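(* Let $(f_w)_{w\in2\mathbb{N},\,w\ge4}$ denote the sequence of normalized extremal quasimodular forms of depth $2$ ($f_w$ of weight $w$). Then $$f_4=\frac1{288}\left(E_4-E_2^2\right),$$ and for every $w\ge4$ with $w\equiv0\pmod4$, $$f_{w+4}=\frac{3(w+4)^2}{16(w+1)(w+2)^2(w+3)}\left(\frac{(w+1)w}{36}E_4f_w-\partial_{w-2}^2f_w\right),$$ $$f_{w+2}=\frac6{w+1}\partial_{w-2}f_w.$$
   Context: $\mathcal{M}_k$ is the space of holomorphic modular forms of weight $k$ for $\mathrm{PSL}(2,\mathbb{Z})$ ($\mathcal{M}_k=0$ for $k<0$); $q=e^{2\pi iz}$; $E_{2k}=1-\frac{4k}{B_{2k}}\sum_{n\ge1}\sigma_{2k-1}(n)q^n$ ($k\ge1$). $f'=\frac1{2\pi i}\frac{df}{dz}$; the Serre derivative is $\partial_kf=f'-\frac k{12}E_2f$, iterated as $\partial_k^0f=f$, $\partial_k^{j+1}f=\partial_{k+2j}(\partial_k^jf)$. $\mathcal{QM}_w^2=\bigoplus_{\ell=0}^2E_2^\ell\mathcal{M}_{w-2\ell}$. A normalized extremal quasimodular form of weight $w$ and depth $2$ (meaning depth $\le 2$) is an element of $\mathcal{QM}_w^2$ of vanishing order $\dim\mathcal{QM}_w^2-1=\lfloor w/4\rfloor$ at $i\infty$ (in $q$) with leading coefficient $1$. *)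

theory Defs
  imports "HOL-Complex_Analysis.Complex_Analysis" "HOL-Library.Function_Algebras"
begin

text \<open>
  Functions on the upper half plane are represented by functions of type
  \<open>complex \<Rightarrow> complex\<close> that are 0 outside it. In this way equality of functions
  and the dimension of a space of such functions have their usual meaning.
\<close>

definition upper_half_plane :: "complex set" where
  "upper_half_plane = {z. Im z > 0}"

definition nome :: "complex \<Rightarrow> complex" where
  "nome z = exp (2 * of_real pi * \<i> * z)"

text \<open>
  A \<open>q\<close>-expansion valid on all of the upper half plane. Since \<open>F\<close> is a power
  series in \<open>q\<close>, having such an expansion is holomorphy at \<open>\<i>\<infinity>\<close> for a
  1-periodic holomorphic function; \<open>F\<close> is uniquely determined by \<open>f\<close>.
\<close>

definition has_q_expansion :: "(complex \<Rightarrow> complex) \<Rightarrow> complex fps \<Rightarrow> bool" where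
  "has_q_expansion f F \<longleftrightarrow>
     (\<forall>z\<in>upper_half_plane. (\<lambda>n. fps_nth F n * nome z ^ n) sums f z)"

definition modular_forms :: "int \<Rightarrow> (complex \<Rightarrow> complex) set" where
  "modular_forms k =
     {f. f holomorphic_on upper_half_plane \<and>
         (\<forall>z. z \<notin> upper_half_plane \<longrightarrow> f z = 0) \<and>
         (\<forall>a b c d :: int. a * d - b * c = 1 \<longrightarrow>
            (\<forall>z\<in>upper_half_plane.
               f ((of_int a * z + of_int b) / (of_int c * z + of_int d)) =
               (of_int c * z + of_int d) powi k * f z)) \<and>
         (\<exists>F. has_q_expansion f F)}"

text \<open>The Bernoulli numbers, by \<open>x / (e\<^sup>x - 1) = \<Sum>\<^sub>n B\<^sub>n x\<^sup>n / n!\<close>.\<close>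

definition bernoulli_number :: "nat \<Rightarrow> complex" where
  "bernoulli_number n = fact n * fps_nth (fps_X / (fps_exp 1 - 1)) n"

definition divisor_sum :: "nat \<Rightarrow> nat \<Rightarrow> nat" where
  "divisor_sum j n = (\<Sum>d | d dvd n. d ^ j)"

text \<open>Here \<open>k\<close> is the weight itself, to be used for even \<open>k \<ge> 2\<close>.\<close>

definition eisenstein :: "nat \<Rightarrow> complex \<Rightarrow> complex" where
  "eisenstein k z =
     (if z \<in> upper_half_plane
      then 1 - 2 * of_nat k / bernoulli_number k *
             (\<Sum>n. of_nat (divisor_sum (k - 1) (Suc n)) * nome z ^ Suc n)
      else 0)"

abbreviation E2 :: "complex \<Rightarrow> complex" where "E2 \<equiv> eisenstein 2"

abbreviation E4 :: "complex \<Rightarrow> complex" where "E4 \<equiv> eisenstein 4"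

text \<open>
  The derivatives below are meaningful only at points of the upper half plane;
  their values elsewhere are unspecified.
\<close>

definition qderiv :: "(complex \<Rightarrow> complex) \<Rightarrow> complex \<Rightarrow> complex" where
  "qderiv f z = 1 / (2 * of_real pi * \<i>) * deriv f z"

definition serre_deriv :: "int \<Rightarrow> (complex \<Rightarrow> complex) \<Rightarrow> complex \<Rightarrow> complex" where
  "serre_deriv k f z = qderiv f z - of_int k / 12 * E2 z * f z"

fun serre_deriv_iter :: "int \<Rightarrow> nat \<Rightarrow> (complex \<Rightarrow> complex) \<Rightarrow> complex \<Rightarrow> complex" where
  "serre_deriv_iter k 0 f = f"
| "serre_deriv_iter k (Suc j) f = serre_deriv (k + 2 * int j) (serre_deriv_iter k j f)"

definition quasimodular_forms :: "int \<Rightarrow> nat \<Rightarrow> (complex \<Rightarrow> complex) set" where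
  "quasimodular_forms w p =
     {f. \<exists>g. (\<forall>l\<le>p. g l \<in> modular_forms (w - 2 * int l)) \<and>
             f = (\<lambda>z. \<Sum>l\<le>p. E2 z ^ l * g l z)}"

definition fun_scale :: "complex \<Rightarrow> (complex \<Rightarrow> complex) \<Rightarrow> complex \<Rightarrow> complex" where
  "fun_scale c f = (\<lambda>z. c * f z)"

lemma vector_space_fun_scale: "vector_space fun_scale"
  by unfold_locales (auto simp: fun_scale_def algebra_simps)

definition cdim :: "(complex \<Rightarrow> complex) set \<Rightarrow> nat" where
  "cdim = vector_space.dim fun_scale"

definition normalized_extremal :: "int \<Rightarrow> nat \<Rightarrow> (complex \<Rightarrow> complex) \<Rightarrow> bool" where
  "normalized_extremal w p f \<longleftrightarrow>
     f \<in> quasimodular_forms w p \<and>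
     (\<exists>F. has_q_expansion f F \<and>
          subdegree F = cdim (quasimodular_forms w p) - 1 \<and>
          fps_nth F (subdegree F) = 1)"

end

theory Submission
  imports Defs
begin

text \<open>
  Write \<open>P, Q, R\<close> for the \<open>q\<close>-expansions of \<open>E\<^sub>2, E\<^sub>4, E\<^sub>6\<close>. The quasimodularity of \<open>E\<^sub>2\<close> makes
  \<open>\<partial>\<^sub>k\<close> a derivation raising the weight by 2, and with the valence inequality it gives
  \<open>12 P' = P\<^sup>2 - Q\<close>, \<open>\<partial>Q = -R/3\<close>, \<open>\<partial>R = -Q\<^sup>2/2\<close>. Starting from \<open>f\<^sub>0 = 1\<close>, the recursion produces forms
  \<open>f\<^sub>w\<close> (\<open>4 | w\<close>) satisfying the third order equation
  \<open>\<partial>\<^sup>3f + (1/36 - w\<^sup>2/48) Q \<partial>f + (w\<^sup>2/288 - w\<^sup>3/864 - 1/216) R f = 0\<close>; this is preserved by the recursion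
  by a formal computation, and it determines the second coefficient of \<open>f\<^sub>w\<close>, hence the leading
  coefficient of \<open>f\<^bsub>w+4\<^esub>\<close>. So \<open>f\<^sub>w\<close> has order exactly \<open>w/4\<close>, and \<open>\<partial>f\<^sub>w\<close> has the same order in weight
  \<open>w + 2\<close>. Multiplying by powers of \<open>Q\<close> yields elements of \<open>\<Q>\<M>\<^sub>w\<close> of every order
  \<open>0, ..., \<lfloor>w/4\<rfloor>\<close>. Since \<open>dim \<M>\<^sub>w + dim \<M>\<^bsub>w-2\<^esub> + dim \<M>\<^bsub>w-4\<^esub> \<le> \<lfloor>w/4\<rfloor> + 1\<close>, these form a basis;
  therefore a quasimodular form of larger order vanishes, and extremal forms are unique.
\<close>

subsection \<open>Expansions in \<open>q\<close>\<close>

text \<open>The analytic obstacle is that the lattice series of weight 2 converges only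
  conditionally, so \<open>E2\<close> acquires the extra term \<open>6 z / (pi i)\<close> under
  \<open>z \<mapsto> - 1 / z\<close>. This one term is what makes Serre derivatives modular, makes
  \<open>E2^2 - 12 E2'\<close> modular of weight 4, and gives the exponential of the integrated
  \<open>E2\<close> the transformation law of the discriminant, from which the valence inequality
  follows. The valence inequality bounds dimensions only from above, and it is not sharp in weights
  congruent to 2 modulo 12, where a separate argument gains one coefficient. The matching lower
  bound has to come from the extremal forms themselves. Hence their exact orders must be known
  before any uniqueness is available, and the recursion is studied by itself, not derived from
  extremality. Its first cancellation is automatic; whether the next coefficient is nonzero depends
  on data that modularity alone does not reveal, and for this the differential equation is carried
  along.\<close>

lemma norm_nome: "norm (nome z) = exp (-(2 * pi * Im z))"
  by (simp add: nome_def)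

lemma nome_nonzero [simp]: "nome z \<noteq> 0"
  by (simp add: nome_def)

lemma norm_nome_less_1: "z \<in> upper_half_plane \<Longrightarrow> norm (nome z) < 1"
  by (simp add: norm_nome upper_half_plane_def)

lemma open_upper_half_plane [simp]: "open upper_half_plane"
  unfolding upper_half_plane_def by (rule open_halfspace_Im_gt)

lemma convex_upper_half_plane [simp]: "convex upper_half_plane"
  unfolding upper_half_plane_def by (rule convex_halfspace_Im_gt)

lemma nome_surj:
  assumes "q \<noteq> 0" "norm q < 1"
  obtains z where "z \<in> upper_half_plane" "nome z = q"
proof
  define z where "z = Ln q / (2 * of_real pi * \<i>)"
  show "nome z = q" using assms by (simp add: nome_def z_def)
  have "Im z = - ln (norm q) / (2 * pi)"
    using assms by (simp add: z_def Im_divide power2_eq_square)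
  then show "z \<in> upper_half_plane" using assms
    by (simp add: upper_half_plane_def divide_neg_pos)
qed

text \<open>\<open>nome\<close> takes every real value in (0,1), so convergence at all points of the
  half plane forces radius of convergence at least 1. From here on expansions are handled through
  \<open>eval_fps\<close> on the unit disc.\<close>

lemma has_q_expansion_iff:
  "has_q_expansion f F \<longleftrightarrow>
     fps_conv_radius F \<ge> 1 \<and> (\<forall>z\<in>upper_half_plane. f z = eval_fps F (nome z))"
proof (intro iffI conjI ballI)
  assume *: "has_q_expansion f F"
  show "fps_conv_radius F \<ge> 1"
    unfolding fps_conv_radius_def
  proof (rule conv_radius_geI_ex')
    fix r :: real assume r: "0 < r" "ereal r < 1"
    obtain z where "z \<in> upper_half_plane" "nome z = of_real r"
      by (rule nome_surj[of "of_real r"]) (use r in auto)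
    with * show "summable (\<lambda>n. fps_nth F n * (of_real r) ^ n)"
      by (auto simp: has_q_expansion_def sums_iff)
  qed
next
  fix z assume "has_q_expansion f F" "z \<in> upper_half_plane"
  then show "f z = eval_fps F (nome z)"
    by (simp add: has_q_expansion_def sums_iff eval_fps_def)
next
  assume *: "fps_conv_radius F \<ge> 1 \<and> (\<forall>z\<in>upper_half_plane. f z = eval_fps F (nome z))"
  show "has_q_expansion f F" unfolding has_q_expansion_def
  proof
    fix z assume z: "z \<in> upper_half_plane"
    have "ereal (norm (nome z)) < 1" using norm_nome_less_1[OF z] by simp
    with * have "ereal (norm (nome z)) < fps_conv_radius F" by (meson less_le_trans)
    from sums_eval_fps[OF this] show "(\<lambda>n. fps_nth F n * nome z ^ n) sums f z"
      using * z by simp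
  qed
qed

lemma norm_nome_less_conv_radius:
  assumes "z \<in> upper_half_plane" "fps_conv_radius F \<ge> 1"
  shows "ereal (norm (nome z)) < fps_conv_radius F"
  using norm_nome_less_1[OF assms(1)] assms(2)
  by (auto intro: less_le_trans[of _ 1])

lemma has_q_expansion_unique:
  assumes "has_q_expansion f F" "has_q_expansion g G"
    and "\<And>z. z \<in> upper_half_plane \<Longrightarrow> f z = g z"
  shows "F = G"
proof -
  have F: "fps_conv_radius F \<ge> 1" and G: "fps_conv_radius G \<ge> 1"
    using assms by (auto simp: has_q_expansion_iff)
  have eq: "eval_fps F q = eval_fps G q" if "q \<noteq> 0" "norm q < 1" for q
    using nome_surj[OF that] assms by (metis has_q_expansion_iff)
  have pos: "fps_conv_radius F > 0" "fps_conv_radius G > 0"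
    using F G by (auto intro: less_le_trans[of _ 1])
  \<comment> \<open>\<open>nome\<close> omits the value 0, so agreement at the centre of the disc
    has to come from continuity.\<close>
  then have cF: "isCont (eval_fps F) 0" and cG: "isCont (eval_fps G) 0"
    by (auto intro!: continuous_eval_fps simp flip: zero_ereal_def)
  have "eventually (\<lambda>q. q \<in> ball 0 1 - {0}) (at (0::complex))"
    by (rule eventually_at_in_open) auto
  then have "eventually (\<lambda>q. eval_fps F q = eval_fps G q) (at 0)"
    by eventually_elim (use eq in auto)
  with cF have "(eval_fps G \<longlongrightarrow> eval_fps F 0) (at 0)"
    by (simp add: isCont_def filterlim_cong)
  with cG have "eval_fps F 0 = eval_fps G 0"
    unfolding isCont_def using tendsto_unique[of "at (0::complex)" "eval_fps G"] by simp
  with eq have eq': "eval_fps F q = eval_fps G q" if "norm q < 1" for q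
    using that by (cases "q = 0") auto
  show ?thesis
  proof (rule eval_fps_eqD)
    show "fps_conv_radius F > 0" "fps_conv_radius G > 0"
      by (fact pos)+
    have "eventually (\<lambda>q. q \<in> ball 0 1) (nhds (0::complex))"
      by (rule eventually_nhds_in_open) auto
    then show "\<forall>\<^sub>F z in nhds 0. eval_fps F z = eval_fps G z"
      by eventually_elim (use eq' in auto)
  qed
qed

lemma has_q_expansion_cong:
  "(\<And>z. z \<in> upper_half_plane \<Longrightarrow> f z = g z) \<Longrightarrow> has_q_expansion f F \<longleftrightarrow> has_q_expansion g F"
  by (simp add: has_q_expansion_def)

lemma has_q_expansion_const: "has_q_expansion (\<lambda>_. c) (fps_const c)"
  by (simp add: has_q_expansion_iff)

lemma has_q_expansion_0: "has_q_expansion (\<lambda>_. 0) 0"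
  by (simp add: has_q_expansion_iff)

lemma has_q_expansion_add:
  assumes "has_q_expansion f F" "has_q_expansion g G"
  shows "has_q_expansion (\<lambda>z. f z + g z) (F + G)"
  using assms by (auto simp: has_q_expansion_def fps_add_nth ring_distribs intro: sums_add)

lemma has_q_expansion_diff:
  assumes "has_q_expansion f F" "has_q_expansion g G"
  shows "has_q_expansion (\<lambda>z. f z - g z) (F - G)"
  using assms by (auto simp: has_q_expansion_def left_diff_distrib intro: sums_diff)

lemma has_q_expansion_mult:
  assumes "has_q_expansion f F" "has_q_expansion g G"
  shows "has_q_expansion (\<lambda>z. f z * g z) (F * G)"
  unfolding has_q_expansion_iff
proof (intro conjI ballI)
  have F: "fps_conv_radius F \<ge> 1" and G: "fps_conv_radius G \<ge> 1"
    using assms by (auto simp: has_q_expansion_iff)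
  show "fps_conv_radius (F * G) \<ge> 1"
    using fps_conv_radius_mult[of F G] F G by (meson min.boundedI order_trans)
  fix z assume z: "z \<in> upper_half_plane"
  show "f z * g z = eval_fps (F * G) (nome z)"
    using assms z norm_nome_less_conv_radius[OF z F] norm_nome_less_conv_radius[OF z G]
    by (simp add: has_q_expansion_iff eval_fps_mult)
qed

lemma has_q_expansion_cmult:
  "has_q_expansion f F \<Longrightarrow> has_q_expansion (\<lambda>z. c * f z) (fps_const c * F)"
  by (intro has_q_expansion_mult has_q_expansion_const)

lemma has_q_expansion_power:
  "has_q_expansion f F \<Longrightarrow> has_q_expansion (\<lambda>z. f z ^ n) (F ^ n)"
proof (induction n)
  case 0
  show ?case using has_q_expansion_const[of 1] by simp
next
  case (Suc n)
  then show ?case using has_q_expansion_mult by simp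
qed

lemma has_field_derivative_nome:
  "(nome has_field_derivative (2 * of_real pi * \<i> * nome z)) (at z)"
  unfolding nome_def by (auto intro!: derivative_eq_intros)

lemma has_q_expansion_has_derivative:
  assumes "has_q_expansion f F" "z \<in> upper_half_plane"
  shows "(f has_field_derivative (2 * of_real pi * \<i> * eval_fps (fps_X * fps_deriv F) (nome z))) (at z)"
proof -
  have F: "fps_conv_radius F \<ge> 1" using assms by (auto simp: has_q_expansion_iff)
  have dF: "fps_conv_radius (fps_deriv F) \<ge> 1" using F fps_conv_radius_deriv by (metis order_trans)
  have *: "((\<lambda>z. eval_fps F (nome z)) has_field_derivative
           (eval_fps (fps_deriv F) (nome z) * (2 * of_real pi * \<i> * nome z))) (at z)"
    by (rule DERIV_chain2[OF has_field_derivative_eval_fps has_field_derivative_nome])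
       (use norm_nome_less_conv_radius[OF assms(2) F] in auto)
  have "eval_fps (fps_X * fps_deriv F) (nome z) = nome z * eval_fps (fps_deriv F) (nome z)"
    using norm_nome_less_conv_radius[OF assms(2) dF] by (subst eval_fps_mult) auto
  with * have *: "((\<lambda>z. eval_fps F (nome z)) has_field_derivative
           (2 * of_real pi * \<i> * eval_fps (fps_X * fps_deriv F) (nome z))) (at z)"
    by (simp add: mult_ac)
  show ?thesis
    by (rule has_field_derivative_transform_within_open[OF * open_upper_half_plane assms(2)])
       (use assms in \<open>auto simp: has_q_expansion_iff\<close>)
qed

lemma has_q_expansion_holomorphic:
  "has_q_expansion f F \<Longrightarrow> f holomorphic_on upper_half_plane"
  by (subst holomorphic_on_open) (auto dest: has_q_expansion_has_derivative)

lemma has_q_expansion_qderiv: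
  assumes "has_q_expansion f F"
  shows "has_q_expansion (qderiv f) (fps_X * fps_deriv F)"
  unfolding has_q_expansion_iff
proof (intro conjI ballI)
  have F: "fps_conv_radius F \<ge> 1" using assms by (auto simp: has_q_expansion_iff)
  have dF: "fps_conv_radius (fps_deriv F) \<ge> 1" using F fps_conv_radius_deriv by (metis order_trans)
  then show "fps_conv_radius (fps_X * fps_deriv F) \<ge> 1"
    using fps_conv_radius_mult[of fps_X "fps_deriv F"] by simp
  fix z assume "z \<in> upper_half_plane"
  from has_q_expansion_has_derivative[OF assms this]
  show "qderiv f z = eval_fps (fps_X * fps_deriv F) (nome z)"
    by (simp add: qderiv_def DERIV_imp_deriv)
qed

lemma has_q_expansion_periodic:
  assumes "has_q_expansion f F" "z \<in> upper_half_plane"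
  shows "f (z + of_int n) = f z"
proof -
  have "nome (z + of_int n) = nome z * exp (\<i> * (of_int n * (of_real pi * 2)))"
    by (simp add: nome_def ring_distribs exp_add mult_ac)
  also have "exp (\<i> * (of_int n * (of_real pi * 2))) = 1"
    using exp_integer_2pi[of "of_int n"] by (simp add: mult_ac)
  finally have "nome (z + of_int n) = nome z" by simp
  moreover have "z + of_int n \<in> upper_half_plane" using assms by (simp add: upper_half_plane_def)
  ultimately show ?thesis using assms by (simp add: has_q_expansion_iff)
qed

subsection \<open>The Lipschitz formula\<close>

lemma upper_half_plane_not_nonpos_Int:
  assumes "z \<in> upper_half_plane"
  shows "z \<notin> \<int>\<^sub>\<le>\<^sub>0" "1 - z \<notin> \<int>\<^sub>\<le>\<^sub>0"
  using assms by (auto simp: upper_half_plane_def elim!: nonpos_Ints_cases dest: arg_cong[where f=Im])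

lemma sin_pi_nonzero:
  assumes "z \<notin> \<int>"
  shows "sin (of_real pi * z :: complex) \<noteq> 0"
proof
  assume "sin (of_real pi * z) = 0"
  then obtain n where "of_real pi * z = of_real (of_int n * pi)" by (auto simp: Complex_Transcendental.sin_eq_0)
  then have "z = of_int n" by simp
  with assms show False by simp
qed

text \<open>Derivative of \<open>rGamma z * rGamma (1 - z) = sin (pi z) / pi\<close>, divided by the
  same product. Using the reciprocal Gamma function keeps both sides entire.\<close>

lemma Digamma_reflection:
  assumes "z \<notin> \<int>"
  shows "Digamma (1 - z) - Digamma z = of_real pi * cot (of_real pi * z :: complex)"
proof -
  have z: "z \<notin> \<int>\<^sub>\<le>\<^sub>0" "1 - z \<notin> \<int>\<^sub>\<le>\<^sub>0"
    using assms by (auto elim!: nonpos_Ints_cases) (metis Ints_1 Ints_diff Ints_of_int diff_diff_eq2 add_diff_cancel_left')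
  have 1: "((\<lambda>z. rGamma z * rGamma (1 - z)) has_field_derivative
      rGamma z * rGamma (1 - z) * (Digamma (1 - z) - Digamma z)) (at z)"
    using z by (auto intro!: derivative_eq_intros simp: algebra_simps)
  have 2: "((\<lambda>z. sin (of_real pi * z) / of_real pi) has_field_derivative cos (of_real pi * z)) (at z)"
    by (auto intro!: derivative_eq_intros)
  have "rGamma z * rGamma (1 - z) * (Digamma (1 - z) - Digamma z) = cos (of_real pi * z)"
    using DERIV_unique[OF 1] 2 by (simp add: rGamma_reflection_complex)
  then show ?thesis
    using sin_pi_nonzero[OF assms] by (simp add: rGamma_reflection_complex cot_def field_simps)
qed

text \<open>The two halves of the symmetric sum are truncated Digamma series at \<open>p\<close> and
  \<open>1 - p\<close>, whose logarithms cancel. The interval contains \<open>N + 1\<close>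
  nonnegative integers but only \<open>N\<close> negative ones; the surplus term
  \<open>inverse (p + of_nat N)\<close> tends to 0.\<close>

lemma symmetric_sum_tendsto_cot:
  assumes "p \<notin> \<int>"
  shows "(\<lambda>N. \<Sum>c=-int N..int N. 1 / (of_int c + p)) \<longlonglongrightarrow> of_real pi * cot (of_real pi * p :: complex)"
proof -
  have "p \<noteq> 0" "1 - p \<noteq> 0" using assms by auto
  note lim = Digamma_LIMSEQ[OF \<open>1 - p \<noteq> 0\<close>] Digamma_LIMSEQ[OF \<open>p \<noteq> 0\<close>]
  have split: "(\<Sum>c=-int N..int N. 1 / (of_int c + p)) =
      (\<Sum>n<Suc N. inverse (p + of_nat n)) - (\<Sum>n<N. inverse (1 - p + of_nat n))" for N
  proof (induction N)
    case (Suc N)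
    have "{-int (Suc N)..int (Suc N)} = insert (-int (Suc N)) (insert (int (Suc N)) {-int N..int N})"
      by auto
    then have "(\<Sum>c=-int (Suc N)..int (Suc N). 1 / (of_int c + p)) =
        1 / (- of_nat (Suc N) + p) + (1 / (of_nat (Suc N) + p) + (\<Sum>c=-int N..int N. 1 / (of_int c + p)))"
      by simp
    also have "1 / (- of_nat (Suc N) + p) = - inverse (1 - p + of_nat N)"
    proof -
      have "- of_nat (Suc N) + p = - (1 - p + of_nat N)" by simp
      then show ?thesis by (simp only: divide_minus_right inverse_eq_divide)
    qed
    finally show ?case unfolding Suc.IH by (simp add: inverse_eq_divide add_ac)
  qed (simp add: inverse_eq_divide)
  have inv0: "(\<lambda>N. inverse (p + of_nat N)) \<longlonglongrightarrow> 0"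
    by (rule filterlim_compose[OF tendsto_inverse_0 tendsto_add_filterlim_at_infinity[OF tendsto_const tendsto_of_nat]])
  have "(\<lambda>N. (of_real (ln (real N)) - (\<Sum>n<N. inverse (1 - p + of_nat n)))
       - (of_real (ln (real N)) - (\<Sum>n<N. inverse (p + of_nat n))) + inverse (p + of_nat N))
       \<longlonglongrightarrow> Digamma (1 - p) - Digamma p + 0"
    by (intro tendsto_intros lim inv0)
  also have "(\<lambda>N. (of_real (ln (real N)) - (\<Sum>n<N. inverse (1 - p + of_nat n)))
       - (of_real (ln (real N)) - (\<Sum>n<N. inverse (p + of_nat n))) + inverse (p + of_nat N)) =
       (\<lambda>N. \<Sum>c=-int N..int N. 1 / (of_int c + p))"
    by (simp add: split fun_eq_iff)
  finally show ?thesis using Digamma_reflection[OF assms] by simp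
qed

text \<open>Comparison with the geometric series after \<open>k\<close> applications of
  \<open>q d/dq\<close>, whose coefficients are exactly \<open>n ^ k\<close> and whose radius is
  unaffected by differentiation.\<close>

lemma conv_radius_polynomial_growth:
  fixes F :: "complex fps"
  assumes "\<And>n. norm (fps_nth F n) \<le> real n ^ k"
  shows "fps_conv_radius F \<ge> 1"
proof -
  define D :: "complex fps \<Rightarrow> complex fps" where "D = (\<lambda>G. fps_X * fps_deriv G)"
  define G where "G = (D ^^ k) (Abs_fps (\<lambda>_. 1))"
  have D: "fps_conv_radius (D H) \<ge> 1" if "fps_conv_radius H \<ge> 1" for H
    using fps_conv_radius_mult[of fps_X "fps_deriv H"] fps_conv_radius_deriv[of H] that
    by (auto simp: D_def min_def split: if_splits intro: order_trans)
  have nth: "fps_nth ((D ^^ j) (Abs_fps (\<lambda>_. 1))) n = of_nat n ^ j" for j n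
  proof (induction j)
    case (Suc j)
    then show ?case by (cases n) (auto simp: D_def)
  qed simp
  have "fps_conv_radius ((D ^^ j) (Abs_fps (\<lambda>_. 1))) \<ge> 1" for j
  proof (induction j)
    case 0
    show ?case unfolding fps_conv_radius_def
      by (rule conv_radius_geI_ex') (auto intro!: summable_geometric)
  qed (use D in auto)
  then have "1 \<le> fps_conv_radius G" by (simp add: G_def)
  then have s: "summable (\<lambda>n. norm (fps_nth G n * of_real r ^ n))" if "0 < r" "r < 1" for r
    using that by (intro norm_summable_fps) (auto intro: less_le_trans[of _ 1])
  show ?thesis unfolding fps_conv_radius_def
  proof (rule conv_radius_geI_ex')
    fix r :: real assume r: "0 < r" "ereal r < 1"
    show "summable (\<lambda>n. fps_nth F n * of_real r ^ n)"
      by (rule summable_comparison_test'[OF s[of r], of 0])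
         (use r assms in \<open>auto simp: G_def nth norm_mult norm_power intro!: mult_right_mono\<close>)
  qed
qed

text \<open>The case distinction matters only for \<open>j = 0\<close>, since
  \<open>0 ^ 0 = 1\<close>.\<close>

definition power_fps :: "nat \<Rightarrow> complex fps" where
  "power_fps j = Abs_fps (\<lambda>n. if n = 0 then 0 else of_nat n ^ j)"

lemma conv_radius_power_fps: "fps_conv_radius (power_fps j) \<ge> 1"
  by (rule conv_radius_polynomial_growth[of _ j]) (auto simp: power_fps_def norm_power)

lemma power_fps_Suc: "fps_X * fps_deriv (power_fps j) = power_fps (Suc j)"
proof (rule fps_ext)
  fix n show "fps_nth (fps_X * fps_deriv (power_fps j)) n = fps_nth (power_fps (Suc j)) n"
    by (cases n) (auto simp: power_fps_def)
qed

text \<open>The polylogarithm of order \<open>- j\<close> at \<open>nome z\<close>. Differentiation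
  in \<open>z\<close> raises \<open>j\<close> by one and contributes \<open>2 pi i\<close>.\<close>

definition lambert :: "nat \<Rightarrow> complex \<Rightarrow> complex" where
  "lambert j z = eval_fps (power_fps j) (nome z)"

lemma has_q_expansion_lambert: "has_q_expansion (lambert j) (power_fps j)"
  by (simp add: has_q_expansion_iff lambert_def conv_radius_power_fps)

lemma lambert_deriv:
  assumes "z \<in> upper_half_plane"
  shows "(lambert j has_field_derivative 2 * of_real pi * \<i> * lambert (Suc j) z) (at z)"
  using has_q_expansion_has_derivative[OF has_q_expansion_lambert assms, of j]
  by (simp add: power_fps_Suc lambert_def)

lemma lambert_has_sum:
  assumes "z \<in> upper_half_plane"
  shows "((\<lambda>n. of_nat n ^ j * nome z ^ n) has_sum lambert j z) {1..}"
    and "(\<lambda>n. norm (of_nat n ^ j * nome z ^ n)) summable_on {1..}"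
proof -
  have r: "ereal (norm (nome z)) < fps_conv_radius (power_fps j)"
    by (rule norm_nome_less_conv_radius[OF assms conv_radius_power_fps])
  have s: "summable (\<lambda>n. norm (fps_nth (power_fps j) n * nome z ^ n))"
    by (rule norm_summable_fps[OF r])
  have "((\<lambda>n. fps_nth (power_fps j) n * nome z ^ n) has_sum lambert j z) UNIV"
    unfolding lambert_def by (rule norm_summable_imp_has_sum[OF s sums_eval_fps[OF r]])
  also have "?this \<longleftrightarrow> ((\<lambda>n. of_nat n ^ j * nome z ^ n) has_sum lambert j z) {1..}"
    by (rule has_sum_cong_neutral) (auto simp: power_fps_def)
  finally show "((\<lambda>n. of_nat n ^ j * nome z ^ n) has_sum lambert j z) {1..}" .
  from s have "(\<lambda>n. norm (fps_nth (power_fps j) n * nome z ^ n)) summable_on UNIV"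
    by (intro norm_summable_imp_summable_on) auto
  also have "?this \<longleftrightarrow> (\<lambda>n. norm (of_nat n ^ j * nome z ^ n)) summable_on {1..}"
    by (rule summable_on_cong_neutral) (auto simp: power_fps_def)
  finally show "(\<lambda>n. norm (of_nat n ^ j * nome z ^ n)) summable_on {1..}" .
qed

lemma lambert_0:
  assumes "z \<in> upper_half_plane"
  shows "lambert 0 z = nome z / (1 - nome z)"
  using lambert_has_sum(1)[OF assms, of 0]
    has_sum_geometric_from_1[OF norm_nome_less_1[OF assms]] has_sum_unique by fastforce

lemma pi_cot_lambert:
  assumes "z \<in> upper_half_plane"
  shows "of_real pi * cot (of_real pi * z) = - of_real pi * \<i> - 2 * of_real pi * \<i> * lambert 0 z"
proof -
  define w where "w = exp (\<i> * of_real pi * z)"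
  have w: "w \<noteq> 0" by (simp add: w_def)
  have q: "nome z = w ^ 2"
    by (simp add: w_def nome_def mult_ac flip: exp_double)
  have n1: "norm (nome z) < 1" by (rule norm_nome_less_1[OF assms])
  then have ne: "w ^ 2 \<noteq> 1" by (auto simp: q)
  have l: "lambert 0 z = w ^ 2 / (1 - w ^ 2)"
    using lambert_0[OF assms] by (simp add: q)
  have "\<i> * (of_real pi * z) = \<i> * of_real pi * z" by (simp add: mult_ac)
  then have cs: "cos (of_real pi * z) = (w + inverse w) / 2" "sin (of_real pi * z) = (w - inverse w) / (2 * \<i>)"
    by (simp_all only: cos_exp_eq sin_exp_eq exp_minus w_def)
  have aux: "(a / 2) / (b / (2 * \<i>)) = \<i> * a / b" for a b
    by (cases "b = 0") (simp_all add: field_simps)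
  have "cot (of_real pi * z) = \<i> * (w + inverse w) / (w - inverse w)"
    unfolding cot_def cs by (rule aux)
  also have "\<dots> = \<i> * (w ^ 2 + 1) / (w ^ 2 - 1)"
    using w ne by (simp add: divide_simps) (simp add: algebra_simps power2_eq_square)
  also have "\<dots> = - \<i> - 2 * \<i> * (w ^ 2 / (1 - w ^ 2))"
    using ne by (simp add: divide_simps) (simp add: algebra_simps)
  finally have c: "cot (of_real pi * z) = - \<i> - 2 * \<i> * (w ^ 2 / (1 - w ^ 2))" .
  show ?thesis unfolding c l by (simp add: algebra_simps)
qed

text \<open>The reflection formula, with the cotangent expanded in \<open>nome\<close>, is
  differentiated repeatedly on the open half plane: once for weight 2 and three times for weight
  4.\<close>

lemma Polygamma_lambert:
  assumes "z \<in> upper_half_plane"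
  shows "Polygamma 1 z + Polygamma 1 (1 - z) = - 4 * of_real pi ^ 2 * lambert 1 z" (is ?th1)
    and "Polygamma 3 z + Polygamma 3 (1 - z) = 16 * of_real pi ^ 4 * lambert 3 z" (is ?th3)
proof -
  have step: "f' = g'" if "\<And>z. z \<in> upper_half_plane \<Longrightarrow> f z = g z"
     "(f has_field_derivative f') (at z)" "(g has_field_derivative g') (at z)"
     "z \<in> upper_half_plane"
    for f g :: "complex \<Rightarrow> complex" and f' g' z
  proof -
    have "(f has_field_derivative g') (at z)"
      by (rule has_field_derivative_transform_within_open[OF that(3) open_upper_half_plane that(4)])
         (use that(1) in auto)
    then show ?thesis using that(2) DERIV_unique by blast
  qed
  have D: "((\<lambda>z. Polygamma n (1 - z)) has_field_derivative - Polygamma (Suc n) (1 - z)) (at z)"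
    "(Polygamma n has_field_derivative Polygamma (Suc n) z) (at z)"
    if "z \<in> upper_half_plane" for n and z :: complex
    using upper_half_plane_not_nonpos_Int[OF that] by (auto intro!: derivative_eq_intros)
  have 0: "Digamma (1 - z) - Digamma z = - of_real pi * \<i> - 2 * of_real pi * \<i> * lambert 0 z"
    if "z \<in> upper_half_plane" for z
  proof -
    have "z \<notin> \<int>" using that by (auto simp: upper_half_plane_def elim!: Ints_cases)
    then show ?thesis using pi_cot_lambert[OF that] Digamma_reflection by simp
  qed
  have 1: "- Polygamma 1 (1 - z) - Polygamma 1 z =
      - (2 * of_real pi * \<i>) * (2 * of_real pi * \<i> * lambert 1 z)" if z: "z \<in> upper_half_plane" for z
    by (rule step[OF 0 _ _ z]) (auto intro!: derivative_eq_intros D[OF z] lambert_deriv[OF z] simp: upper_half_plane_not_nonpos_Int[OF z] numeral_2_eq_2 numeral_3_eq_3)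
  have 2: "Polygamma 2 (1 - z) - Polygamma 2 z =
      - (2 * of_real pi * \<i>) * (2 * of_real pi * \<i> * (2 * of_real pi * \<i> * lambert 2 z))"
    if z: "z \<in> upper_half_plane" for z
    by (rule step[OF 1 _ _ z]) (auto intro!: derivative_eq_intros D[OF z] lambert_deriv[OF z] simp: upper_half_plane_not_nonpos_Int[OF z] numeral_2_eq_2 numeral_3_eq_3)
  have 3: "- Polygamma 3 (1 - z) - Polygamma 3 z =
      - (2 * of_real pi * \<i>) * (2 * of_real pi * \<i> * (2 * of_real pi * \<i> * (2 * of_real pi * \<i> * lambert 3 z)))"
    if z: "z \<in> upper_half_plane" for z
    by (rule step[OF 2 _ _ z]) (auto intro!: derivative_eq_intros D[OF z] lambert_deriv[OF z] simp: upper_half_plane_not_nonpos_Int[OF z] numeral_2_eq_2 numeral_3_eq_3)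
  have flip: "a + b = - (- b - a)" for a b :: complex by simp
  show ?th1 by (subst flip, subst 1[OF assms]) (simp add: power2_eq_square)
  show ?th3 by (subst flip, subst 3[OF assms]) (simp add: power4_eq_xxxx mult_ac)
qed

lemma norm_lattice_point_bound:
  assumes "z \<in> upper_half_plane"
  obtains K where "K > 0"
    "\<And>(c::int) (d::int) x. x \<in> {of_int d, of_int d - 1/2, of_int d + 1/2} \<Longrightarrow> c \<noteq> 0 \<or> x \<noteq> 0 \<Longrightarrow>
       1 + \<bar>of_int c\<bar> \<le> K * norm (of_int c * z + of_real x) \<and>
       1 + \<bar>of_int d\<bar> \<le> K * norm (of_int c * z + of_real x)"
proof
  define y where "y = Im z"
  define L where "L = 1 / y + 1 + norm z / y"
  have y: "y > 0" using assms by (simp add: y_def upper_half_plane_def)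
  then show "4 * L > 0" by (auto simp: L_def intro!: add_pos_nonneg)
  fix c d :: int and x :: real
  assume x: "x \<in> {of_int d, of_int d - 1/2, of_int d + 1/2}" and nz: "c \<noteq> 0 \<or> x \<noteq> 0"
  define M where "M = norm (of_int c * z + of_real x)"
  have M: "M \<ge> 0" by (simp add: M_def)
  have "\<bar>of_int c * y\<bar> \<le> M"
    using abs_Im_le_cmod[of "of_int c * z + of_real x"] by (simp add: M_def y_def)
  then have c: "\<bar>of_int c\<bar> \<le> M / y" using y by (simp add: abs_mult field_simps)
  have "\<bar>x\<bar> = norm ((of_int c * z + of_real x) - of_int c * z)" by simp
  also have "\<dots> \<le> M + \<bar>of_int c\<bar> * norm z"
    unfolding M_def by (rule order_trans[OF norm_triangle_ineq4]) (simp add: norm_mult)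
  also have "\<dots> \<le> M + M / y * norm z" using c by (intro add_mono mult_right_mono) auto
  finally have x1: "\<bar>x\<bar> \<le> M + M / y * norm z" .
  have LM: "L * M = M / y + M + M / y * norm z" by (simp add: L_def algebra_simps)
  have nn: "0 \<le> M / y" "0 \<le> M / y * norm z" using M y by simp_all
  have 1: "\<bar>of_int c\<bar> \<le> L * M" and 2: "\<bar>x\<bar> \<le> L * M"
    using c x1 M nn unfolding LM by linarith+
  have "1 \<le> 2 * \<bar>x\<bar> \<or> c \<noteq> 0"
  proof (cases "c = 0")
    case True
    with nz have "x \<noteq> 0" by simp
    then have "2 * x \<noteq> 0" by simp
    moreover obtain k :: int where "2 * x = of_int k"
      using x by (auto intro: that[of "2 * d"] that[of "2 * d - 1"] that[of "2 * d + 1"])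
    ultimately show ?thesis
      by (metis abs_mult abs_numeral of_int_0 of_int_1 of_int_abs of_int_le_iff zero_less_abs_iff int_one_le_iff_zero_less of_int_eq_iff)
  qed simp
  then have 3: "1 \<le> 2 * (L * M)"
  proof
    assume "c \<noteq> 0"
    then have "(1::real) \<le> \<bar>of_int c\<bar>" by linarith
    then show ?thesis using 1 by linarith
  qed (use 2 in linarith)
  have "\<bar>of_int d\<bar> \<le> \<bar>x\<bar> + 1/2" using x by auto
  with 1 2 3 have "1 + \<bar>of_int c\<bar> \<le> 4 * (L * M) \<and> 1 + \<bar>of_int d\<bar> \<le> 4 * (L * M)" by linarith
  then show "1 + \<bar>of_int c\<bar> \<le> 4 * L * norm (of_int c * z + of_real x) \<and>
       1 + \<bar>of_int d\<bar> \<le> 4 * L * norm (of_int c * z + of_real x)"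
    by (simp add: M_def mult.assoc)
qed

section \<open>Sums over the integers and the Lipschitz formula\<close>

lemma summable_on_int_iff:
  fixes f :: "int \<Rightarrow> 'a :: banach"
  shows "f summable_on UNIV \<longleftrightarrow>
    (\<lambda>n. f (int n)) summable_on UNIV \<and> (\<lambda>n. f (- int (Suc n))) summable_on UNIV"
proof -
  have 1: "(\<lambda>n. f (int n)) summable_on UNIV \<longleftrightarrow> f summable_on {0..}"
    by (rule summable_on_reindex_bij_witness[of _ nat int]) auto
  have 2: "(\<lambda>n. f (- int (Suc n))) summable_on UNIV \<longleftrightarrow> f summable_on {..<0}"
    by (rule summable_on_reindex_bij_witness[of _ "\<lambda>d. nat (- d - 1)" "\<lambda>n. - int (Suc n)"]) auto
  have U: "UNIV = {0::int..} \<union> {..<0}" by auto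
  show ?thesis unfolding 1 2
  proof (intro iffI conjI)
    assume "f summable_on {0..} \<and> f summable_on {..<0}"
    then have "f summable_on ({0..} \<union> {..<0})" by (intro summable_on_Un_disjoint) auto
    then show "f summable_on UNIV" by (simp only: U)
  qed (auto intro: summable_on_subset_banach)
qed

lemma has_sum_int:
  fixes f :: "int \<Rightarrow> 'a :: banach"
  assumes "((\<lambda>n. f (int n)) has_sum a) UNIV" "((\<lambda>n. f (- int (Suc n))) has_sum b) UNIV"
  shows "(f has_sum (a + b)) UNIV"
proof -
  have 1: "(f has_sum a) {0..}"
    by (rule has_sum_reindex_bij_witness[of _ nat int, THEN iffD1, OF _ _ _ _ _ _ assms(1)]) auto
  have 2: "(f has_sum b) {..<0}"
    by (rule has_sum_reindex_bij_witness[of _ "\<lambda>d. nat (- d - 1)" "\<lambda>n. - int (Suc n)", THEN iffD1, OF _ _ _ _ _ _ assms(2)]) auto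
  have U: "UNIV = {0::int..} \<union> {..<0}" by auto
  show ?thesis unfolding U by (rule has_sum_Un_disjoint[OF 1 2]) auto
qed

lemma summable_inverse_square_int: "(\<lambda>d::int. 1 / (1 + \<bar>of_int d\<bar> :: real) ^ 2) summable_on UNIV"
proof -
  have s: "summable (\<lambda>n. 1 / (real (Suc n)) ^ 2)"
    by (subst summable_Suc_iff) (use inverse_power_summable[of 2] in \<open>simp add: inverse_eq_divide\<close>)
  have "(\<lambda>n. 1 / (real (Suc n)) ^ 2) summable_on UNIV"
    by (rule norm_summable_imp_summable_on) (use s in simp)
  moreover have "(\<lambda>n. 1 / (real (Suc (Suc n))) ^ 2) summable_on UNIV"
    by (rule norm_summable_imp_summable_on) (use s summable_Suc_iff[of "\<lambda>n. 1 / (real (Suc n)) ^ 2"] in simp)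
  ultimately show ?thesis by (simp add: summable_on_int_iff add_ac)
qed

text \<open>For odd \<open>n\<close> the exponent \<open>Suc n\<close> is even, so the terms with
  negative \<open>d\<close> are, without a sign, the terms of the Polygamma series at
  \<open>1 - z\<close>; moreover the exponent is at least 2, which gives absolute
  convergence.\<close>

lemma Polygamma_has_sum_int:
  assumes z: "z \<in> upper_half_plane" and n: "odd n"
  shows "((\<lambda>d::int. 1 / (z + of_int d) ^ Suc n) has_sum
     ((Polygamma n z + Polygamma n (1 - z)) / fact n)) UNIV"
proof -
  obtain K where K: "K > 0" "\<And>(c::int) (d::int) x. x \<in> {of_int d, of_int d - 1/2, of_int d + 1/2} \<Longrightarrow> c \<noteq> 0 \<or> x \<noteq> 0 \<Longrightarrow>
       1 + \<bar>of_int c\<bar> \<le> K * norm (of_int c * z + of_real x) \<and>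
       1 + \<bar>of_int d\<bar> \<le> K * norm (of_int c * z + of_real x)"
    using norm_lattice_point_bound[OF z] by metis
  have bound: "norm (1 / (z + of_int d) ^ Suc n) \<le> K ^ Suc n * (1 / (1 + \<bar>of_int d\<bar>) ^ 2)" for d :: int
  proof -
    have *: "1 + \<bar>of_int d\<bar> \<le> K * norm (z + of_int d)" using K(2)[of "of_int d" d 1] by simp
    have "(1 + \<bar>of_int d\<bar> :: real) ^ 2 \<le> (1 + \<bar>of_int d\<bar>) ^ Suc n"
      using n by (intro power_increasing) (auto elim: oddE)
    also have "\<dots> \<le> (K * norm (z + of_int d)) ^ Suc n" by (rule power_mono[OF *]) auto
    finally have "(1 + \<bar>of_int d\<bar> :: real) ^ 2 \<le> K ^ Suc n * norm (z + of_int d) ^ Suc n"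
      by (simp only: power_mult_distrib)
    moreover have "norm (z + of_int d) > 0" using * K(1)
      by (metis abs_ge_zero add_pos_nonneg less_le_trans zero_less_mult_pos zero_less_one)
    ultimately show ?thesis
      by (simp add: norm_divide norm_power field_simps del: power_Suc)
  qed
  have "(\<lambda>d::int. norm (1 / (z + of_int d) ^ Suc n)) summable_on UNIV"
    by (rule Infinite_Sum.abs_summable_on_comparison_test')
       (rule summable_on_cmult_right[OF summable_inverse_square_int], rule bound)
  then have s: "(\<lambda>d::int. 1 / (z + of_int d) ^ Suc n) summable_on UNIV"
    by (rule abs_summable_summable)
  have nz: "z \<noteq> 0" "1 - z \<noteq> 0" and n0: "n > 0" using z n by (auto simp: upper_half_plane_def elim: oddE)
  have P: "((\<lambda>k::nat. 1 / (w + of_nat k) ^ Suc n) has_sum Polygamma n w / fact n) UNIV"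
    if "w \<noteq> 0" "(\<lambda>k::nat. 1 / (w + of_nat k) ^ Suc n) summable_on UNIV" for w :: complex
  proof -
    have "(\<lambda>k::nat. 1 / (w + of_nat k) ^ Suc n) sums (Polygamma n w / fact n)"
      using Polygamma_LIMSEQ[OF that(1) n0] n by (simp add: inverse_eq_divide)
    then show ?thesis
      using that(2) has_sum_imp_sums sums_unique2 summable_iff_has_sum_infsum by metis
  qed
  have e: "1 / (z + of_int (- int (Suc k))) ^ Suc n = 1 / (1 - z + of_nat k) ^ Suc n" for k
  proof -
    have "z + of_int (- int (Suc k)) = - (1 - z + of_nat k)" by simp
    moreover have "even (Suc n)" using n by simp
    ultimately show ?thesis by (metis power_minus_even)
  qed
  have "((\<lambda>d::int. 1 / (z + of_int d) ^ Suc n) has_sum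
     (Polygamma n z / fact n + Polygamma n (1 - z) / fact n)) UNIV"
  proof (rule has_sum_int)
    show "((\<lambda>k. 1 / (z + of_int (int k)) ^ Suc n) has_sum Polygamma n z / fact n) UNIV"
      using P[OF nz(1)] s by (simp add: summable_on_int_iff)
    show "((\<lambda>k. 1 / (z + of_int (- int (Suc k))) ^ Suc n) has_sum Polygamma n (1 - z) / fact n) UNIV"
      unfolding e by (rule P[OF nz(2)]) (use s in \<open>simp only: summable_on_int_iff e\<close>)
  qed
  then show ?thesis by (simp add: add_divide_distrib)
qed

theorem lipschitz_formula:
  assumes "z \<in> upper_half_plane"
  shows "((\<lambda>d::int. 1 / (z + of_int d) ^ 2) has_sum - 4 * of_real pi ^ 2 * lambert 1 z) UNIV"
    and "((\<lambda>d::int. 1 / (z + of_int d) ^ 4) has_sum 8 / 3 * of_real pi ^ 4 * lambert 3 z) UNIV"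
proof -
  show "((\<lambda>d::int. 1 / (z + of_int d) ^ 2) has_sum - 4 * of_real pi ^ 2 * lambert 1 z) UNIV"
    using Polygamma_has_sum_int[OF assms, of 1] unfolding Polygamma_lambert[OF assms]
    by (simp add: numeral_2_eq_2)
  have [simp]: "Suc 3 = 4" by simp
  show "((\<lambda>d::int. 1 / (z + of_int d) ^ 4) has_sum 8 / 3 * of_real pi ^ 4 * lambert 3 z) UNIV"
    using Polygamma_has_sum_int[OF assms, of 3] unfolding Polygamma_lambert[OF assms]
    by (simp add: fact_numeral mult_ac)
qed

subsection \<open>Eisenstein series as Lambert series\<close>

definition sigma_fps :: "nat \<Rightarrow> complex fps" where
  "sigma_fps j = Abs_fps (\<lambda>n. of_nat (divisor_sum j n))"

definition sigma_series :: "nat \<Rightarrow> complex \<Rightarrow> complex" where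
  "sigma_series j z = eval_fps (sigma_fps j) (nome z)"

lemma divisor_sum_0 [simp]: "divisor_sum j 0 = 0"
  by (simp add: divisor_sum_def)

lemma divisor_sum_1 [simp]: "divisor_sum j (Suc 0) = 1"
  by (simp add: divisor_sum_def)

lemma divisor_sum_le: "divisor_sum j n \<le> n ^ Suc j"
proof (cases "n = 0")
  case False
  have "divisor_sum j n \<le> (\<Sum>d=1..n. d ^ j)" unfolding divisor_sum_def
    by (rule sum_mono2) (use False in \<open>auto dest: dvd_imp_le intro!: Nat.gr0I\<close>)
  also have "\<dots> \<le> (\<Sum>d=1..n. n ^ j)" by (rule sum_mono) (auto intro: power_mono)
  finally show ?thesis by simp
qed simp

lemma conv_radius_sigma_fps: "fps_conv_radius (sigma_fps j) \<ge> 1"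
proof (rule conv_radius_polynomial_growth[of _ "Suc j"])
  fix n show "norm (fps_nth (sigma_fps j) n) \<le> real n ^ Suc j"
    using divisor_sum_le[of j n] by (simp add: sigma_fps_def flip: of_nat_power of_nat_mult)
qed

lemma has_q_expansion_sigma: "has_q_expansion (sigma_series j) (sigma_fps j)"
  by (simp add: has_q_expansion_iff sigma_series_def conv_radius_sigma_fps)

lemma nome_of_nat_mult: "nome (of_nat c * z) = nome z ^ c"
  by (simp add: nome_def mult_ac flip: exp_of_nat_mult)

lemma of_nat_mult_in_upper_half_plane:
  "z \<in> upper_half_plane \<Longrightarrow> c > 0 \<Longrightarrow> of_nat c * z \<in> upper_half_plane"
  by (simp add: upper_half_plane_def)

text \<open>A pair \<open>(N, d)\<close> with \<open>d dvd N\<close> is the same as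
  \<open>(c * n, n)\<close>. Absolute summability over these pairs permits grouping by
  \<open>c\<close> instead of by \<open>N\<close>. In this form the series matches a lattice sum
  taken row by row.\<close>

lemma sigma_series_has_sum_lambert:
  assumes z: "z \<in> upper_half_plane"
  shows "((\<lambda>c. lambert j (of_nat c * z)) has_sum sigma_series j z) {1..}"
proof -
  define q where "q = nome z"
  define D where "D = (SIGMA N:{1::nat..}. {d. d dvd N})"
  define h where "h = (\<lambda>(N::nat, d::nat). of_nat d ^ j * q ^ N)"
  have r: "ereal (norm q) < fps_conv_radius (sigma_fps j)"
    unfolding q_def by (rule norm_nome_less_conv_radius[OF z conv_radius_sigma_fps])
  have s: "summable (\<lambda>n. norm (fps_nth (sigma_fps j) n * q ^ n))"
    by (rule norm_summable_fps[OF r])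
  have "((\<lambda>N. fps_nth (sigma_fps j) N * q ^ N) has_sum sigma_series j z) UNIV"
    unfolding sigma_series_def q_def[symmetric]
    by (rule norm_summable_imp_has_sum[OF s sums_eval_fps[OF r]])
  also have "?this \<longleftrightarrow> ((\<lambda>N. fps_nth (sigma_fps j) N * q ^ N) has_sum sigma_series j z) {1..}"
    by (rule has_sum_cong_neutral) (auto simp: sigma_fps_def not_le)
  finally have N: "((\<lambda>N. fps_nth (sigma_fps j) N * q ^ N) has_sum sigma_series j z) {1..}" .
  have fin: "finite {d. d dvd N}" if "N \<in> {1..}" for N :: nat using that by auto
  have h_N: "((\<lambda>d. h (N, d)) has_sum fps_nth (sigma_fps j) N * q ^ N) {d. d dvd N}" if "N \<in> {1..}" for N
    by (rule has_sum_finiteI[OF fin[OF that]])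
       (simp add: h_def sigma_fps_def divisor_sum_def sum_distrib_right)
  have "(\<lambda>x. norm (h x)) summable_on D"
    unfolding D_def
  proof (rule summable_on_SigmaI)
    show "((\<lambda>d. norm (h (N, d))) has_sum norm (fps_nth (sigma_fps j) N * q ^ N)) {d. d dvd N}"
      if "N \<in> {1..}" for N
    proof (rule has_sum_finiteI[OF fin[OF that]])
      have "norm (fps_nth (sigma_fps j) N) = (\<Sum>d | d dvd N. real d ^ j)"
        by (simp only: sigma_fps_def fps_nth_Abs_fps norm_of_nat) (simp add: divisor_sum_def)
      then show "norm (fps_nth (sigma_fps j) N * q ^ N) = (\<Sum>d | d dvd N. norm (h (N, d)))"
        by (simp add: h_def norm_mult norm_power sum_distrib_right)
    qed
    have "(\<lambda>N. norm (fps_nth (sigma_fps j) N * q ^ N)) summable_on UNIV"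
      by (rule norm_summable_imp_summable_on) (use s in simp)
    then show "(\<lambda>N. norm (fps_nth (sigma_fps j) N * q ^ N)) summable_on {1..}"
      by (rule summable_on_subset_banach) simp
  qed simp
  then have "h summable_on D" by (rule abs_summable_summable)
  then have "(h has_sum sigma_series j z) D"
    unfolding D_def by (intro has_sum_SigmaI[OF h_N N])
  also have "?this \<longleftrightarrow> ((\<lambda>(c, n). of_nat n ^ j * (q ^ c) ^ n) has_sum sigma_series j z) ({1..} \<times> {1..})"
    by (rule has_sum_reindex_bij_witness[of _ "\<lambda>(c, n). (c * n, n)" "\<lambda>(N, d). (N div d, d)"])
       (auto simp: D_def h_def mult.commute simp flip: power_mult elim!: dvdE)
  finally show ?thesis
    by (rule has_sum_SigmaD)
       (use lambert_has_sum(1)[OF of_nat_mult_in_upper_half_plane[OF z], of _ j]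
        in \<open>simp add: q_def nome_of_nat_mult\<close>)
qed

lemma bernoulli_2: "bernoulli_number 2 = 1 / 6" and bernoulli_4: "bernoulli_number 4 = - 1 / 30"
proof -
  define U :: "complex fps" where "U = fps_exp 1 - 1"
  define V where "V = fps_X / U"
  have U1: "fps_nth U 1 = 1" "fps_nth U 0 = 0" by (simp_all add: U_def)
  then have "U \<noteq> 0" by auto
  moreover have "subdegree U = 1" by (rule subdegreeI) (use U1 in auto)
  \<comment> \<open>The quotient in \<open>bernoulli_number\<close> is exact although
    \<open>U\<close> has no constant term; the coefficients can therefore be read off recursively
    from \<open>V * U = fps_X\<close>.\<close>
  ultimately have "U dvd fps_X" by (simp add: fps_dvd_iff)
  then have VU: "V * U = fps_X" by (simp add: V_def)
  have nth: "fps_nth fps_X n = (\<Sum>i=0..n. fps_nth V i * fps_nth U (n - i))" for n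
    by (subst VU[symmetric]) (rule fps_mult_nth)
  have Un: "fps_nth U n = (if n = 0 then 0 else 1 / fact n)" for n by (simp add: U_def)
  have v0: "fps_nth V 0 = 1" using nth[of 1] by (simp add: Un)
  have v1: "fps_nth V (Suc 0) = - 1/2" using nth[of 2]
    by (simp add: Un v0 numeral_2_eq_2 eq_neg_iff_add_eq_0 add_ac)
  have v2: "fps_nth V (Suc (Suc 0)) = 1 / 12" using nth[of 3]
    by (simp add: Un v0 v1 sum.atLeast0_atMost_Suc eval_nat_numeral)
  have v3: "fps_nth V (Suc (Suc (Suc 0))) = 0" using nth[of 4]
    by (simp add: Un v0 v1 v2 sum.atLeast0_atMost_Suc eval_nat_numeral)
  have v4: "fps_nth V (Suc (Suc (Suc (Suc 0)))) = - 1 / 720" using nth[of 5]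
    by (simp add: Un v0 v1 v2 v3 sum.atLeast0_atMost_Suc eval_nat_numeral eq_neg_iff_add_eq_0 add_ac)
  show "bernoulli_number 2 = 1 / 6"
    by (simp add: bernoulli_number_def v2[unfolded V_def U_def] numeral_2_eq_2)
  show "bernoulli_number 4 = - 1 / 30"
    by (simp add: bernoulli_number_def v4[unfolded V_def U_def] eval_nat_numeral)
qed

lemma eisenstein_sigma_series:
  assumes "z \<in> upper_half_plane"
  shows "eisenstein k z = 1 - 2 * of_nat k / bernoulli_number k * sigma_series (k - 1) z"
proof -
  have "(\<lambda>n. fps_nth (sigma_fps (k - 1)) n * nome z ^ n) sums sigma_series (k - 1) z"
    using has_q_expansion_sigma assms by (auto simp: has_q_expansion_def)
  then have "(\<lambda>n. fps_nth (sigma_fps (k - 1)) (Suc n) * nome z ^ Suc n) sums sigma_series (k - 1) z"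
    by (subst sums_Suc_iff) (simp add: sigma_fps_def)
  then show ?thesis using assms
    by (simp add: eisenstein_def sigma_fps_def sums_iff)
qed

lemma E2_eq: "z \<in> upper_half_plane \<Longrightarrow> E2 z = 1 - 24 * sigma_series 1 z"
  and E4_eq: "z \<in> upper_half_plane \<Longrightarrow> E4 z = 1 + 240 * sigma_series 3 z"
  by (simp_all add: eisenstein_sigma_series bernoulli_2 bernoulli_4)

definition E2_fps :: "complex fps" where "E2_fps = 1 - fps_const 24 * sigma_fps 1"
definition E4_fps :: "complex fps" where "E4_fps = 1 + fps_const 240 * sigma_fps 3"

lemma has_q_expansion_E2: "has_q_expansion E2 E2_fps"
proof -
  have "has_q_expansion (\<lambda>z. 1 - 24 * sigma_series 1 z) (fps_const 1 - fps_const 24 * sigma_fps 1)"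
    by (intro has_q_expansion_diff has_q_expansion_const has_q_expansion_cmult has_q_expansion_sigma)
  then show ?thesis unfolding E2_fps_def
    by (subst has_q_expansion_cong[OF E2_eq]) auto
qed

lemma has_q_expansion_E4: "has_q_expansion E4 E4_fps"
proof -
  have "has_q_expansion (\<lambda>z. 1 + 240 * sigma_series 3 z) (fps_const 1 + fps_const 240 * sigma_fps 3)"
    by (intro has_q_expansion_add has_q_expansion_const has_q_expansion_cmult has_q_expansion_sigma)
  then show ?thesis unfolding E4_fps_def
    by (subst has_q_expansion_cong[OF E4_eq]) auto
qed

lemma has_sum_int_even:
  fixes A :: "int \<Rightarrow> complex"
  assumes "\<And>c. A (- c) = A c" "((\<lambda>n. A (int n)) has_sum L) {1..}"
  shows "(A has_sum (A 0 + 2 * L)) UNIV"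
proof -
  have "((\<lambda>n. A (int n)) has_sum (A 0 + L)) (insert 0 {1..})"
    using has_sum_insert[OF _ assms(2), of 0] by simp
  also have "insert 0 {1..} = (UNIV :: nat set)" by auto
  finally have 1: "((\<lambda>n. A (int n)) has_sum (A 0 + L)) UNIV" .
  have 2: "((\<lambda>n. A (- int (Suc n))) has_sum L) UNIV"
    unfolding assms(1)
    by (rule has_sum_reindex_bij_witness[of _ "\<lambda>n. n - 1" Suc, THEN iffD2, OF _ _ _ _ _ _ assms(2)]) auto
  show ?thesis using has_sum_int[OF 1 2] by (simp add: add_ac)
qed

text \<open>The intervals \<open>{-int N..int N}\<close> eventually contain every finite set. A sum
  already known to exist can thus be evaluated along them, which is where telescoping and the
  cotangent series apply.\<close>

lemma has_sum_int_symmetric: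
  fixes f :: "int \<Rightarrow> 'a :: {comm_monoid_add, topological_space}"
  assumes "(f has_sum S) UNIV"
  shows "(\<lambda>N. \<Sum>d=-int N..int N. f d) \<longlonglongrightarrow> S"
proof -
  have "filterlim (\<lambda>N. {-int N..int N}) (finite_subsets_at_top UNIV) sequentially"
    unfolding filterlim_finite_subsets_at_top
  proof (intro allI impI)
    fix X :: "int set" assume "finite X \<and> X \<subseteq> UNIV"
    then have fin: "finite X" by simp
    show "\<forall>\<^sub>F N in sequentially. finite {-int N..int N} \<and> X \<subseteq> {-int N..int N} \<and> {-int N..int N} \<subseteq> UNIV"
      using eventually_ge_at_top[of "nat (\<Sum>x\<in>X. \<bar>x\<bar>)"]
    proof eventually_elim
      case (elim N)
      have "\<bar>x\<bar> \<le> int N" if "x \<in> X" for x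
        using member_le_sum[OF that, of abs] fin elim by auto
      then show ?case by (force simp: abs_le_iff)
    qed
  qed
  then show ?thesis using assms unfolding has_sum_def by (rule filterlim_compose[rotated])
qed

lemma summable_inverse_square_int_prod:
  "(\<lambda>(c::int, d::int). 1 / ((1 + \<bar>of_int c\<bar>) ^ 2 * (1 + \<bar>of_int d\<bar>) ^ 2) :: real) summable_on UNIV"
proof -
  define s where "s = (\<Sum>\<^sub>\<infinity>d::int. 1 / (1 + \<bar>of_int d\<bar> :: real) ^ 2)"
  define h :: "int \<times> int \<Rightarrow> real"
    where "h = (\<lambda>(c, d). 1 / (1 + \<bar>of_int c\<bar>) ^ 2 * (1 / (1 + \<bar>of_int d\<bar>) ^ 2))"
  have "h summable_on (SIGMA c:UNIV. UNIV)"
  proof (rule summable_on_SigmaI)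
    show "((\<lambda>d. h (c, d)) has_sum 1 / (1 + \<bar>of_int c\<bar>) ^ 2 * s) UNIV" for c :: int
      unfolding s_def h_def prod.case
      by (intro has_sum_cmult_right has_sum_infsum summable_inverse_square_int)
    show "(\<lambda>c::int. 1 / (1 + \<bar>of_int c\<bar>) ^ 2 * s) summable_on UNIV"
      by (intro summable_on_cmult_left summable_inverse_square_int)
  qed (auto simp: h_def)
  then show ?thesis by (simp add: case_prod_unfold h_def)
qed

subsection \<open>Transformation of \<open>E\<^sub>2\<close> and \<open>G\<^sub>4\<close>\<close>

lemma half_integer_nonzero: "of_int d - 1/2 \<noteq> (0::real)" "of_int d + 1/2 \<noteq> (0::real)"
proof -
  have "real_of_int (2 * d) \<noteq> of_int 1" "real_of_int (2 * d) \<noteq> of_int (-1)"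
    unfolding of_int_eq_iff by presburger+
  then show "of_int d - 1/2 \<noteq> (0::real)" "of_int d + 1/2 \<noteq> (0::real)" by auto
qed

lemma square_minus_quarter: "u ^ 2 - 1/4 = (u - 1/2) * (u + 1/2 :: complex)"
  by (simp add: algebra_simps power2_eq_square)

lemma inverse_shift_tendsto_0:
  "(\<lambda>N. 1 / (a + of_nat N)) \<longlonglongrightarrow> (0::complex)" "(\<lambda>N. 1 / (a - of_nat N)) \<longlonglongrightarrow> (0::complex)"
proof -
  show *: "(\<lambda>N. 1 / (a + of_nat N)) \<longlonglongrightarrow> (0::complex)" for a
    using filterlim_compose[OF tendsto_inverse_0 tendsto_add_filterlim_at_infinity[OF tendsto_const tendsto_of_nat, of a]]
    by (simp add: inverse_eq_divide)
  have "(\<lambda>N. - (1 / (- a + of_nat N))) \<longlonglongrightarrow> - (0::complex)"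
    by (intro tendsto_minus *)
  also have "(\<lambda>N. - (1 / (- a + of_nat N))) = (\<lambda>N. 1 / (a - of_nat N))"
    by (metis (no_types, opaque_lifting) add.commute diff_minus_eq_add divide_minus_right minus_diff_eq minus_minus)
  finally show "(\<lambda>N. 1 / (a - of_nat N)) \<longlonglongrightarrow> (0::complex)" by simp
qed

lemma sum_int_symmetric_telescope:
  fixes g :: "int \<Rightarrow> 'a :: ab_group_add"
  shows "(\<Sum>d=-int N..int N. g d - g (d + 1)) = g (- int N) - g (int N + 1)"
proof (induction N)
  case (Suc N)
  have "{-int (Suc N)..int (Suc N)} = insert (-int (Suc N)) (insert (int (Suc N)) {-int N..int N})"
    by auto
  then show ?case using Suc by (simp add: algebra_simps)
qed simp

definition latt :: "complex \<Rightarrow> int \<Rightarrow> int \<Rightarrow> complex" where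
  "latt z c d = of_int c * z + of_int d"

definition sqterm :: "complex \<Rightarrow> int \<times> int \<Rightarrow> complex" where
  "sqterm z = (\<lambda>(c, d). 1 / latt z c d ^ 2)"

text \<open>
  Subtracting \<open>1 / ((cz+d)\<^sup>2 - 1/4) = 1 / (cz+d-1/2) - 1 / (cz+d+1/2)\<close> makes the double series of
  \<open>1 / (cz+d)\<^sup>2\<close> absolutely convergent. Both iterated sums of the correction telescope, and their
  difference is the failure of modularity of \<open>E\<^sub>2\<close>. At \<open>(0,0)\<close> the junk value \<open>1/0 = 0\<close> is
  what is wanted.
\<close>

definition corrterm :: "complex \<Rightarrow> int \<times> int \<Rightarrow> complex" where
  "corrterm z = (\<lambda>(c, d). 1 / (latt z c d ^ 2 - 1/4))"

text \<open>The limit of the symmetric sums over \<open>c\<close> of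
  \<open>1 / (c z + d - 1/2)\<close>, that is, one of the two halves of a column of
  \<open>corrterm\<close>.\<close>

definition corrcot :: "complex \<Rightarrow> int \<Rightarrow> complex" where
  "corrcot z d = of_real pi / z * cot (of_real pi * ((of_int d - 1/2) / z))"

definition row_sum :: "complex \<Rightarrow> int \<Rightarrow> complex" where
  "row_sum z c = (\<Sum>\<^sub>\<infinity>d. sqterm z (c, d))"

context
  fixes z :: complex
  assumes z: "z \<in> upper_half_plane"
begin

lemma lattice_point_nonzero: "c \<noteq> 0 \<or> x \<noteq> 0 \<Longrightarrow> of_int c * z + of_real x \<noteq> 0"
proof
  assume *: "c \<noteq> 0 \<or> x \<noteq> 0" and 0: "of_int c * z + of_real x = 0"
  from 0 have "Im (of_int c * z + of_real x) = 0" "Re (of_int c * z + of_real x) = 0" by simp_all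
  with z have "c = 0" "x = 0" by (auto simp: upper_half_plane_def)
  with * show False by simp
qed

lemma half_shift_nonzero:
  "of_int c * z + of_int d - 1/2 \<noteq> 0" "of_int c * z + of_int d + 1/2 \<noteq> 0"
proof -
  from lattice_point_nonzero[OF disjI2, OF half_integer_nonzero(1), of c]
    lattice_point_nonzero[OF disjI2, OF half_integer_nonzero(2), of c]
  show "of_int c * z + of_int d - 1/2 \<noteq> 0" "of_int c * z + of_int d + 1/2 \<noteq> 0"
    by (simp_all add: algebra_simps)
qed

lemma corrterm_eq: "corrterm z (c, d) = 1 / (latt z c d - 1/2) - 1 / (latt z c d + 1/2)"
proof -
  have *: "1 / (a * b) = 1 / a - 1 / b" if "b = a + 1" "a \<noteq> 0" "b \<noteq> 0" for a b :: complex
    using that by (simp add: divide_simps)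
  show ?thesis unfolding corrterm_def prod.case square_minus_quarter
    by (rule *) (use half_shift_nonzero[of c d] in \<open>simp_all add: latt_def\<close>)
qed

lemma ex_lattice_bound:
  "\<exists>K>0. \<forall>c d.
     1 + \<bar>of_int c\<bar> \<le> K * norm (latt z c d - 1/2) \<and> 1 + \<bar>of_int d\<bar> \<le> K * norm (latt z c d - 1/2) \<and>
     1 + \<bar>of_int c\<bar> \<le> K * norm (latt z c d + 1/2) \<and> 1 + \<bar>of_int d\<bar> \<le> K * norm (latt z c d + 1/2) \<and>
     ((c, d) \<noteq> (0, 0) \<longrightarrow>
       1 + \<bar>of_int c\<bar> \<le> K * norm (latt z c d) \<and> 1 + \<bar>of_int d\<bar> \<le> K * norm (latt z c d))"
proof -
  obtain K where K: "K > 0" "\<And>(c::int) (d::int) x. x \<in> {of_int d, of_int d - 1/2, of_int d + 1/2} \<Longrightarrow> c \<noteq> 0 \<or> x \<noteq> 0 \<Longrightarrow>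
       1 + \<bar>of_int c\<bar> \<le> K * norm (of_int c * z + of_real x) \<and>
       1 + \<bar>of_int d\<bar> \<le> K * norm (of_int c * z + of_real x)"
    using norm_lattice_point_bound[OF z] by metis
  show ?thesis
  proof (intro exI[of _ K] conjI allI K(1))
    fix c d :: int
    have e: "latt z c d - 1/2 = of_int c * z + of_real (of_int d - 1/2)"
      "latt z c d + 1/2 = of_int c * z + of_real (of_int d + 1/2)"
      "latt z c d = of_int c * z + of_real (of_int d)" by (simp_all add: latt_def)
    show "1 + \<bar>of_int c\<bar> \<le> K * norm (latt z c d - 1/2)" "1 + \<bar>of_int d\<bar> \<le> K * norm (latt z c d - 1/2)"
     "1 + \<bar>of_int c\<bar> \<le> K * norm (latt z c d + 1/2)" "1 + \<bar>of_int d\<bar> \<le> K * norm (latt z c d + 1/2)"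
      unfolding e(1,2) using K(2)[of "of_int d - 1/2" d c] K(2)[of "of_int d + 1/2" d c] half_integer_nonzero[of d] by blast+
    show "(c, d) \<noteq> (0, 0) \<longrightarrow>
       1 + \<bar>of_int c\<bar> \<le> K * norm (latt z c d) \<and> 1 + \<bar>of_int d\<bar> \<le> K * norm (latt z c d)"
      unfolding e(3) using K(2)[of "of_int d" d c] by auto
  qed
qed

lemma summable_square_diff: "(\<lambda>p. sqterm z p - corrterm z p) summable_on UNIV"
proof -
  obtain K where K0: "K > 0" and K: "\<And>c d.
     1 + \<bar>of_int c\<bar> \<le> K * norm (latt z c d - 1/2) \<and> 1 + \<bar>of_int d\<bar> \<le> K * norm (latt z c d - 1/2) \<and>
     1 + \<bar>of_int c\<bar> \<le> K * norm (latt z c d + 1/2) \<and> 1 + \<bar>of_int d\<bar> \<le> K * norm (latt z c d + 1/2) \<and>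
     ((c, d) \<noteq> (0, 0) \<longrightarrow>
       1 + \<bar>of_int c\<bar> \<le> K * norm (latt z c d) \<and> 1 + \<bar>of_int d\<bar> \<le> K * norm (latt z c d))"
    using ex_lattice_bound by blast
  \<comment> \<open>The summand 4 accounts for \<open>p = (0, 0)\<close>, where
    \<open>sqterm\<close> is 0 and \<open>corrterm\<close> is -4.\<close>
  have bound: "norm (sqterm z p - corrterm z p) \<le>
      (K ^ 4 + 4) * (\<lambda>(c::int, d::int). 1 / ((1 + \<bar>of_int c\<bar>) ^ 2 * (1 + \<bar>of_int d\<bar>) ^ 2)) p" for p
  proof (cases p)
    case [simp]: (Pair c d)
    define u where "u = latt z c d"
    define C D :: real where "C = 1 + \<bar>of_int c\<bar>" and "D = 1 + \<bar>of_int d\<bar>"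
    have CD: "C \<ge> 1" "D \<ge> 1" by (auto simp: C_def D_def)
    show ?thesis
    proof (cases "(c, d) = (0, 0)")
      case True
      then show ?thesis using K0 by (simp add: sqterm_def corrterm_def latt_def)
    next
      case False
      then have u0: "u \<noteq> 0" using lattice_point_nonzero[of c "of_int d"] by (auto simp: u_def latt_def)
      have u1: "u - 1/2 \<noteq> 0" "u + 1/2 \<noteq> 0" using half_shift_nonzero[of c d] by (simp_all add: u_def latt_def)
      \<comment> \<open>The difference decays like the fourth power of the lattice point. Of its
        four linear factors two are bounded below in terms of \<open>c\<close> and two in terms of
        \<open>d\<close>, which yields the product bound.\<close>
      have t: "sqterm z p - corrterm z p = - (1/4) / (u ^ 2 * ((u - 1/2) * (u + 1/2)))"
        using u0 u1 unfolding sqterm_def corrterm_def prod.case Pair u_def[symmetric] square_minus_quarter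
        by (simp add: divide_simps) (simp add: algebra_simps power2_eq_square)
      have k: "C \<le> K * norm u" "D \<le> K * norm u" "C \<le> K * norm (u - 1/2)" "D \<le> K * norm (u + 1/2)"
        using K[of c d] False by (auto simp: C_def D_def u_def)
      have "(C * D) * (C * D) \<le> ((K * norm u) * (K * norm u)) * ((K * norm (u - 1/2)) * (K * norm (u + 1/2)))"
        using k CD K0 by (intro mult_mono) auto
      also have "\<dots> = K ^ 4 * norm (u ^ 2 * ((u - 1/2) * (u + 1/2)))"
        by (simp add: norm_mult norm_power power2_eq_square power4_eq_xxxx)
      finally have le: "C ^ 2 * D ^ 2 \<le> K ^ 4 * norm (u ^ 2 * ((u - 1/2) * (u + 1/2)))"
        by (simp add: power2_eq_square mult_ac)
      have pos: "norm (u ^ 2 * ((u - 1/2) * (u + 1/2))) > 0" "C ^ 2 * D ^ 2 > 0" using u0 u1 CD by auto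
      have "norm (sqterm z p - corrterm z p) = (1/4) / norm (u ^ 2 * ((u - 1/2) * (u + 1/2)))"
        unfolding t by (simp add: norm_divide)
      also have "\<dots> \<le> (1/4) * (K ^ 4 / (C ^ 2 * D ^ 2))"
        using le pos by (simp add: divide_simps mult_ac)
      also have "\<dots> \<le> (K ^ 4 + 4) / (C ^ 2 * D ^ 2)"
        using pos K0 by (simp add: divide_simps)
      finally show ?thesis by (simp add: C_def D_def)
    qed
  qed
  have "(\<lambda>p. norm (sqterm z p - corrterm z p)) summable_on UNIV"
    by (rule Infinite_Sum.abs_summable_on_comparison_test')
      (rule summable_on_cmult_right[OF summable_inverse_square_int_prod], rule bound)
  then show ?thesis by (rule abs_summable_summable)
qed

lemma corrterm_summable_row: "(\<lambda>d. corrterm z (c, d)) summable_on UNIV"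
  and corrterm_summable_column: "(\<lambda>c. corrterm z (c, d)) summable_on UNIV"
proof -
  obtain K where K0: "K > 0" and K: "\<And>c d.
     1 + \<bar>of_int c\<bar> \<le> K * norm (latt z c d - 1/2) \<and> 1 + \<bar>of_int d\<bar> \<le> K * norm (latt z c d - 1/2) \<and>
     1 + \<bar>of_int c\<bar> \<le> K * norm (latt z c d + 1/2) \<and> 1 + \<bar>of_int d\<bar> \<le> K * norm (latt z c d + 1/2) \<and>
     ((c, d) \<noteq> (0, 0) \<longrightarrow>
       1 + \<bar>of_int c\<bar> \<le> K * norm (latt z c d) \<and> 1 + \<bar>of_int d\<bar> \<le> K * norm (latt z c d))"
    using ex_lattice_bound by blast
  have bound: "norm (corrterm z (c, d)) \<le> K ^ 2 * (1 / X ^ 2)"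
    if "X \<le> K * norm (latt z c d - 1/2)" "X \<le> K * norm (latt z c d + 1/2)" "X > 0" for c d X
  proof -
    define u where "u = latt z c d"
    have u1: "u - 1/2 \<noteq> 0" "u + 1/2 \<noteq> 0" using half_shift_nonzero[of c d] by (simp_all add: u_def latt_def)
    have "X * X \<le> (K * norm (u - 1/2)) * (K * norm (u + 1/2))"
      using that K0 by (intro mult_mono) (auto simp: u_def)
    then have "X ^ 2 \<le> K ^ 2 * norm ((u - 1/2) * (u + 1/2))"
      by (simp add: norm_mult power2_eq_square mult_ac)
    moreover define W where "W = (u - 1/2) * (u + 1/2)"
    ultimately have "X ^ 2 \<le> K ^ 2 * norm W" by simp
    moreover have "norm W > 0" using u1 by (auto simp: W_def)
    moreover have c: "corrterm z (c, d) = 1 / W"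
      by (simp add: corrterm_def u_def square_minus_quarter W_def)
    ultimately show ?thesis using that(3) unfolding c
      by (simp add: norm_divide divide_simps mult_ac)
  qed
  have "(\<lambda>d. norm (corrterm z (c, d))) summable_on UNIV"
    by (rule Infinite_Sum.abs_summable_on_comparison_test')
      (rule summable_on_cmult_right[OF summable_inverse_square_int], rule bound, use K[of c] in auto)
  then show "(\<lambda>d. corrterm z (c, d)) summable_on UNIV" by (rule abs_summable_summable)
  have "(\<lambda>c. norm (corrterm z (c, d))) summable_on UNIV"
    by (rule Infinite_Sum.abs_summable_on_comparison_test')
      (rule summable_on_cmult_right[OF summable_inverse_square_int], rule bound, use K[of _ d] in auto)
  then show "(\<lambda>c. corrterm z (c, d)) summable_on UNIV" by (rule abs_summable_summable)
qed

lemma corrterm_row: "((\<lambda>d. corrterm z (c, d)) has_sum 0) UNIV"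
proof -
  have hs: "((\<lambda>d. corrterm z (c, d)) has_sum (\<Sum>\<^sub>\<infinity>d. corrterm z (c, d))) UNIV"
    by (rule has_sum_infsum[OF corrterm_summable_row])
  define a where "a = of_int c * z"
  have "(\<Sum>d=-int N..int N. corrterm z (c, d)) = 1 / ((a - 1/2) - of_nat N) - 1 / ((a + 1/2) + of_nat N)" for N
  proof -
    have "(\<Sum>d=-int N..int N. corrterm z (c, d)) =
       (\<Sum>d=-int N..int N. 1 / (a + of_int d - 1/2) - 1 / (a + of_int (d + 1) - 1/2))"
      by (intro sum.cong) (simp_all add: corrterm_eq latt_def a_def algebra_simps)
    also have "\<dots> = 1 / (a + of_int (- int N) - 1/2) - 1 / (a + of_int (int N + 1) - 1/2)"
      by (rule sum_int_symmetric_telescope)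
    finally show ?thesis by (simp add: algebra_simps)
  qed
  moreover have "(\<lambda>N. 1 / ((a - 1/2) - of_nat N) - 1 / ((a + 1/2) + of_nat N)) \<longlonglongrightarrow> 0 - 0"
    by (intro tendsto_diff inverse_shift_tendsto_0)
  ultimately have "(\<lambda>N. \<Sum>d=-int N..int N. corrterm z (c, d)) \<longlonglongrightarrow> 0" by simp
  then show ?thesis using has_sum_int_symmetric[OF hs] hs LIMSEQ_unique by fastforce
qed


text \<open>Along a column both halves of \<open>corrterm\<close> are cotangent series. Each
  converges only symmetrically, which suffices since the column itself is already known to be
  summable. The half-integer shift keeps the arguments of the cotangent away from its poles.\<close>

lemma corrterm_column: "((\<lambda>c. corrterm z (c, d)) has_sum (corrcot z d - corrcot z (d + 1))) UNIV"
proof -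
  have hs: "((\<lambda>c. corrterm z (c, d)) has_sum (\<Sum>\<^sub>\<infinity>c. corrterm z (c, d))) UNIV"
    by (rule has_sum_infsum[OF corrterm_summable_column])
  have z0: "z \<noteq> 0" using z by (auto simp: upper_half_plane_def)
  have nI: "(of_int d - 1/2) / z \<notin> \<int>" for d :: int
  proof
    assume "(of_int d - 1/2) / z \<in> \<int>"
    then obtain k where "(of_int d - 1/2) / z = of_int k" by (auto elim: Ints_cases)
    then have "of_int (- k) * z + of_int d - 1/2 = 0" using z0 by (simp add: field_simps)
    then show False using half_shift_nonzero by blast
  qed
  have L: "(\<lambda>N. 1 / z * (\<Sum>c=-int N..int N. 1 / (of_int c + (of_int d - 1/2) / z))) \<longlonglongrightarrow> corrcot z d" for d :: int
    using tendsto_mult_left[OF symmetric_sum_tendsto_cot[OF nI[of d]], of "1 / z"]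
    by (simp add: corrcot_def)
  have "(\<Sum>c=-int N..int N. corrterm z (c, d)) =
     1 / z * (\<Sum>c=-int N..int N. 1 / (of_int c + (of_int d - 1/2) / z)) -
     1 / z * (\<Sum>c=-int N..int N. 1 / (of_int c + (of_int (d + 1) - 1/2) / z))" for N
  proof -
    have "1 / z * (1 / (of_int c + (of_int d - 1/2) / z)) = 1 / (latt z c d - 1/2)" for c d
    proof -
      have "z * (of_int c + (of_int d - 1/2) / z) = latt z c d - 1/2"
        using z0 by (simp add: latt_def field_simps)
      then show ?thesis by (metis mult.right_neutral times_divide_times_eq)
    qed
    note e = this
    have "latt z c (d + 1) - 1/2 = latt z c d + 1/2" for c by (simp add: latt_def)
    then show ?thesis
      by (simp only: sum_distrib_left e corrterm_eq sum_subtractf)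
  qed
  then have "(\<lambda>N. \<Sum>c=-int N..int N. corrterm z (c, d)) \<longlonglongrightarrow> corrcot z d - corrcot z (d + 1)"
    using tendsto_diff[OF L[of d] L[of "d + 1"]] by simp
  then show ?thesis using has_sum_int_symmetric[OF hs] hs LIMSEQ_unique by metis
qed


lemma sqterm_row: "((\<lambda>d. sqterm z (c, d)) has_sum row_sum z c) UNIV"
  and row_sum_minus: "row_sum z (- c) = row_sum z c"
  and row_sum_pos: "c > 0 \<Longrightarrow> row_sum z c = - 4 * of_real pi ^ 2 * lambert 1 (of_int c * z)"
  and row_sum_0: "row_sum z 0 = of_real pi ^ 2 / 3"
proof -
  have pos: "((\<lambda>d. sqterm z (c, d)) has_sum - 4 * of_real pi ^ 2 * lambert 1 (of_int c * z)) UNIV" if "c > 0" for c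
    using lipschitz_formula(1)[of "of_int c * z"] that z
    by (simp add: sqterm_def latt_def upper_half_plane_def)
  have refl: "((\<lambda>d. sqterm z (- c, d)) has_sum S) UNIV \<longleftrightarrow> ((\<lambda>d. sqterm z (c, d)) has_sum S) UNIV" for c S
  proof (rule has_sum_reindex_bij_witness[of _ uminus uminus])
    show "sqterm z (c, - d) = sqterm z (- c, d)" for d
      using power2_minus[of "latt z c (- d)"] by (simp add: sqterm_def latt_def)
  qed auto
  \<comment> \<open>Row 0 is \<open>2 * zeta(2)\<close>; its term at \<open>d = 0\<close> is
    \<open>1 / 0 = 0\<close>.\<close>
  have 0: "((\<lambda>d. sqterm z (0, d)) has_sum of_real pi ^ 2 / 3) UNIV"
  proof -
    have s: "((\<lambda>n. 1 / real (n + 1) ^ 2) has_sum pi ^ 2 / 6) UNIV"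
      by (rule norm_summable_imp_has_sum) (use inverse_squares_sums in \<open>auto simp: sums_iff add_ac\<close>)
    have s': "((\<lambda>n. 1 / real n ^ 2) has_sum pi ^ 2 / 6) {1..}"
      by (rule has_sum_reindex_bij_witness[of _ "\<lambda>n. n - 1" Suc, THEN iffD1, OF _ _ _ _ _ _ s]) auto
    have "((\<lambda>n. sqterm z (0, int n)) has_sum of_real (pi ^ 2 / 6)) {1..}"
      using has_sum_of_real[OF s', where ?'a = complex] by (simp add: sqterm_def latt_def)
    from has_sum_int_even[OF _ this] show ?thesis by (simp add: sqterm_def latt_def)
  qed
  have ex: "\<exists>S. ((\<lambda>d. sqterm z (c, d)) has_sum S) UNIV" for c
    using pos[of c] pos[of "-c"] refl[of c] 0 by (cases "c = 0"; cases "c > 0") auto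
  then show "((\<lambda>d. sqterm z (c, d)) has_sum row_sum z c) UNIV"
    unfolding row_sum_def by (simp add: summable_on_def)
  show "row_sum z (- c) = row_sum z c"
    using refl[of c] ex[of c] unfolding row_sum_def by (metis infsumI)
  show "c > 0 \<Longrightarrow> row_sum z c = - 4 * of_real pi ^ 2 * lambert 1 (of_int c * z)"
    using pos infsumI unfolding row_sum_def by blast
  show "row_sum z 0 = of_real pi ^ 2 / 3"
    using 0 infsumI unfolding row_sum_def by blast
qed

lemma row_sums: "(row_sum z has_sum (of_real pi ^ 2 / 3 * E2 z)) UNIV"
proof -
  have "((\<lambda>n. row_sum z (int n)) has_sum (- 4 * of_real pi ^ 2 * sigma_series 1 z)) {1..}"
    using has_sum_cmult_right[OF sigma_series_has_sum_lambert[OF z, of 1], of "- 4 * of_real pi ^ 2"]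
    by (rule has_sum_cong[THEN iffD1, rotated]) (simp add: row_sum_pos)
  from has_sum_int_even[OF row_sum_minus this] show ?thesis
    by (simp add: row_sum_0 E2_eq[OF z] algebra_simps)
qed

text \<open>The subtracted rows have sum 0, so the row-wise value is still Eisenstein's iterated sum
  for \<open>E2\<close>. The absolutely convergent double sum with this value may then also be
  summed by columns.\<close>

lemma total_sum: "((\<lambda>p. sqterm z p - corrterm z p) has_sum (of_real pi ^ 2 / 3 * E2 z)) UNIV"
proof -
  obtain T where T: "((\<lambda>p. sqterm z p - corrterm z p) has_sum T) UNIV"
    using summable_square_diff by (auto simp: summable_on_def)
  then have "((\<lambda>p. sqterm z p - corrterm z p) has_sum T) (SIGMA c:UNIV. UNIV)" by simp
  then have "(row_sum z has_sum T) UNIV"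
  proof (rule has_sum_SigmaD)
    show "((\<lambda>d. sqterm z (c, d) - corrterm z (c, d)) has_sum row_sum z c) UNIV" for c
      using has_sum_add[OF sqterm_row has_sum_uminusI[OF corrterm_row]] by simp
  qed
  with row_sums T show ?thesis using has_sum_unique by blast
qed

end

lemma minus_inverse_upper_half_plane:
  assumes "z \<in> upper_half_plane"
  shows "- 1 / z \<in> upper_half_plane"
proof -
  have "Im (- 1 / z) = Im z / (norm z) ^ 2"
    by (simp add: Im_divide cmod_power2)
  moreover have "z \<noteq> 0" using assms by (auto simp: upper_half_plane_def)
  ultimately show ?thesis using assms by (simp add: upper_half_plane_def)
qed

text \<open>Along a ray in the half plane \<open>nome\<close> tends to 0 and only the constant term
  of the cotangent survives. This limit is the source of the extra term in the transformation of
  \<open>E2\<close>.\<close>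

lemma pi_cot_tendsto:
  assumes "z \<in> upper_half_plane"
  shows "(\<lambda>N. of_real pi * cot (of_real pi * (of_real (real N + 1/2) * z))) \<longlonglongrightarrow> - of_real pi * \<i>"
proof -
  define y where "y = (\<lambda>N. of_real (real N + 1/2) * z)"
  have y: "y N \<in> upper_half_plane" for N
    using assms by (simp add: y_def upper_half_plane_def add_nonneg_pos)
  have "nome (y N) = exp (\<i> * of_real pi * z) * nome z ^ N" for N
    by (simp add: nome_def y_def algebra_simps flip: exp_of_nat_mult exp_add)
  moreover have "(\<lambda>N. exp (\<i> * of_real pi * z) * nome z ^ N) \<longlonglongrightarrow> exp (\<i> * of_real pi * z) * 0"
    by (intro tendsto_mult tendsto_const LIMSEQ_power_zero norm_nome_less_1 assms)
  ultimately have n: "(\<lambda>N. nome (y N)) \<longlonglongrightarrow> 0" by simp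
  have "(\<lambda>N. - of_real pi * \<i> - 2 * of_real pi * \<i> * (nome (y N) / (1 - nome (y N))))
      \<longlonglongrightarrow> - of_real pi * \<i> - 2 * of_real pi * \<i> * (0 / (1 - 0))"
    by (intro tendsto_intros n) simp
  moreover have "of_real pi * cot (of_real pi * y N) =
      - of_real pi * \<i> - 2 * of_real pi * \<i> * (nome (y N) / (1 - nome (y N)))" for N
    by (simp add: pi_cot_lambert[OF y] lambert_0[OF y])
  ultimately show ?thesis by (simp add: y_def)
qed

theorem E2_transformation:
  assumes z: "z \<in> upper_half_plane"
  shows "E2 (- 1 / z) = z ^ 2 * E2 z + 6 * z / (of_real pi * \<i>)"
proof -
  define z' where "z' = - 1 / z"
  have z': "z' \<in> upper_half_plane" using minus_inverse_upper_half_plane[OF z] by (simp add: z'_def)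
  have z0: "z \<noteq> 0" using z by (auto simp: upper_half_plane_def)
  define T where "T = of_real pi ^ 2 / 3 * E2 z"
  define T' where "T' = of_real pi ^ 2 / 3 * E2 z'"
  \<comment> \<open>Columns for \<open>z\<close> are rows for \<open>- 1 / z\<close>, because
    \<open>c z + d\<close> is, up to sign, \<open>z\<close> times the lattice point with coordinates
    \<open>(d, - c)\<close> for \<open>- 1 / z\<close>.\<close>
  have col: "((\<lambda>c. sqterm z (c, d)) has_sum (1 / z ^ 2 * row_sum z' d)) UNIV" for d
  proof -
    have "((\<lambda>c. 1 / z ^ 2 * sqterm z' (d, c)) has_sum (1 / z ^ 2 * row_sum z' d)) UNIV"
      by (rule has_sum_cmult_right[OF sqterm_row[OF z']])
    moreover have "1 / z ^ 2 * sqterm z' (d, - c) = sqterm z (c, d)" for c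
    proof -
      have "latt z c d = - (z * latt z' d (- c))"
        using z0 by (simp add: latt_def z'_def field_simps)
      then have "latt z c d ^ 2 = z ^ 2 * latt z' d (- c) ^ 2"
        by (simp add: power_mult_distrib)
      then show ?thesis by (simp add: sqterm_def)
    qed
    ultimately show ?thesis
      by (subst has_sum_reindex_bij_witness[of _ uminus uminus]) auto
  qed
  have "((\<lambda>p. sqterm z p - corrterm z p) has_sum T) (UNIV \<times> UNIV)"
    using total_sum[OF z] by (simp add: T_def)
  then have "((\<lambda>(d, c). sqterm z (c, d) - corrterm z (c, d)) has_sum T) (UNIV \<times> UNIV)"
    by (rule has_sum_swap[THEN iffD1])
  then have "((\<lambda>d. 1 / z ^ 2 * row_sum z' d - (corrcot z d - corrcot z (d + 1))) has_sum T) UNIV"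
  proof (rule has_sum_SigmaD)
    show "((\<lambda>c. case (d, c) of (d, c) \<Rightarrow> sqterm z (c, d) - corrterm z (c, d)) has_sum
        (1 / z ^ 2 * row_sum z' d - (corrcot z d - corrcot z (d + 1)))) UNIV" for d
      using has_sum_add[OF col has_sum_uminusI[OF corrterm_column[OF z]], of d d]
      by (simp add: algebra_simps)
  qed
  from has_sum_add[OF has_sum_cmult_right[OF row_sums[OF z'], of "1 / z ^ 2"] has_sum_uminusI[OF this]]
  have "((\<lambda>d. corrcot z d - corrcot z (d + 1)) has_sum (1 / z ^ 2 * T' - T)) UNIV"
    by (simp add: T'_def)
  from has_sum_int_symmetric[OF this]
  have lim1: "(\<lambda>N. corrcot z (- int N) - corrcot z (int N + 1)) \<longlonglongrightarrow> 1 / z ^ 2 * T' - T"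
    by (simp only: sum_int_symmetric_telescope)
  \<comment> \<open>The two boundary terms of the telescoping sum have opposite arguments. The
    cotangent is odd, so they reinforce each other instead of cancelling.\<close>
  have "corrcot z (- int N) - corrcot z (int N + 1) =
      2 / z * (of_real pi * cot (of_real pi * (of_real (real N + 1/2) * z')))" for N
  proof -
    define w where "w = of_real pi * (of_real (real N + 1/2) * z')"
    have "of_real pi * ((of_int (- int N) - 1/2) / z) = w"
      "of_real pi * ((of_int (int N + 1) - 1/2) / z) = - w"
      using z0 by (simp_all add: w_def z'_def field_simps)
    then show ?thesis unfolding corrcot_def w_def[symmetric] by (simp add: cot_def field_simps)
  qed
  then have "(\<lambda>N. corrcot z (- int N) - corrcot z (int N + 1)) \<longlonglongrightarrow> 2 / z * (- of_real pi * \<i>)"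
    using tendsto_mult_left[OF pi_cot_tendsto[OF z'], of "2 / z"] by simp
  with lim1 have diff: "1 / z ^ 2 * T' - T = 2 / z * (- of_real pi * \<i>)" by (rule LIMSEQ_unique)
  have "T' = z ^ 2 * (1 / z ^ 2 * T' - T) + z ^ 2 * T"
    using z0 by (simp add: right_diff_distrib)
  also have "\<dots> = z ^ 2 * T - 2 * z * of_real pi * \<i>"
    unfolding diff using z0 by (simp add: power2_eq_square)
  finally have "T' = z ^ 2 * T - 2 * z * of_real pi * \<i>" .
  moreover have inv: "of_real pi ^ 2 / 3 * (6 * z / (of_real pi * \<i>)) = - (2 * z * of_real pi * \<i>)"
    by (simp add: divide_i power2_eq_square flip: divide_divide_eq_left)
  ultimately have "of_real pi ^ 2 / 3 * E2 z' = of_real pi ^ 2 / 3 * (z ^ 2 * E2 z + 6 * z / (of_real pi * \<i>))"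
    by (simp add: T_def T'_def distrib_left inv)
  then show ?thesis by (simp add: z'_def)
qed

text \<open>The origin contributes \<open>1 / 0 = 0\<close>, so this is the usual sum over nonzero
  lattice points. In weight 4 it converges absolutely and may be reindexed freely.\<close>

definition G4 :: "complex \<Rightarrow> complex" where
  "G4 z = (\<Sum>\<^sub>\<infinity>(c, d). 1 / latt z c d ^ 4)"

lemma summable_G4:
  assumes z: "z \<in> upper_half_plane"
  shows "(\<lambda>(c, d). 1 / latt z c d ^ 4) summable_on UNIV"
proof -
  obtain K where K0: "K > 0" and K: "\<And>c d. (c, d) \<noteq> (0, 0) \<Longrightarrow>
       1 + \<bar>of_int c\<bar> \<le> K * norm (latt z c d) \<and> 1 + \<bar>of_int d\<bar> \<le> K * norm (latt z c d)"
    using ex_lattice_bound[OF z] by blast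
  have bound: "norm (case p of (c, d) \<Rightarrow> 1 / latt z c d ^ 4) \<le>
      K ^ 4 * (\<lambda>(c::int, d::int). 1 / ((1 + \<bar>of_int c\<bar>) ^ 2 * (1 + \<bar>of_int d\<bar>) ^ 2)) p" for p
  proof (cases p)
    case [simp]: (Pair c d)
    define u where "u = latt z c d"
    define C D :: real where "C = 1 + \<bar>of_int c\<bar>" and "D = 1 + \<bar>of_int d\<bar>"
    have CD: "C \<ge> 1" "D \<ge> 1" by (auto simp: C_def D_def)
    show ?thesis
    proof (cases "(c, d) = (0, 0)")
      case True
      then show ?thesis using K0 by (simp add: latt_def)
    next
      case False
      then have k: "C \<le> K * norm u" "D \<le> K * norm u" using K by (auto simp: C_def D_def u_def)
      then have "(C * D) * (C * D) \<le> ((K * norm u) * (K * norm u)) * ((K * norm u) * (K * norm u))"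
        using CD K0 by (intro mult_mono) auto
      then have le: "C ^ 2 * D ^ 2 \<le> K ^ 4 * norm u ^ 4"
        by (simp add: power2_eq_square power4_eq_xxxx mult_ac)
      have "norm u \<noteq> 0" using k CD by auto
      then have "norm (1 / u ^ 4) \<le> K ^ 4 * (1 / (C ^ 2 * D ^ 2))"
        using le CD by (simp add: norm_divide norm_power divide_simps mult_ac)
      then show ?thesis by (simp add: C_def D_def u_def)
    qed
  qed
  have "(\<lambda>p. norm (case p of (c, d) \<Rightarrow> 1 / latt z c d ^ 4)) summable_on UNIV"
    by (rule Infinite_Sum.abs_summable_on_comparison_test')
      (rule summable_on_cmult_right[OF summable_inverse_square_int_prod], rule bound)
  then show ?thesis by (rule abs_summable_summable)
qed

lemma G4_transformation:
  assumes z: "z \<in> upper_half_plane"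
  shows "G4 (- 1 / z) = z ^ 4 * G4 z"
proof -
  have z0: "z \<noteq> 0" using z by (auto simp: upper_half_plane_def)
  have "((\<lambda>p. z ^ 4 * (case p of (c, d) \<Rightarrow> 1 / latt z c d ^ 4)) has_sum z ^ 4 * G4 z) UNIV"
    unfolding G4_def by (intro has_sum_cmult_right has_sum_infsum summable_G4[OF z])
  also have "?this \<longleftrightarrow> ((\<lambda>(c, d). 1 / latt (- 1 / z) c d ^ 4) has_sum z ^ 4 * G4 z) UNIV"
  proof (rule has_sum_reindex_bij_witness[of _ "\<lambda>(c, d). (d, - c)" "\<lambda>(c, d). (- d, c)"])
    fix p :: "int \<times> int"
    show "(case (case p of (c, d) \<Rightarrow> (- d, c)) of (c, d) \<Rightarrow> 1 / latt (- 1 / z) c d ^ 4) =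
        z ^ 4 * (case p of (c, d) \<Rightarrow> 1 / latt z c d ^ 4)"
    proof (cases p)
      case (Pair c d)
      have "latt (- 1 / z) (- d) c = latt z c d / z" using z0 by (simp add: latt_def field_simps)
      then show ?thesis using z0 Pair by (simp add: power_divide)
    qed
  qed auto
  finally show ?thesis unfolding G4_def by (rule infsumI)
qed

definition zeta4 :: complex where "zeta4 = (\<Sum>\<^sub>\<infinity>d::int. 1 / of_int d ^ 4)"

lemma G4_q_series:
  assumes z: "z \<in> upper_half_plane"
  shows "G4 z = zeta4 + 16 / 3 * of_real pi ^ 4 * sigma_series 3 z"
proof -
  define A where "A c = (\<Sum>\<^sub>\<infinity>d. 1 / latt z c d ^ 4)" for c
  have G: "((\<lambda>(c, d). 1 / latt z c d ^ 4) has_sum G4 z) (SIGMA c:UNIV. UNIV)"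
    using summable_G4[OF z] by (simp add: G4_def)
  have row: "((\<lambda>d. 1 / latt z c d ^ 4) has_sum A c) UNIV" for c
    unfolding A_def using summable_on_SigmaD1[of "\<lambda>c d. 1 / latt z c d ^ 4" UNIV "\<lambda>_. UNIV" c]
      summable_G4[OF z] by (simp add: has_sum_infsum)
  have "(A has_sum G4 z) UNIV" by (rule has_sum_SigmaD[OF G]) (simp add: row)
  moreover have "(A has_sum (A 0 + 2 * (8 / 3 * of_real pi ^ 4 * sigma_series 3 z))) UNIV"
  proof (rule has_sum_int_even)
    show "A (- c) = A c" for c
      unfolding A_def
    proof (rule infsum_reindex_bij_witness[of _ uminus uminus])
      show "1 / latt z c (- d) ^ 4 = 1 / latt z (- c) d ^ 4" for d
        using power_minus_even[of 4 "latt z c (- d)"] by (simp add: latt_def)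
    qed auto
    have "A (int n) = 8 / 3 * of_real pi ^ 4 * lambert 3 (of_nat n * z)" if "n \<in> {1..}" for n
      using lipschitz_formula(2)[OF of_nat_mult_in_upper_half_plane[OF z], of n] that
      unfolding A_def by (intro infsumI) (simp add: latt_def)
    note e = this
    show "((\<lambda>n. A (int n)) has_sum 8 / 3 * of_real pi ^ 4 * sigma_series 3 z) {1..}"
      by (subst has_sum_cong[OF e]) (assumption, rule has_sum_cmult_right[OF sigma_series_has_sum_lambert[OF z]])
  qed
  ultimately have "G4 z = A 0 + 2 * (8 / 3 * of_real pi ^ 4 * sigma_series 3 z)"
    using has_sum_unique by blast
  then show ?thesis by (simp add: A_def latt_def zeta4_def)
qed

subsection \<open>Modular forms and Serre derivatives\<close>

lemma power_int_uminus_even: "even k \<Longrightarrow> (- x) powi k = (x :: complex) powi k"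
  by (elim evenE) (simp add: power_int_mult)

text \<open>The Euclidean algorithm on the bottom row: with \<open>n = d div c\<close>, passing from
  \<open>z\<close> to \<open>- 1 / (z + n)\<close> replaces the row \<open>(c, d)\<close> by
  \<open>(d mod c, - c)\<close>, whose first entry is smaller in absolute value. Even weight makes
  the signs disappear.\<close>

lemma slash_invariant_from_generators:
  fixes f :: "complex \<Rightarrow> complex" and k a b c d :: int
  assumes k: "even k"
    and T: "\<And>z n. z \<in> upper_half_plane \<Longrightarrow> f (z + of_int n) = f z"
    and S: "\<And>z. z \<in> upper_half_plane \<Longrightarrow> f (- 1 / z) = z powi k * f z"
  shows "a * d - b * c = 1 \<Longrightarrow> z \<in> upper_half_plane \<Longrightarrow>
    f ((of_int a * z + of_int b) / (of_int c * z + of_int d)) = (of_int c * z + of_int d) powi k * f z"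
proof (induction "nat \<bar>c\<bar>" arbitrary: a b c d z rule: less_induct)
  case less
  note det = less.prems(1) and z = less.prems(2)
  show ?case
  proof (cases "c = 0")
    case True
    with det have "a * d = 1" by simp
    then have "a = 1 \<and> d = 1 \<or> a = -1 \<and> d = -1" by (simp add: zmult_eq_1_iff)
    then show ?thesis
    proof
      assume *: "a = 1 \<and> d = 1"
      then show ?thesis using True T[OF z, of b] by simp
    next
      assume *: "a = -1 \<and> d = -1"
      have "(- z + of_int b) / (- 1) = z + of_int (- b)" by simp
      then show ?thesis using * True T[OF z, of "-b"] k by (simp add: power_int_uminus_even[OF k])
    qed
  next
    case False
    define n where "n = d div c"
    define d' b' where "d' = d - n * c" and "b' = b - n * a"
    define y where "y = z + of_int n"
    define w where "w = - 1 / y"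
    have "d' = d mod c" by (simp add: d'_def n_def minus_div_mult_eq_mod)
    then have small: "nat \<bar>d'\<bar> < nat \<bar>c\<bar>" using False by (simp add: abs_mod_less)
    have y: "y \<in> upper_half_plane" using z by (simp add: y_def upper_half_plane_def)
    have y0: "y \<noteq> 0" using y by (auto simp: upper_half_plane_def)
    have w: "w \<in> upper_half_plane" unfolding w_def by (rule minus_inverse_upper_half_plane[OF y])
    have det': "b' * (- c) - (- a) * d' = 1" using det by (simp add: b'_def d'_def algebra_simps)
    have IH: "f ((of_int b' * w + of_int (- a)) / (of_int d' * w + of_int (- c))) =
        (of_int d' * w + of_int (- c)) powi k * f w"
      by (rule less.hyps[OF small det' w])
    have num: "of_int b' * w + of_int (- a) = - (of_int a * z + of_int b) / y"
      and den: "of_int d' * w + of_int (- c) = - (of_int c * z + of_int d) / y"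
      using y0 by (simp_all add: w_def b'_def d'_def divide_simps) (simp_all add: y_def algebra_simps)
    have frac: "(- p / y) / (- r / y) = p / r" for p r using y0 by simp
    have "f ((of_int a * z + of_int b) / (of_int c * z + of_int d)) =
        (- (of_int c * z + of_int d) / y) powi k * f w"
      using IH unfolding num den frac .
    also have "f w = y powi k * f z" unfolding w_def S[OF y] by (simp add: y_def T[OF z])
    also have "(- (of_int c * z + of_int d) / y) powi k * (y powi k * f z) =
        (- (of_int c * z + of_int d)) powi k * f z"
      using y0 by (simp add: power_int_divide_distrib)
    finally show ?thesis unfolding power_int_uminus_even[OF k] .
  qed
qed

lemma modular_formsI:
  assumes "even k" "has_q_expansion f F"
    and "\<And>z. z \<notin> upper_half_plane \<Longrightarrow> f z = 0"
    and "\<And>z. z \<in> upper_half_plane \<Longrightarrow> f (- 1 / z) = z powi k * f z"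
  shows "f \<in> modular_forms k"
  using assms slash_invariant_from_generators[OF assms(1) has_q_expansion_periodic[OF assms(2)] assms(4)]
  by (auto simp: modular_forms_def intro: has_q_expansion_holomorphic)

lemma modular_forms_S:
  assumes "f \<in> modular_forms k" "z \<in> upper_half_plane"
  shows "f (- 1 / z) = z powi k * f z"
proof -
  have "(0::int) * 0 - (-1) * 1 = 1" by simp
  then have "f ((of_int 0 * z + of_int (-1)) / (of_int 1 * z + of_int 0)) = (of_int 1 * z + of_int 0) powi k * f z"
    using assms unfolding modular_forms_def by blast
  then show ?thesis by simp
qed

lemma modular_forms_q_expansion: "f \<in> modular_forms k \<Longrightarrow> \<exists>F. has_q_expansion f F"
  and modular_forms_outside: "f \<in> modular_forms k \<Longrightarrow> z \<notin> upper_half_plane \<Longrightarrow> f z = 0"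
  by (auto simp: modular_forms_def)

text \<open>Passing to the power series turns identities between forms into ring identities and
  orders at the cusp into \<open>subdegree\<close>.\<close>

definition modular_fps :: "int \<Rightarrow> complex fps \<Rightarrow> bool" where
  "modular_fps k F \<longleftrightarrow> (\<exists>f\<in>modular_forms k. has_q_expansion f F)"

text \<open>Only the transformation \<open>S\<close> has to be checked, as a \<open>q\<close>-series is 1-periodic.\<close>

lemma modular_fpsI:
  assumes "even k" "has_q_expansion f F"
    and "\<And>z. z \<in> upper_half_plane \<Longrightarrow> f (- 1 / z) = z powi k * f z"
  shows "modular_fps k F"
proof -
  define g where "g z = (if z \<in> upper_half_plane then f z else 0)" for z
  have "has_q_expansion g F"
    using assms(2) by (subst has_q_expansion_cong[of g f]) (simp_all add: g_def)
  moreover have "g \<in> modular_forms k"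
    by (rule modular_formsI[OF assms(1) calculation])
       (use assms(3) minus_inverse_upper_half_plane in \<open>auto simp: g_def\<close>)
  ultimately show ?thesis by (auto simp: modular_fps_def)
qed

lemma modular_fpsE:
  assumes "modular_fps k F"
  obtains f where "f \<in> modular_forms k" "has_q_expansion f F"
    "\<And>z. z \<in> upper_half_plane \<Longrightarrow> f (- 1 / z) = z powi k * f z"
  using assms modular_forms_S by (auto simp: modular_fps_def)

lemma modular_fps_mult:
  assumes "even k" "even l" "modular_fps k F" "modular_fps l G"
  shows "modular_fps (k + l) (F * G)"
proof -
  obtain f g where fg: "has_q_expansion f F" "has_q_expansion g G"
    "\<And>z. z \<in> upper_half_plane \<Longrightarrow> f (- 1 / z) = z powi k * f z"
    "\<And>z. z \<in> upper_half_plane \<Longrightarrow> g (- 1 / z) = z powi l * g z"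
    using assms(3,4) by (auto elim!: modular_fpsE)
  show ?thesis
  proof (rule modular_fpsI[OF _ has_q_expansion_mult[OF fg(1,2)]])
    show "f (- 1 / z) * g (- 1 / z) = z powi (k + l) * (f z * g z)" if "z \<in> upper_half_plane" for z
    proof -
      have "z \<noteq> 0" using that by (auto simp: upper_half_plane_def)
      then show ?thesis using fg(3,4)[OF that] by (simp add: power_int_add)
    qed
  qed (use assms in simp)
qed

lemma modular_fps_add:
  assumes "even k" "modular_fps k F" "modular_fps k G"
  shows "modular_fps k (F + G)"
proof -
  obtain f g where fg: "has_q_expansion f F" "has_q_expansion g G"
    "\<And>z. z \<in> upper_half_plane \<Longrightarrow> f (- 1 / z) = z powi k * f z"
    "\<And>z. z \<in> upper_half_plane \<Longrightarrow> g (- 1 / z) = z powi k * g z"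
    using assms by (auto elim!: modular_fpsE)
  show ?thesis
    by (rule modular_fpsI[OF assms(1) has_q_expansion_add[OF fg(1,2)]])
       (simp only: fg(3,4) distrib_left)
qed

lemma modular_fps_const: "modular_fps 0 (fps_const c)"
  by (rule modular_fpsI[OF _ has_q_expansion_const]) auto

lemma modular_fps_cmult:
  "even k \<Longrightarrow> modular_fps k F \<Longrightarrow> modular_fps k (fps_const c * F)"
  using modular_fps_mult[OF _ _ modular_fps_const, of k F c] by simp

lemma modular_fps_diff:
  assumes "even k" "modular_fps k F" "modular_fps k G"
  shows "modular_fps k (F - G)"
proof -
  have "F + fps_const (-1) * G = F - G" by (simp flip: fps_const_neg)
  then show ?thesis
    using modular_fps_add[OF assms(1,2) modular_fps_cmult[OF assms(1,3), of "-1"]] by simp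
qed

lemma modular_fps_power:
  assumes "even k" "modular_fps k F"
  shows "modular_fps (int n * k) (F ^ n)"
proof (induction n)
  case 0
  show ?case using modular_fps_const[of 1] by simp
next
  case (Suc n)
  then show ?case
    using modular_fps_mult[OF assms(1) _ assms(2) Suc] assms(1) by (simp add: algebra_simps)
qed

lemma qderiv_S:
  assumes f: "has_q_expansion f F" and z: "z \<in> upper_half_plane"
    and h: "\<And>z. z \<in> upper_half_plane \<Longrightarrow> f (- 1 / z) = h z" "(h has_field_derivative h') (at z)"
  shows "qderiv f (- 1 / z) = z ^ 2 * h' / (2 * of_real pi * \<i>)"
proof -
  have z0: "z \<noteq> 0" using z by (auto simp: upper_half_plane_def)
  note z' = minus_inverse_upper_half_plane[OF z]
  have "(f has_field_derivative deriv f (- 1 / z)) (at (- 1 / z))"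
    using has_q_expansion_has_derivative[OF f z'] by (simp add: DERIV_imp_deriv)
  then have "((\<lambda>z. f (- 1 / z)) has_field_derivative deriv f (- 1 / z) * (1 / z ^ 2)) (at z)"
    by (rule DERIV_chain2) (use z0 in \<open>auto intro!: derivative_eq_intros simp: power2_eq_square\<close>)
  moreover have "((\<lambda>z. f (- 1 / z)) has_field_derivative h') (at z)"
    by (rule has_field_derivative_transform_within_open[OF h(2) open_upper_half_plane z])
       (use h(1) in auto)
  ultimately have "deriv f (- 1 / z) * (1 / z ^ 2) = h'" by (rule DERIV_unique)
  then show ?thesis using z0 by (simp add: qderiv_def field_simps)
qed

definition serre_fps :: "int \<Rightarrow> complex fps \<Rightarrow> complex fps" where
  "serre_fps k F = fps_X * fps_deriv F - fps_const (of_int k / 12) * (E2_fps * F)"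

lemma has_q_expansion_serre_deriv:
  assumes "has_q_expansion f F"
  shows "has_q_expansion (serre_deriv k f) (serre_fps k F)"
proof -
  have "has_q_expansion (\<lambda>z. qderiv f z - of_int k / 12 * (E2 z * f z)) (serre_fps k F)"
    unfolding serre_fps_def
    by (intro has_q_expansion_diff has_q_expansion_qderiv has_q_expansion_cmult
        has_q_expansion_mult has_q_expansion_E2 assms)
  then show ?thesis by (simp add: serre_deriv_def[abs_def] mult.assoc)
qed

lemma qderiv_eq:
  assumes "has_q_expansion f F" "z \<in> upper_half_plane"
  shows "(f has_field_derivative 2 * of_real pi * \<i> * qderiv f z) (at z)"
  using has_q_expansion_has_derivative[OF assms]
  by (simp add: qderiv_def DERIV_imp_deriv)

text \<open>Differentiating \<open>z powi k * f z\<close> produces the unwanted term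
  \<open>k z^(k+1) f / (2 pi i)\<close>. The extra term of \<open>E2\<close>, multiplied by
  \<open>k / 12\<close>, is exactly the same.\<close>

lemma modular_fps_serre:
  assumes "even k" "modular_fps k F"
  shows "modular_fps (k + 2) (serre_fps k F)"
proof -
  obtain f where f: "has_q_expansion f F"
    "\<And>z. z \<in> upper_half_plane \<Longrightarrow> f (- 1 / z) = z powi k * f z"
    using assms by (auto elim!: modular_fpsE)
  show ?thesis
  proof (rule modular_fpsI[OF _ has_q_expansion_serre_deriv[OF f(1), of k]])
    show "even (k + 2)" using assms by simp
    fix z assume z: "z \<in> upper_half_plane"
    have z0: "z \<noteq> 0" using z by (auto simp: upper_half_plane_def)
    have *: "((\<lambda>z. z powi k * f z) has_field_derivative
        of_int k * z powi (k - 1) * f z + 2 * of_real pi * \<i> * qderiv f z * z powi k) (at z)"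
      by (auto intro!: derivative_eq_intros qderiv_eq[OF f(1) z] simp: z0)
    have pw: "z powi (k + 2) = z powi k * z ^ 2" "z powi (k - 1) = z powi k / z"
      using z0 by (simp_all add: power_int_add power_int_diff)
    have q: "qderiv f (- 1 / z) = z ^ 2 *
       (of_int k * z powi (k - 1) * f z + 2 * of_real pi * \<i> * qderiv f z * z powi k) / (2 * of_real pi * \<i>)"
      by (rule qderiv_S[OF f(1) z f(2) *])
    have "serre_deriv k f (- 1 / z) =
       z ^ 2 * (of_int k * (z powi k / z) * f z + 2 * of_real pi * \<i> * qderiv f z * z powi k) / (2 * of_real pi * \<i>) -
       of_int k / 12 * (z ^ 2 * E2 z + 6 * z / (of_real pi * \<i>)) * (z powi k * f z)"
      by (simp only: serre_deriv_def q E2_transformation[OF z] f(2)[OF z] pw)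
    also have "\<dots> = z powi k * z ^ 2 * serre_deriv k f z"
    proof -
      have "z ^ 2 * (n * (w / z) * x + 2 * \<kappa> * q * w) / (2 * \<kappa>) - n / 12 * (z ^ 2 * e + 6 * z / \<kappa>) * (w * x) =
          w * z ^ 2 * (q - n / 12 * e * x)" if "\<kappa> \<noteq> 0" for n w x \<kappa> q e
        using z0 that by (simp add: divide_simps) (simp add: algebra_simps power2_eq_square)
      from this[of "of_real pi * \<i>"] show ?thesis by (simp add: serre_deriv_def mult.assoc)
    qed
    finally show "serre_deriv k f (- 1 / z) = z powi (k + 2) * serre_deriv k f z"
      unfolding pw .
  qed
qed

text \<open>The anomalies of \<open>E2^2\<close> and of \<open>12 E2'\<close> both equal
  \<open>12 z^3 E2 / (pi i) + 36 z^2 / (pi i)^2\<close>. The difference will turn out to be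
  \<open>E4\<close>.\<close>

lemma modular_fps_E2_square_minus_deriv:
  "modular_fps 4 (E2_fps ^ 2 - fps_const 12 * (fps_X * fps_deriv E2_fps))"
proof (rule modular_fpsI)
  show "has_q_expansion (\<lambda>z. E2 z ^ 2 - 12 * qderiv E2 z)
      (E2_fps ^ 2 - fps_const 12 * (fps_X * fps_deriv E2_fps))"
    by (intro has_q_expansion_diff has_q_expansion_power has_q_expansion_cmult
        has_q_expansion_qderiv has_q_expansion_E2)
  fix z assume z: "z \<in> upper_half_plane"
  have z0: "z \<noteq> 0" using z by (auto simp: upper_half_plane_def)
  have *: "((\<lambda>z. z ^ 2 * E2 z + 6 * z / (of_real pi * \<i>)) has_field_derivative
      2 * z * E2 z + 2 * of_real pi * \<i> * qderiv E2 z * z ^ 2 + 6 / (of_real pi * \<i>)) (at z)"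
    by (rule derivative_eq_intros qderiv_eq[OF has_q_expansion_E2 z] refl | simp)+
  have "E2 (- 1 / z) ^ 2 - 12 * qderiv E2 (- 1 / z) = z ^ 4 * (E2 z ^ 2 - 12 * qderiv E2 z)"
  proof -
    have q: "qderiv E2 (- 1 / z) = z ^ 2 * (2 * z * E2 z + 2 * of_real pi * \<i> * qderiv E2 z * z ^ 2 +
        6 / (of_real pi * \<i>)) / (2 * of_real pi * \<i>)"
      by (rule qderiv_S[OF has_q_expansion_E2 z E2_transformation *])
    have "(z ^ 2 * e + 6 * z / \<kappa>) ^ 2 - 12 * (z ^ 2 * (2 * z * e + 2 * \<kappa> * q * z ^ 2 + 6 / \<kappa>) / (2 * \<kappa>)) =
        z ^ 4 * (e ^ 2 - 12 * q)" if "\<kappa> \<noteq> 0" for \<kappa> q e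
      using that by (simp add: divide_simps) (simp add: algebra_simps power2_eq_square power4_eq_xxxx)
    from this[of "of_real pi * \<i>"] show ?thesis
      unfolding q E2_transformation[OF z] by (simp add: mult.assoc)
  qed
  then show "E2 (- 1 / z) ^ 2 - 12 * qderiv E2 (- 1 / z) = z powi 4 * (E2 z ^ 2 - 12 * qderiv E2 z)"
    by simp
qed simp

lemma modular_fps_G4: "modular_fps 4 (fps_const zeta4 + fps_const (16 / 3 * of_real pi ^ 4) * sigma_fps 3)"
proof (rule modular_fpsI)
  have "has_q_expansion (\<lambda>z. zeta4 + 16 / 3 * of_real pi ^ 4 * sigma_series 3 z)
     (fps_const zeta4 + fps_const (16 / 3 * of_real pi ^ 4) * sigma_fps 3)"
    by (intro has_q_expansion_add has_q_expansion_cmult has_q_expansion_const has_q_expansion_sigma)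
  then show "has_q_expansion G4 (fps_const zeta4 + fps_const (16 / 3 * of_real pi ^ 4) * sigma_fps 3)"
    by (subst has_q_expansion_cong[OF G4_q_series])
  show "G4 (- 1 / z) = z powi 4 * G4 z" if "z \<in> upper_half_plane" for z
    using G4_transformation[OF that] by simp
qed simp

subsection \<open>The valence inequality\<close>

text \<open>A coarse substitute for the fundamental domain. If
  \<open>\<bar>Re y\<bar> \<le> 1/2\<close> and \<open>Im y < 1/2\<close>, then
  \<open>norm y ^ 2 \<le> 1/2\<close>, so inversion at least doubles the imaginary part; finitely
  many doublings reach height 1/2.\<close>

lemma upper_half_plane_reduction:
  assumes T: "\<And>z n. z \<in> upper_half_plane \<Longrightarrow> h (z + of_int n) = h z"
    and S: "\<And>z. z \<in> upper_half_plane \<Longrightarrow> h (- 1 / z) = h z"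
    and z: "z \<in> upper_half_plane"
  obtains z' where "\<bar>Re z'\<bar> \<le> 1/2" "Im z' \<ge> 1/2" "h z' = h z"
proof -
  have translate: "\<exists>y. \<bar>Re y\<bar> \<le> 1/2 \<and> Im y = Im z \<and> h y = h z" if "z \<in> upper_half_plane" for z
  proof (intro exI conjI)
    let ?y = "z + of_int (- round (Re z))"
    show "\<bar>Re ?y\<bar> \<le> 1/2" using of_int_round_abs_le[of "Re z"] by (simp add: abs_minus_commute)
    show "h ?y = h z" by (rule T[OF that])
  qed simp
  have "\<exists>z'. \<bar>Re z'\<bar> \<le> 1/2 \<and> Im z' \<ge> 1/2 \<and> h z' = h z"
    if "z \<in> upper_half_plane" "2 ^ n * Im z \<ge> 1/2" for n z
    using that
  proof (induction n arbitrary: z)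
    case 0
    then show ?case using translate[OF 0(1)] by auto
  next
    case (Suc n)
    obtain y where y: "\<bar>Re y\<bar> \<le> 1/2" "Im y = Im z" "h y = h z" using translate[OF Suc.prems(1)] by auto
    show ?case
    proof (cases "Im y \<ge> 1/2")
      case False
      have pos: "Im y > 0" using y Suc.prems(1) by (simp add: upper_half_plane_def)
      then have yH: "y \<in> upper_half_plane" by (simp add: upper_half_plane_def)
      have "\<bar>Re y\<bar> ^ 2 \<le> (1/2) ^ 2" by (rule power_mono[OF y(1)]) simp
      moreover have "Im y ^ 2 \<le> (1/2) ^ 2" using False pos by (intro power_mono) auto
      ultimately have n: "norm y ^ 2 \<le> 1/2" unfolding cmod_power2 by (simp add: power_divide)
      have n0: "norm y ^ 2 > 0" using pos by auto
      have "Im (- 1 / y) = Im y / norm y ^ 2" by (simp add: Im_divide cmod_power2)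
      moreover have "2 * Im y \<le> Im y / norm y ^ 2"
        using n n0 pos mult_left_mono[OF n, of "2 * Im y"] by (simp add: pos_le_divide_eq)
      ultimately have "2 ^ n * (2 * Im y) \<le> 2 ^ n * Im (- 1 / y)" by (intro mult_left_mono) auto
      then have "2 ^ n * Im (- 1 / y) \<ge> 1/2" using Suc.prems(2) y(2) by simp
      from Suc.IH[OF minus_inverse_upper_half_plane[OF yH] this]
      show ?thesis using S[OF yH] y(3) by auto
    qed (use y in auto)
  qed
  moreover obtain n where "2 ^ n * Im z \<ge> 1/2"
  proof -
    have "Im z > 0" using z by (simp add: upper_half_plane_def)
    moreover obtain n where "1 / (2 * Im z) < 2 ^ n" using real_arch_pow[of 2] by auto
    ultimately have "1/2 \<le> 2 ^ n * Im z" by (simp add: field_simps)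
    then show ?thesis by (rule that)
  qed
  ultimately show ?thesis using z that by blast
qed

text \<open>The maximum principle is applied on the part of the strip \<open>\<bar>Re z\<bar> \<le> 1/2\<close>, \<open>Im z \<ge> 1/2\<close> below height \<open>Y\<close>.\<close>

lemma modular_function_vanishing_at_cusp:
  assumes hol: "h holomorphic_on upper_half_plane"
    and T: "\<And>z n. z \<in> upper_half_plane \<Longrightarrow> h (z + of_int n) = h z"
    and S: "\<And>z. z \<in> upper_half_plane \<Longrightarrow> h (- 1 / z) = h z"
    and cusp: "\<And>\<epsilon>. \<epsilon> > 0 \<Longrightarrow> \<exists>Y. \<forall>z. Im z > Y \<longrightarrow> norm (h z) < \<epsilon>"
    and z: "z \<in> upper_half_plane"
  shows "h z = 0"
proof (rule ccontr)
  assume nz: "h z \<noteq> 0"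
  obtain Y where Y: "\<And>w. Im w > Y \<Longrightarrow> norm (h w) < norm (h z)" using cusp[of "norm (h z)"] nz by auto
  define K where "K = cbox (Complex (-1/2) (1/2)) (Complex (1/2) (max Y (1/2)))"
  have K: "w \<in> K \<longleftrightarrow> \<bar>Re w\<bar> \<le> 1/2 \<and> 1/2 \<le> Im w \<and> Im w \<le> max Y (1/2)" for w
    by (auto simp: K_def in_cbox_complex_iff)
  have KH: "K \<subseteq> upper_half_plane" by (auto simp: K upper_half_plane_def)
  \<comment> \<open>Above height \<open>Y\<close> the function is smaller than at \<open>z\<close>.
    A point where it is at least as large therefore has its representative in the compact set
    \<open>K\<close>, and the maximum over \<open>K\<close> is a global one.\<close>
  have red: "\<exists>w'\<in>K. h w' = h w" if w: "w \<in> upper_half_plane" "norm (h w) \<ge> norm (h z)" for w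
  proof -
    obtain w' where w': "\<bar>Re w'\<bar> \<le> 1/2" "Im w' \<ge> 1/2" "h w' = h w"
      using upper_half_plane_reduction[of h, OF T S w(1)] by blast
    have "\<not> Im w' > Y" using Y[of w'] w' w by auto
    with w' have "w' \<in> K" by (auto simp: K)
    with w' show ?thesis by auto
  qed
  have "K \<noteq> {}" using red[OF z] by auto
  moreover have "continuous_on K (\<lambda>w. norm (h w))"
    by (intro continuous_on_norm holomorphic_on_imp_continuous_on holomorphic_on_subset[OF hol KH])
  moreover have "compact K" by (simp add: K_def)
  ultimately obtain m where m: "m \<in> K" "\<And>w. w \<in> K \<Longrightarrow> norm (h w) \<le> norm (h m)"
    using continuous_attains_sup[of K "\<lambda>w. norm (h w)"] by auto
  have mH: "m \<in> upper_half_plane" using m KH by auto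
  have max: "norm (h w) \<le> norm (h m)" if "w \<in> upper_half_plane" for w
  proof (cases "norm (h w) \<ge> norm (h z)")
    case True
    then show ?thesis using red[OF that True] m(2) by metis
  next
    case False
    obtain w' where "w' \<in> K" "h w' = h z" using red[OF z] by auto
    then show ?thesis using m(2)[of w'] False by auto
  qed
  have const: "h constant_on upper_half_plane"
    by (rule maximum_modulus_principle[OF hol open_upper_half_plane convex_connected[OF convex_upper_half_plane]
          open_upper_half_plane order_refl mH max])
  define w where "w = Complex 0 (max Y 0 + 1)"
  have "w \<in> upper_half_plane" by (simp add: w_def upper_half_plane_def)
  then have "h w = h z" using const z by (auto simp: constant_on_def)
  moreover have "norm (h w) < norm (h z)" by (rule Y) (simp add: w_def)
  ultimately show False by simp
qed

text \<open>The logarithmic derivative of \<open>\<Delta>\<close> is \<open>E\<^sub>2\<close>; this is used to define \<open>\<Delta>\<close>, so that it has no zeros.\<close>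

definition log_discr_fps :: "complex fps" where
  "log_discr_fps = Abs_fps (\<lambda>n. - 24 * of_nat (divisor_sum 1 n) / of_nat n)"

lemma conv_radius_log_discr_fps: "fps_conv_radius log_discr_fps \<ge> 1"
proof -
  have "fps_conv_radius (fps_const (1/24) * log_discr_fps) \<ge> 1"
  proof (rule conv_radius_polynomial_growth[of _ 2])
    fix n show "norm (fps_nth (fps_const (1/24) * log_discr_fps) n) \<le> real n ^ 2"
    proof (cases "n = 0")
      case False
      have "real (divisor_sum 1 n) \<le> real n ^ 2"
        using divisor_sum_le[of 1 n] by (simp add: power2_eq_square flip: of_nat_mult)
      also have "\<dots> \<le> real n ^ 2 * real n" using False by simp
      finally show ?thesis using False
        by (simp add: log_discr_fps_def norm_divide norm_mult divide_simps)
    qed (simp add: log_discr_fps_def)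
  qed
  then show ?thesis by (simp add: fps_conv_radius_cmult_left)
qed

lemma log_discr_fps_deriv: "fps_X * fps_deriv log_discr_fps = E2_fps - 1"
proof (rule fps_ext)
  fix n show "fps_nth (fps_X * fps_deriv log_discr_fps) n = fps_nth (E2_fps - 1) n"
    by (cases n) (simp_all add: log_discr_fps_def E2_fps_def sigma_fps_def del: of_nat_Suc)
qed

text \<open>This is \<open>q\<close> times the product of all \<open>(1 - q^n)^24\<close>, the
  logarithm of that product being the series \<open>log_discr_fps\<close>.\<close>

definition discr :: "complex \<Rightarrow> complex" where
  "discr z = nome z * exp (eval_fps log_discr_fps (nome z))"

lemma discr_nonzero [simp]: "discr z \<noteq> 0"
  by (simp add: discr_def)

lemma has_field_derivative_discr:
  assumes z: "z \<in> upper_half_plane"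
  shows "(discr has_field_derivative 2 * of_real pi * \<i> * E2 z * discr z) (at z)"
proof -
  have L: "has_q_expansion (\<lambda>z. eval_fps log_discr_fps (nome z)) log_discr_fps"
    by (simp add: has_q_expansion_iff conv_radius_log_discr_fps)
  have E: "has_q_expansion (\<lambda>z. E2 z - 1) (E2_fps - 1)"
    using has_q_expansion_diff[OF has_q_expansion_E2 has_q_expansion_const[of 1]] by simp
  have "((\<lambda>z. eval_fps log_discr_fps (nome z)) has_field_derivative 2 * of_real pi * \<i> * (E2 z - 1)) (at z)"
    using has_q_expansion_has_derivative[OF L z] E z by (simp add: log_discr_fps_deriv has_q_expansion_iff)
  then have "((\<lambda>z. nome z * exp (eval_fps log_discr_fps (nome z))) has_field_derivative
      2 * of_real pi * \<i> * nome z * exp (eval_fps log_discr_fps (nome z)) +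
      exp (eval_fps log_discr_fps (nome z)) * (2 * of_real pi * \<i> * (E2 z - 1)) * nome z) (at z)"
    by (intro DERIV_mult has_field_derivative_nome DERIV_chain2[OF DERIV_exp])
  then show ?thesis by (simp add: discr_def[abs_def] algebra_simps)
qed

text \<open>The extra term of \<open>E2\<close> gives \<open>discr (- 1 / z)\<close> and
  \<open>z ^ 12 * discr z\<close> the same logarithmic derivative. Their constant ratio is found at
  the fixed point \<open>\<i>\<close>, where it is 1 since the twelfth power of \<open>\<i>\<close>
  is 1.\<close>

lemma discr_transformation:
  assumes z: "z \<in> upper_half_plane"
  shows "discr (- 1 / z) = z ^ 12 * discr z"
proof -
  define r where "r z = discr (- 1 / z) / (z ^ 12 * discr z)" for z
  have "(r has_field_derivative 0) (at z within upper_half_plane)" if z: "z \<in> upper_half_plane" for z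
  proof -
    have z0: "z \<noteq> 0" using z by (auto simp: upper_half_plane_def)
    have "((\<lambda>z. discr (- 1 / z)) has_field_derivative
        2 * of_real pi * \<i> * E2 (- 1 / z) * discr (- 1 / z) * (1 / z ^ 2)) (at z)"
      by (rule DERIV_chain2[where f = discr and g = "\<lambda>z. - 1 / z", OF has_field_derivative_discr[OF minus_inverse_upper_half_plane[OF z]]])
         (use z0 in \<open>auto intro!: derivative_eq_intros simp: power2_eq_square\<close>)
    moreover have "((\<lambda>z. z ^ 12 * discr z) has_field_derivative
        12 * z ^ 11 * discr z + 2 * of_real pi * \<i> * E2 z * discr z * z ^ 12) (at z)"
      using has_field_derivative_discr[OF z] by (auto intro!: derivative_eq_intros)
    ultimately have "(r has_field_derivative
       (2 * of_real pi * \<i> * E2 (- 1 / z) * discr (- 1 / z) * (1 / z ^ 2) * (z ^ 12 * discr z) -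
        discr (- 1 / z) * (12 * z ^ 11 * discr z + 2 * of_real pi * \<i> * E2 z * discr z * z ^ 12)) /
       ((z ^ 12 * discr z) * (z ^ 12 * discr z))) (at z)"
      unfolding r_def by (rule DERIV_divide) (use z0 in simp)
    moreover have E: "2 * of_real pi * \<i> * E2 (- 1 / z) * (1 / z ^ 2) = 2 * of_real pi * \<i> * E2 z + 12 / z"
      unfolding E2_transformation[OF z] using z0 by (simp add: field_simps power2_eq_square)
    have "p * d' * u * (z ^ 12 * d) - d' * (12 * z ^ 11 * d + e * d * z ^ 12) = 0" if "p * u = e + 12 / z" for p d' u d e
    proof -
      have "p * d' * u * (z ^ 12 * d) - d' * (12 * z ^ 11 * d + e * d * z ^ 12) =
          d' * d * ((p * u) * z ^ 12 - (12 * z ^ 11 + e * z ^ 12))" by (simp add: algebra_simps)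
      also have "\<dots> = 0" unfolding that using z0 by (simp add: algebra_simps power_eq_if)
      finally show ?thesis .
    qed
    moreover note this[OF E, of "discr (- 1 / z)" "discr z"]
    ultimately have "(r has_field_derivative 0 / ((z ^ 12 * discr z) * (z ^ 12 * discr z))) (at z)"
      by (simp only:)
    then show ?thesis using has_field_derivative_at_within by auto
  qed
  then have "r z = r \<i>"
    using has_field_derivative_zero_constant[OF convex_upper_half_plane, of r] z
    by (metis (no_types, lifting) mem_Collect_eq upper_half_plane_def imaginary_unit.simps(2) zero_less_one)
  also have "r \<i> = 1" by (simp add: r_def power_eq_if)
  finally show ?thesis using z by (auto simp: r_def upper_half_plane_def field_simps)
qed

text \<open>\<open>f^12 / discr^k\<close> has weight 0, is holomorphic as \<open>discr\<close> has
  no zeros, and has order \<open>12 * subdegree F - k\<close> at the cusp. If this is positive, the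
  maximum principle makes the function vanish.\<close>

theorem valence_inequality:
  assumes F: "modular_fps (int k) F" and k: "even k" and nz: "F \<noteq> 0"
  shows "12 * subdegree F \<le> k"
proof (rule ccontr)
  assume "\<not> 12 * subdegree F \<le> k"
  then have gt: "12 * subdegree F > k" by simp
  define N where "N = subdegree F"
  obtain f where f: "has_q_expansion f F"
    "\<And>z. z \<in> upper_half_plane \<Longrightarrow> f (- 1 / z) = z powi (int k) * f z"
    using F by (auto elim!: modular_fpsE)
  define h where "h z = f z ^ 12 / discr z ^ k" for z
  have FR: "fps_conv_radius F \<ge> 1" using f by (simp add: has_q_expansion_iff)
  \<comment> \<open>The function \<open>h\<close> in terms of \<open>q\<close>, with the powers of
    \<open>q\<close> collected in front so that it is continuous at \<open>q = 0\<close> and visibly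
    vanishes there.\<close>
  define \<phi> where "\<phi> q = q ^ (12 * N - k) * (eval_fps (fps_shift N F) q) ^ 12 / exp (eval_fps log_discr_fps q) ^ k" for q
  have h\<phi>: "h z = \<phi> (nome z)" if "z \<in> upper_half_plane" for z
  proof -
    have "F = fps_X ^ N * fps_shift N F" unfolding N_def
      by (metis mult.commute subdegree_decompose)
    moreover have "ereal (norm (nome z)) < fps_conv_radius (fps_shift N F)"
      using norm_nome_less_conv_radius[OF that FR] by simp
    ultimately have "eval_fps F (nome z) = nome z ^ N * eval_fps (fps_shift N F) (nome z)"
      by (metis eval_fps_mult eval_fps_X_power fps_conv_radius_fps_X_power ereal_less_PInfty less_ereal.simps(4) ereal_infty_less(1) less_PInf_Ex_of_nat)
    moreover have "f z = eval_fps F (nome z)" using f that by (simp add: has_q_expansion_iff)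
    moreover have "nome z ^ (12 * N) = nome z ^ (12 * N - k) * nome z ^ k"
      using gt by (simp add: N_def flip: power_add)
    ultimately show ?thesis
      by (simp add: h_def \<phi>_def discr_def power_mult_distrib power_mult[symmetric] mult.commute)
  qed
  have h0: "h z = 0" if "z \<in> upper_half_plane" for z
  proof (rule modular_function_vanishing_at_cusp[OF _ _ _ _ that])
    have "discr holomorphic_on upper_half_plane"
      by (subst holomorphic_on_open) (auto dest: has_field_derivative_discr)
    then show "h holomorphic_on upper_half_plane"
      unfolding h_def by (intro holomorphic_intros has_q_expansion_holomorphic[OF f(1)]) auto
    show "h (z + of_int n) = h z" if "z \<in> upper_half_plane" for z n
    proof -
      have "nome (z + of_int n) = nome z"
        using has_q_expansion_periodic[of nome fps_X z n] that
        by (simp add: has_q_expansion_iff)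
      then show ?thesis
        using has_q_expansion_periodic[OF f(1) that] by (simp add: h_def discr_def)
    qed
    show "h (- 1 / z) = h z" if "z \<in> upper_half_plane" for z
    proof -
      have "z \<noteq> 0" using that by (auto simp: upper_half_plane_def)
      then show ?thesis using f(2)[OF that] discr_transformation[OF that]
        by (simp add: h_def power_mult_distrib mult.commute flip: power_mult)
    qed
    fix \<epsilon> :: real assume "\<epsilon> > 0"
    have "ereal 0 < fps_conv_radius F" "ereal 0 < fps_conv_radius log_discr_fps"
      using FR conv_radius_log_discr_fps by (auto intro: less_le_trans[of _ 1])
    then have "isCont \<phi> 0" unfolding \<phi>_def by (intro continuous_intros) auto
    moreover have "\<phi> 0 = 0" using gt by (simp add: \<phi>_def N_def)
    ultimately have "(\<phi> \<longlongrightarrow> 0) (at 0)" by (simp add: isCont_def)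
    from tendstoD[OF this \<open>\<epsilon> > 0\<close>]
    obtain \<delta> where d: "\<delta> > 0" "\<And>q. q \<noteq> 0 \<Longrightarrow> norm q < \<delta> \<Longrightarrow> norm (\<phi> q) < \<epsilon>"
      by (auto simp: eventually_at)
    show "\<exists>Y. \<forall>z. Im z > Y \<longrightarrow> norm (h z) < \<epsilon>"
    proof (intro exI allI impI)
      fix z assume z: "Im z > max 0 (- ln \<delta> / (2 * pi))"
      then have "- ln \<delta> / (2 * pi) < Im z" by simp
      then have "-(2 * pi * Im z) < ln \<delta>" by (simp add: field_simps)
      then have "norm (nome z) < \<delta>" using d(1) by (simp add: norm_nome) (metis exp_less_mono exp_ln)
      moreover have "z \<in> upper_half_plane" using z by (simp add: upper_half_plane_def)
      ultimately show "norm (h z) < \<epsilon>" using d(2)[of "nome z"] h\<phi> by simp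
    qed
  qed
  have "F = 0"
    by (rule has_q_expansion_unique[OF f(1) has_q_expansion_0]) (use h0 in \<open>auto simp: h_def\<close>)
  with nz show False by simp
qed

subsection \<open>Ramanujan's identities and dimension bounds\<close>

lemma serre_fps_add: "serre_fps k (F + G) = serre_fps k F + serre_fps k G"
  by (simp add: serre_fps_def algebra_simps)

lemma serre_fps_mult: "serre_fps (k + l) (F * G) = serre_fps k F * G + F * serre_fps l G"
proof -
  have "fps_const (of_int (k + l) / 12) = fps_const (of_int k / 12) + fps_const (of_int l / 12 :: complex)"
    by (simp add: add_divide_distrib)
  then show ?thesis by (simp only: serre_fps_def fps_deriv_mult) (simp only: algebra_simps)
qed

lemma serre_fps_const: "serre_fps 0 (fps_const c) = 0"
  by (simp add: serre_fps_def)

lemma serre_fps_cmult: "serre_fps k (fps_const c * F) = fps_const c * serre_fps k F"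
  using serre_fps_mult[of 0 k "fps_const c" F] by (simp add: serre_fps_const)

lemma serre_fps_diff: "serre_fps k (F - G) = serre_fps k F - serre_fps k G"
  by (simp add: serre_fps_def algebra_simps)

lemma modular_fps_eq_0:
  assumes "modular_fps (int k) F" "even k" "\<And>n. 12 * n \<le> k \<Longrightarrow> fps_nth F n = 0"
  shows "F = 0"
  using valence_inequality[OF assms(1,2)] assms(3)[of "subdegree F"] by (auto simp: subdegree_eq_0_iff)

lemma E2_fps_nth: "fps_nth E2_fps 0 = 1" "fps_nth E2_fps (Suc 0) = - 24"
  and E4_fps_nth: "fps_nth E4_fps 0 = 1" "fps_nth E4_fps (Suc 0) = 240"
  by (simp_all add: E2_fps_def E4_fps_def sigma_fps_def)

text \<open>
  The constant term \<open>2 \<zeta>(4)\<close> of the lattice sum \<open>G\<^sub>4\<close> need not be evaluated: comparing two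
  coefficients with \<open>E\<^sub>2\<^sup>2 - 12 E\<^sub>2'\<close> determines it.
\<close>

lemma E4_fps_eq: "E4_fps = E2_fps ^ 2 - fps_const 12 * (fps_X * fps_deriv E2_fps)"
  and modular_fps_E4: "modular_fps 4 E4_fps"
proof -
  define F where "F = E2_fps ^ 2 - fps_const 12 * (fps_X * fps_deriv E2_fps)"
  define \<beta> :: complex where "\<beta> = 16 / 3 * of_real pi ^ 4"
  define G where "G = fps_const zeta4 + fps_const \<beta> * sigma_fps 3"
  have F: "modular_fps 4 F" "fps_nth F 0 = 1" "fps_nth F (Suc 0) = 240"
    using modular_fps_E2_square_minus_deriv
    by (simp_all add: F_def power2_eq_square fps_mult_nth_1' E2_fps_nth)
  have G: "modular_fps 4 G" "fps_nth G 0 = zeta4" "fps_nth G (Suc 0) = \<beta>"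
    using modular_fps_G4 by (simp_all add: G_def \<beta>_def sigma_fps_def)
  have "G - fps_const zeta4 * F = 0"
  proof (rule modular_fps_eq_0[of 4])
    show "modular_fps (int 4) (G - fps_const zeta4 * F)"
      using modular_fps_diff[OF _ G(1) modular_fps_cmult[OF _ F(1)]] by simp
    show "fps_nth (G - fps_const zeta4 * F) n = 0" if "12 * n \<le> 4" for n
    proof -
      have "n = 0" using that by simp
      then show ?thesis by (simp add: F G)
    qed
  qed simp
  then have eq: "G = fps_const zeta4 * F" by simp
  then have "\<beta> = zeta4 * 240" using F(3) G(3) by simp
  moreover have "\<beta> \<noteq> 0" by (simp add: \<beta>_def)
  ultimately have "zeta4 \<noteq> 0" and "G = fps_const zeta4 * E4_fps"
    by (auto simp: G_def E4_fps_def distrib_left mult.assoc[symmetric])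
  with eq have "E4_fps = F" by simp
  then show "E4_fps = E2_fps ^ 2 - fps_const 12 * (fps_X * fps_deriv E2_fps)" "modular_fps 4 E4_fps"
    using F(1) by (simp_all add: F_def)
qed

text \<open>The Eisenstein series of weight 6, obtained from the Serre derivative of
  \<open>E4\<close> instead of a lattice sum; its modularity is then inherited from
  \<open>E4\<close>.\<close>

definition E6_fps :: "complex fps" where "E6_fps = fps_const (-3) * serre_fps 4 E4_fps"

lemma modular_fps_E6: "modular_fps 6 E6_fps"
  using modular_fps_cmult[OF _ modular_fps_serre[OF _ modular_fps_E4]] by (simp add: E6_fps_def)

lemma E6_fps_nth: "fps_nth E6_fps 0 = 1" "fps_nth E6_fps (Suc 0) = - 504"
  by (simp_all add: E6_fps_def serre_fps_def fps_mult_nth_1' E2_fps_nth E4_fps_nth)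

lemma serre_E4: "serre_fps 4 E4_fps = fps_const (- 1 / 3) * E6_fps"
  by (simp add: E6_fps_def mult.assoc[symmetric])

text \<open>A form of weight 8 is determined by its constant term, and that of the left side is
  \<open>- 6 / 12\<close>.\<close>

lemma serre_E6: "serre_fps 6 E6_fps = fps_const (- 1 / 2) * E4_fps ^ 2"
proof -
  have "serre_fps 6 E6_fps - fps_const (- 1 / 2) * E4_fps ^ 2 = 0"
  proof (rule modular_fps_eq_0[of 8])
    have "modular_fps 8 (fps_const (- 1 / 2) * E4_fps ^ 2)"
      using modular_fps_cmult[OF _ modular_fps_power[OF _ modular_fps_E4, of 2]] by simp
    then show "modular_fps (int 8) (serre_fps 6 E6_fps - fps_const (- 1 / 2) * E4_fps ^ 2)"
      using modular_fps_diff[OF _ modular_fps_serre[OF _ modular_fps_E6]] by simp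
    show "fps_nth (serre_fps 6 E6_fps - fps_const (- 1 / 2) * E4_fps ^ 2) n = 0" if "12 * n \<le> 8" for n
    proof -
      have "n = 0" using that by simp
      then show ?thesis by (simp add: serre_fps_def E2_fps_nth E4_fps_nth E6_fps_nth power2_eq_square)
    qed
  qed simp
  then show ?thesis by simp
qed

text \<open>The valence inequality still allows order \<open>a\<close> here. If \<open>c\<close> is
  the coefficient at \<open>a\<close>, then \<open>F^2\<close> and \<open>F^3\<close> are explicit
  multiples of \<open>E4 \<Delta>^(2a)\<close> and \<open>E6 \<Delta>^(3a)\<close>. Computing
  \<open>F^6\<close> in both ways gives \<open>c^6 (E4^3 - E6^2) \<Delta>^(6a) = 0\<close>, and the
  middle factor is the nonzero \<open>\<Delta>\<close>; hence \<open>c = 0\<close>.\<close>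

lemma modular_fps_weight_2_mod_12:
  assumes F: "modular_fps (int (12 * a + 2)) F" and a: "\<And>n. n < a \<Longrightarrow> fps_nth F n = 0"
  shows "F = 0"
proof -
  define \<Delta> where "\<Delta> = E4_fps ^ 3 - E6_fps ^ 2"
  have "modular_fps 12 (E4_fps ^ 3)" "modular_fps 12 (E6_fps ^ 2)"
    using modular_fps_power[OF _ modular_fps_E4, of 3] modular_fps_power[OF _ modular_fps_E6, of 2] by simp_all
  then have \<Delta>: "modular_fps 12 \<Delta>"
    unfolding \<Delta>_def by (intro modular_fps_diff) simp_all
  have \<Delta>0: "fps_nth \<Delta> 0 = 0" and \<Delta>1: "fps_nth \<Delta> (Suc 0) = 1728"
    by (simp_all add: \<Delta>_def power2_eq_square power3_eq_cube fps_mult_nth_1' E4_fps_nth E6_fps_nth)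
  define \<Delta>' where "\<Delta>' = fps_shift 1 \<Delta>"
  define F' where "F' = fps_shift a F"
  have X\<Delta>: "\<Delta> = fps_X * \<Delta>'"
    by (rule fps_ext) (use \<Delta>0 in \<open>auto simp: \<Delta>'_def not_less\<close>)
  have XF: "F = fps_X ^ a * F'"
    by (rule fps_ext) (use a in \<open>auto simp: F'_def fps_X_power_mult_nth\<close>)
  define c where "c = fps_nth F' 0"
  have \<Delta>'0: "fps_nth \<Delta>' 0 = 1728" using \<Delta>1 by (simp add: \<Delta>'_def)
  \<comment> \<open>In weight \<open>r * (12 * a + 2)\<close> with \<open>r\<close> equal to 2 or 3
    the largest possible order is \<open>r * a\<close>, so two forms vanishing to this order are
    proportional. The factor compares their coefficients at \<open>r * a\<close>;
    \<open>\<Delta>\<close> begins with \<open>1728 q\<close>.\<close>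
  have key: "F ^ r = fps_const (c ^ r / 1728 ^ (r * a)) * (E * \<Delta> ^ (r * a))"
    if r: "r = 2 \<and> E = E4_fps \<or> r = 3 \<and> E = E6_fps" for r E
  proof -
    define \<kappa> where "\<kappa> = c ^ r / 1728 ^ (r * a)"
    have E: "modular_fps (int (2 * r)) E" "fps_nth E 0 = 1"
      using r modular_fps_E4 modular_fps_E6 by (auto simp: E4_fps_nth E6_fps_nth)
    have "F ^ r - fps_const \<kappa> * (E * \<Delta> ^ (r * a)) = 0"
    proof (rule modular_fps_eq_0[of "r * (12 * a + 2)"])
      have "modular_fps (int r * int (12 * a + 2)) (F ^ r)"
        by (rule modular_fps_power[OF _ F]) simp
      moreover have "modular_fps (int (2 * r) + int (r * a) * 12) (E * \<Delta> ^ (r * a))"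
        by (rule modular_fps_mult[OF _ _ E(1) modular_fps_power[OF _ \<Delta>]]) simp_all
      moreover have "int (2 * r) + int (r * a) * 12 = int r * int (12 * a + 2)"
        by (simp add: algebra_simps)
      ultimately show "modular_fps (int (r * (12 * a + 2))) (F ^ r - fps_const \<kappa> * (E * \<Delta> ^ (r * a)))"
        by (simp only: of_nat_mult) (rule modular_fps_diff modular_fps_cmult | simp)+
      fix n assume "12 * n \<le> r * (12 * a + 2)"
      then have n: "n \<le> r * a" using r by (auto simp: algebra_simps)
      have "F ^ r - fps_const \<kappa> * (E * \<Delta> ^ (r * a)) =
          fps_X ^ (r * a) * (F' ^ r - fps_const \<kappa> * (E * \<Delta>' ^ (r * a)))"
        unfolding XF X\<Delta> power_mult_distrib by (simp add: algebra_simps power_mult[symmetric])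
      moreover have "fps_nth (F' ^ r - fps_const \<kappa> * (E * \<Delta>' ^ (r * a))) 0 = 0"
        by (simp add: fps_nth_power_0 E \<Delta>'0 c_def[symmetric] \<kappa>_def)
      ultimately show "fps_nth (F ^ r - fps_const \<kappa> * (E * \<Delta> ^ (r * a))) n = 0"
        using n by (auto simp: fps_X_power_mult_nth not_less)
    qed simp
    then show ?thesis by (simp add: \<kappa>_def)
  qed
  define \<kappa> where "\<kappa> = c ^ 6 / 1728 ^ (6 * a)"
  have pc: "fps_const x ^ n = fps_const (x ^ n)" for x :: complex and n by (rule fps_const_power)
  have "(F ^ 2) ^ 3 = fps_const \<kappa> * (E4_fps ^ 3 * \<Delta> ^ (6 * a))"
    by (subst key[of 2 E4_fps])
       (simp_all add: \<kappa>_def power_mult_distrib fps_const_power power_divide power_mult[symmetric])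
  moreover have "(F ^ 3) ^ 2 = fps_const \<kappa> * (E6_fps ^ 2 * \<Delta> ^ (6 * a))"
    by (subst key[of 3 E6_fps])
       (simp_all add: \<kappa>_def power_mult_distrib fps_const_power power_divide power_mult[symmetric])
  moreover have "(F ^ 2) ^ 3 = (F ^ 3) ^ 2" by (simp add: power_mult[symmetric])
  ultimately have "fps_const \<kappa> * (\<Delta> * \<Delta> ^ (6 * a)) = 0"
    by (simp add: \<Delta>_def algebra_simps)
  moreover have "\<Delta> \<noteq> 0" using \<Delta>1 by auto
  ultimately have "\<kappa> = 0" by auto
  then have "c = 0" by (simp add: \<kappa>_def)
  then have "fps_nth F a = 0" by (simp add: XF c_def fps_X_power_mult_nth)
  then have "fps_nth F n = 0" if "n \<le> a" for n using a[of n] that by (cases "n = a") auto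
  then show ?thesis by (intro modular_fps_eq_0[OF F]) auto
qed

text \<open>For even \<open>k\<close> the classical dimension of the space of modular forms. It
  enters as the number of initial coefficients that determine a form, hence as an upper
  bound.\<close>

definition modular_dim :: "nat \<Rightarrow> nat" where
  "modular_dim k = (if k mod 12 = 2 then k div 12 else k div 12 + 1)"

lemma modular_fps_eq_0_modular_dim:
  assumes F: "modular_fps (int k) F" "even k" and z: "\<And>n. n < modular_dim k \<Longrightarrow> fps_nth F n = 0"
  shows "F = 0"
proof (cases "k mod 12 = 2")
  case True
  then have "k = 12 * (k div 12) + 2" by (metis mult_div_mod_eq)
  with F(1) have "modular_fps (int (12 * (k div 12) + 2)) F" by simp
  then show ?thesis by (rule modular_fps_weight_2_mod_12) (use z True in \<open>simp add: modular_dim_def\<close>)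
next
  case False
  show ?thesis
    by (rule modular_fps_eq_0[OF F]) (use z False in \<open>auto simp: modular_dim_def\<close>)
qed

lemma modular_dim_sum_le:
  assumes "even w" "w \<ge> 4"
  shows "modular_dim w + modular_dim (w - 2) + modular_dim (w - 4) \<le> w div 4 + 1"
proof -
  obtain v where v: "w = 2 * v" using assms by (elim evenE)
  \<comment> \<open>Raising the weight by 12 raises both sides by 3, so the residue of
    \<open>w / 2\<close> modulo 6 decides. For residues 0 and 1 the weight \<open>w - 4\<close>
    falls into the preceding block of 12, and \<open>w \<ge> 4\<close> provides
    \<open>a > 0\<close>.\<close>
  define a r where "a = v div 6" and "r = v mod 6"
  have v': "v = 6 * a + r" "r < 6" by (simp_all add: a_def r_def)
  then have "r = 0 \<or> r = 1 \<or> r = 2 \<or> r = 3 \<or> r = 4 \<or> r = 5" by auto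
  moreover have "a > 0" if "r = 0 \<or> r = 1" using assms that v v' by (cases a) auto
  ultimately show ?thesis unfolding modular_dim_def v v'
    by (elim disjE; cases a; simp)
qed

section \<open>Linear algebra with coefficient functionals\<close>

context vector_space
begin

text \<open>Passing to the kernel of one functional costs at most one spanning vector. Linearity is
  assumed only on \<open>S\<close> because a coefficient is meaningful only for functions that have
  a \<open>q\<close>-expansion.\<close>

lemma subspace_spanned_by_few:
  assumes "subspace S"
    and "\<And>n x y. x \<in> S \<Longrightarrow> y \<in> S \<Longrightarrow> c n (x + y) = c n x + c n y"
    and "\<And>n a x. x \<in> S \<Longrightarrow> c n (scale a x) = a * c n x"
    and "\<And>x. x \<in> S \<Longrightarrow> (\<And>n. n < N \<Longrightarrow> c n x = 0) \<Longrightarrow> x = 0"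
  shows "\<exists>B. finite B \<and> card B \<le> N \<and> S \<subseteq> span B"
  using assms
proof (induction N arbitrary: S)
  case 0
  then have "S \<subseteq> span {}" by auto
  then show ?case by (metis card.empty finite.emptyI le_refl)
next
  case (Suc N)
  define S' where "S' = {x \<in> S. c N x = 0}"
  have "0 \<in> S" using Suc.prems(1) by (rule subspace_0)
  then have "c N (scale 0 0) = 0" using Suc.prems(3)[of 0 N 0] by simp
  then have S': "subspace S'" using Suc.prems(1,2,3) \<open>0 \<in> S\<close>
    by (auto simp: subspace_def S'_def)
  obtain B where B: "finite B" "card B \<le> N" "S' \<subseteq> span B"
  proof -
    have "\<exists>B. finite B \<and> card B \<le> N \<and> S' \<subseteq> span B"
    proof (rule Suc.IH[OF S'])
      show "x = 0" if "x \<in> S'" "\<And>n. n < N \<Longrightarrow> c n x = 0" for x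
        using Suc.prems(4)[of x] that by (auto simp: S'_def less_Suc_eq)
    qed (use Suc.prems(2,3) in \<open>auto simp: S'_def\<close>)
    then show ?thesis using that by blast
  qed
  show ?case
  proof (cases "S' = S")
    case True
    then show ?thesis using B by (auto intro!: exI[of _ B])
  next
    case False
    then obtain y where y: "y \<in> S" "c N y \<noteq> 0" by (auto simp: S'_def)
    have "x \<in> span (insert y B)" if x: "x \<in> S" for x
    proof -
      define u where "u = x + scale (- (c N x / c N y)) y"
      have sy: "scale (- (c N x / c N y)) y \<in> S" using Suc.prems(1) y by (intro subspace_scale)
      have "u \<in> S" unfolding u_def using Suc.prems(1) x sy by (intro subspace_add)
      moreover have "c N u = 0"
        unfolding u_def Suc.prems(2)[OF x sy] Suc.prems(3)[OF y(1)] using y by simp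
      ultimately have "u \<in> span B" using B by (auto simp: S'_def)
      then have "x - scale (c N x / c N y) y \<in> span B" by (simp add: u_def)
      then show ?thesis by (auto simp: span_breakdown_eq)
    qed
    moreover have "card (insert y B) \<le> Suc N" using B card_insert_le_m1[of "Suc N" B y] by simp
    ultimately show ?thesis using B(1) by (intro exI[of _ "insert y B"]) auto
  qed
qed

text \<open>The echelon shape makes the \<open>e j\<close> independent, and a further independent
  vector would exceed the size of the spanning set \<open>B\<close>; so they form a basis. The
  triangular system then shows that the first \<open>N\<close> functionals detect zero, which later
  yields uniqueness of extremal forms.\<close>

lemma triangular_family_basis:
  assumes S: "subspace S"
    and add: "\<And>n x y. x \<in> S \<Longrightarrow> y \<in> S \<Longrightarrow> c n (x + y) = c n x + c n y"
    and sc: "\<And>n a x. x \<in> S \<Longrightarrow> c n (scale a x) = a * c n x"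
    and B: "finite B" "card B \<le> N" "S \<subseteq> span B"
    and e: "\<And>j. j < N \<Longrightarrow> e j \<in> S" "\<And>j n. j < N \<Longrightarrow> n < j \<Longrightarrow> c n (e j) = 0"
      "\<And>j. j < N \<Longrightarrow> c j (e j) \<noteq> 0"
  shows "dim S = N" and "\<And>x. x \<in> S \<Longrightarrow> (\<And>n. n < N \<Longrightarrow> c n x = 0) \<Longrightarrow> x = 0"
proof -
  have c0: "c n 0 = 0" for n using sc[of 0 n 0] subspace_0[OF S] by simp
  have c_sum: "c n (\<Sum>j\<in>A. scale (a j) (e j)) = (\<Sum>j\<in>A. a j * c n (e j))" if "A \<subseteq> {..<N}" "finite A" for n a A
    using that(2,1)
  proof (induction A rule: finite_induct)
    case (insert j A)
    have "(\<Sum>j\<in>A. scale (a j) (e j)) \<in> S" "scale (a j) (e j) \<in> S"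
      using insert.prems S e(1) by (auto intro!: subspace_sum subspace_scale)
    then show ?case using insert e(1) by (simp add: add sc)
  qed (simp add: c0)
  have zero: "a j = 0" if "\<And>n. n < N \<Longrightarrow> c n (\<Sum>j<N. scale (a j) (e j)) = 0" "j < N" for a j
    using that(2)
  proof (induction j rule: less_induct)
    case (less j)
    have "0 = (\<Sum>i<N. a i * c j (e i))" using that(1)[OF less.prems] by (simp add: c_sum)
    also have "\<dots> = (\<Sum>i\<in>{j}. a i * c j (e i))"
    proof (rule sum.mono_neutral_right)
      show "\<forall>i\<in>{..<N} - {j}. a i * c j (e i) = 0"
      proof
        fix i assume "i \<in> {..<N} - {j}"
        then have "i < N" "i < j \<or> j < i" by auto
        then show "a i * c j (e i) = 0" using less.IH[of i] e(2)[of i j] by auto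
      qed
    qed (use less.prems in auto)
    finally show ?case using e(3)[OF less.prems] by simp
  qed
  have inj: "inj_on e {..<N}"
  proof (rule inj_onI, rule ccontr)
    fix i j assume ij: "i \<in> {..<N}" "j \<in> {..<N}" "e i = e j" "i \<noteq> j"
    then have "i < j \<or> j < i" by auto
    then show False using ij e(2)[of j i] e(2)[of i j] e(3)[of i] e(3)[of j] by auto
  qed
  define E where "E = e ` {..<N}"
  have E: "finite E" "card E = N" by (simp_all add: E_def card_image[OF inj])
  have sumE: "(\<Sum>x\<in>E. scale (u x) x) = (\<Sum>j<N. scale (u (e j)) (e j))" for u
    unfolding E_def by (simp add: sum.reindex[OF inj])
  have ind: "independent E"
  proof (rule independent_if_scalars_zero[OF E(1)])
    fix u x assume sum: "(\<Sum>x\<in>E. scale (u x) x) = 0" and x: "x \<in> E"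
    obtain j where j: "x = e j" "j < N" using x by (auto simp: E_def)
    show "u x = 0"
      unfolding j(1) by (rule zero[of "\<lambda>j. u (e j)", OF _ j(2)]) (use sum in \<open>simp add: sumE c0\<close>)
  qed
  have ES: "E \<subseteq> S" using e(1) by (auto simp: E_def)
  have SE: "S \<subseteq> span E"
  proof
    fix x assume x: "x \<in> S"
    show "x \<in> span E"
    proof (rule ccontr)
      assume nx: "x \<notin> span E"
      then have "independent (insert x E)" using ind by (rule independent_insertI)
      moreover have "insert x E \<subseteq> span B" using x ES B(3) by auto
      ultimately have "card (insert x E) \<le> card B" using independent_span_bound[OF B(1)] by blast
      moreover have "x \<notin> E" using nx span_base by blast
      ultimately show False using E B(2) by simp
    qed
  qed
  show "dim S = N" using basis_card_eq_dim[OF ES SE ind] E by simp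
  fix x assume x: "x \<in> S" "\<And>n. n < N \<Longrightarrow> c n x = 0"
  then obtain u where "x = (\<Sum>v\<in>E. scale (u v) v)" using SE by (auto simp: span_finite[OF E(1)])
  then have eq: "x = (\<Sum>j<N. scale (u (e j)) (e j))" by (simp add: sumE)
  then have "u (e j) = 0" if "j < N" for j using zero[of "\<lambda>j. u (e j)"] x(2) that by simp
  then show "x = 0" using eq by simp
qed

end

subsection \<open>Quasimodular forms of depth 2\<close>

definition quasi_fps :: "int \<Rightarrow> complex fps \<Rightarrow> bool" where
  "quasi_fps w F \<longleftrightarrow> (\<exists>f\<in>quasimodular_forms w 2. has_q_expansion f F)"

lemma quasi_fpsI:
  assumes "modular_fps w G0" "modular_fps (w - 2) G1" "modular_fps (w - 4) G2"
  shows "quasi_fps w (G0 + E2_fps * G1 + E2_fps ^ 2 * G2)"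
proof -
  obtain g0 g1 g2 where g: "g0 \<in> modular_forms w" "g1 \<in> modular_forms (w - 2)" "g2 \<in> modular_forms (w - 4)"
    and q: "has_q_expansion g0 G0" "has_q_expansion g1 G1" "has_q_expansion g2 G2"
    using assms by (auto simp: modular_fps_def)
  have "(\<lambda>z. \<Sum>l\<le>2::nat. E2 z ^ l * (if l = 0 then g0 else if l = 1 then g1 else g2) z) \<in> quasimodular_forms w 2"
    unfolding quasimodular_forms_def using g
    by (auto intro!: exI[of _ "\<lambda>l. if l = 0 then g0 else if l = 1 then g1 else g2"] simp: le_Suc_eq numeral_2_eq_2)
  moreover have "has_q_expansion (\<lambda>z. g0 z + E2 z * g1 z + E2 z ^ 2 * g2 z) (G0 + E2_fps * G1 + E2_fps ^ 2 * G2)"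
    by (intro has_q_expansion_add has_q_expansion_mult has_q_expansion_power has_q_expansion_E2 q)
  ultimately show ?thesis unfolding quasi_fps_def by (auto simp: numeral_2_eq_2)
qed

lemma quasimodular_formsE:
  assumes "f \<in> quasimodular_forms w 2"
  obtains g0 g1 g2 where "g0 \<in> modular_forms w" "g1 \<in> modular_forms (w - 2)" "g2 \<in> modular_forms (w - 4)"
    "f = (\<lambda>z. g0 z + E2 z * g1 z + E2 z ^ 2 * g2 z)"
proof -
  from assms obtain g where g: "\<And>l. l \<le> 2 \<Longrightarrow> g l \<in> modular_forms (w - 2 * int l)"
    "f = (\<lambda>z. \<Sum>l\<le>2. E2 z ^ l * g l z)" by (auto simp: quasimodular_forms_def)
  show ?thesis
    by (rule that[of "g 0" "g 1" "g 2"]) (use g(1)[of 0] g(1)[of 1] g(1)[of 2] g(2) in \<open>auto simp: numeral_2_eq_2\<close>)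
qed

lemma quasi_fpsE:
  assumes "quasi_fps w F"
  obtains G0 G1 G2 where "modular_fps w G0" "modular_fps (w - 2) G1" "modular_fps (w - 4) G2"
    "F = G0 + E2_fps * G1 + E2_fps ^ 2 * G2"
proof -
  obtain f where f: "f \<in> quasimodular_forms w 2" "has_q_expansion f F" using assms by (auto simp: quasi_fps_def)
  obtain g0 g1 g2 where g: "g0 \<in> modular_forms w" "g1 \<in> modular_forms (w - 2)" "g2 \<in> modular_forms (w - 4)"
    "f = (\<lambda>z. g0 z + E2 z * g1 z + E2 z ^ 2 * g2 z)" using f(1) by (rule quasimodular_formsE)
  obtain G0 G1 G2 where q: "has_q_expansion g0 G0" "has_q_expansion g1 G1" "has_q_expansion g2 G2"
    using g modular_forms_q_expansion by meson
  have "has_q_expansion (\<lambda>z. g0 z + E2 z * g1 z + E2 z ^ 2 * g2 z) (G0 + E2_fps * G1 + E2_fps ^ 2 * G2)"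
    by (intro has_q_expansion_add has_q_expansion_mult has_q_expansion_power has_q_expansion_E2 q)
  then have "F = G0 + E2_fps * G1 + E2_fps ^ 2 * G2"
    using f(2) g(4) has_q_expansion_unique by blast
  then show ?thesis using that g q by (auto simp: modular_fps_def)
qed

lemma quasi_fps_add:
  assumes w: "even w" and "quasi_fps w F" "quasi_fps w F'"
  shows "quasi_fps w (F + F')"
proof -
  obtain G0 G1 G2 where G: "modular_fps w G0" "modular_fps (w - 2) G1" "modular_fps (w - 4) G2"
    "F = G0 + E2_fps * G1 + E2_fps ^ 2 * G2" using assms(2) by (rule quasi_fpsE)
  obtain H0 H1 H2 where H: "modular_fps w H0" "modular_fps (w - 2) H1" "modular_fps (w - 4) H2"
    "F' = H0 + E2_fps * H1 + E2_fps ^ 2 * H2" using assms(3) by (rule quasi_fpsE)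
  have "quasi_fps w ((G0 + H0) + E2_fps * (G1 + H1) + E2_fps ^ 2 * (G2 + H2))"
    by (intro quasi_fpsI modular_fps_add G H) (use w in simp_all)
  then show ?thesis by (simp add: G(4) H(4) algebra_simps)
qed

lemma quasi_fps_mult_modular:
  assumes w: "even w" "even k" and "quasi_fps w F" and M: "modular_fps k M"
  shows "quasi_fps (w + k) (F * M)"
proof -
  obtain G0 G1 G2 where G: "modular_fps w G0" "modular_fps (w - 2) G1" "modular_fps (w - 4) G2"
    "F = G0 + E2_fps * G1 + E2_fps ^ 2 * G2" using assms(3) by (rule quasi_fpsE)
  have "modular_fps (w + k) (G0 * M)" "modular_fps (w - 2 + k) (G1 * M)" "modular_fps (w - 4 + k) (G2 * M)"
    by (intro modular_fps_mult G M; use w in simp)+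
  then have "quasi_fps (w + k) (G0 * M + E2_fps * (G1 * M) + E2_fps ^ 2 * (G2 * M))"
    by (intro quasi_fpsI) (simp_all add: algebra_simps)
  then show ?thesis by (simp add: G(4) algebra_simps)
qed

lemma quasi_fps_cmult: "even w \<Longrightarrow> quasi_fps w F \<Longrightarrow> quasi_fps w (fps_const c * F)"
  using quasi_fps_mult_modular[OF _ _ _ modular_fps_const, of w F c] by (simp add: mult.commute)

lemma quasi_fps_diff:
  assumes "even w" "quasi_fps w F" "quasi_fps w G"
  shows "quasi_fps w (F - G)"
proof -
  have "F + fps_const (-1) * G = F - G" by (simp flip: fps_const_neg)
  then show ?thesis
    using quasi_fps_add[OF assms(1,2) quasi_fps_cmult[OF assms(1,3), of "-1"]] by simp
qed

text \<open>Rational constants are rewritten as integer polynomials in this element, so that the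
  identities below become polynomial identities in a commutative ring.\<close>

abbreviation twelfth :: "complex fps" where "twelfth \<equiv> fps_const (1 / 12)"

lemma twelfth: "12 * twelfth = 1"
  by (simp add: numeral_fps_const)

lemma serre_fps_twelfth: "serre_fps k F = fps_X * fps_deriv F - of_int k * twelfth * E2_fps * F"
proof -
  have "fps_const (of_int k / 12) = of_int k * twelfth"
    by (simp flip: fps_of_int)
  then show ?thesis by (simp add: serre_fps_def mult.assoc)
qed

lemma E2_fps_deriv: "fps_X * fps_deriv E2_fps = twelfth * (E2_fps ^ 2 - E4_fps)"
proof -
  have "E2_fps ^ 2 - E4_fps = 12 * (fps_X * fps_deriv E2_fps)"
    by (subst E4_fps_eq) (simp add: fps_numeral_fps_const)
  then have "twelfth * (E2_fps ^ 2 - E4_fps) = (12 * twelfth) * (fps_X * fps_deriv E2_fps)"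
    by (simp only: mult_ac)
  then show ?thesis by (simp only: twelfth mult_1)
qed

text \<open>This explains the index \<open>w - 2\<close>: the coefficient of
  \<open>E2^3 * G2\<close> is \<open>2/12 + (w - 4)/12 - (w - 2)/12 = 0\<close>, so the depth stays
  at most 2.\<close>

lemma serre_quasi_components:
  "serre_fps (w - 2) (G0 + E2_fps * G1 + E2_fps ^ 2 * G2) =
    (serre_fps w G0 - twelfth * (E4_fps * G1)) +
    E2_fps * (serre_fps (w - 2) G1 + fps_const (1/6) * G0 - fps_const (1/6) * (E4_fps * G2)) +
    E2_fps ^ 2 * (serre_fps (w - 4) G2 + twelfth * G1)"
proof -
  have s: "fps_const (1/6) = 2 * twelfth" by (simp add: numeral_fps_const)
  have d: "fps_X * fps_deriv (G0 + E2_fps * G1 + E2_fps ^ 2 * G2) =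
     fps_X * fps_deriv G0 + (fps_X * fps_deriv E2_fps) * G1 + E2_fps * (fps_X * fps_deriv G1) +
     2 * E2_fps * (fps_X * fps_deriv E2_fps) * G2 + E2_fps ^ 2 * (fps_X * fps_deriv G2)"
    by (simp add: power2_eq_square algebra_simps)
  show ?thesis unfolding serre_fps_twelfth s d E2_fps_deriv
    by (simp add: algebra_simps power2_eq_square)
qed

lemma quasi_fps_serre:
  assumes w: "even w" and "quasi_fps w F"
  shows "quasi_fps (w + 2) (serre_fps (w - 2) F)"
proof -
  obtain G0 G1 G2 where G: "modular_fps w G0" "modular_fps (w - 2) G1" "modular_fps (w - 4) G2"
    "F = G0 + E2_fps * G1 + E2_fps ^ 2 * G2" using assms(2) by (rule quasi_fpsE)
  have e: "even (w - 2)" "even (w - 4)" "even (w + 2)" "even (4::int)" using w by simp_all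
  have a: "modular_fps (w + 2) (E4_fps * G1)" "modular_fps w (E4_fps * G2)"
    "modular_fps (w + 2) (serre_fps w G0)" "modular_fps w (serre_fps (w - 2) G1)"
    "modular_fps (w - 2) (serre_fps (w - 4) G2)"
    using modular_fps_mult[OF e(4,1) modular_fps_E4 G(2)] modular_fps_mult[OF e(4,2) modular_fps_E4 G(3)]
      modular_fps_serre[OF w G(1)] modular_fps_serre[OF e(1) G(2)] modular_fps_serre[OF e(2) G(3)]
    by (simp_all add: algebra_simps)
  show ?thesis unfolding G(4) serre_quasi_components
  proof (rule quasi_fpsI)
    show "modular_fps (w + 2) (serre_fps w G0 - twelfth * (E4_fps * G1))"
      by (intro modular_fps_diff modular_fps_cmult a e)
    have "modular_fps w (serre_fps (w - 2) G1 + fps_const (1/6) * G0 - fps_const (1/6) * (E4_fps * G2))"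
      by (intro modular_fps_diff modular_fps_add modular_fps_cmult a w G)
    then show "modular_fps (w + 2 - 2) (serre_fps (w - 2) G1 + fps_const (1/6) * G0 - fps_const (1/6) * (E4_fps * G2))"
      by simp
    have "modular_fps (w - 2) (serre_fps (w - 4) G2 + twelfth * G1)"
      by (intro modular_fps_add modular_fps_cmult a e G)
    then show "modular_fps (w + 2 - 4) (serre_fps (w - 4) G2 + twelfth * G1)"
      by simp
  qed
qed

text \<open>
  The coefficients are such that the exponents at the cusp are \<open>0, 0, w/4\<close>: the indicial equation is
  \<open>n\<^sup>2 (n - w/4) = 0\<close>.
\<close>

definition extremal_ode :: "int \<Rightarrow> complex fps \<Rightarrow> bool" where
  "extremal_ode w F \<longleftrightarrow>
     serre_fps (w + 2) (serre_fps w (serre_fps (w - 2) F)) =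
       - (fps_const (1/36 - of_int w ^ 2 / 48) * E4_fps * serre_fps (w - 2) F)
       - fps_const (of_int w ^ 2 / 288 - of_int w ^ 3 / 864 - 1/216) * E6_fps * F"

lemma extremal_ode_twelfth:
  "extremal_ode w F \<longleftrightarrow>
     serre_fps (w + 2) (serre_fps w (serre_fps (w - 2) F)) =
       - (twelfth ^ 2 * (4 - 3 * of_int w ^ 2) * E4_fps * serre_fps (w - 2) F)
       - twelfth ^ 3 * (6 * of_int w ^ 2 - 2 * of_int w ^ 3 - 8) * E6_fps * F"
proof -
  have "fps_const (1/36 - of_int w ^ 2 / 48) = twelfth ^ 2 * (4 - 3 * of_int w ^ 2)"
    by (simp add: numeral_fps_const field_simps power2_eq_square flip: fps_of_int)
  moreover have "fps_const (of_int w ^ 2 / 288 - of_int w ^ 3 / 864 - 1/216) =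
      twelfth ^ 3 * (6 * of_int w ^ 2 - 2 * of_int w ^ 3 - 8)"
    by (simp add: numeral_fps_const field_simps power2_eq_square power3_eq_cube flip: fps_of_int)
  ultimately show ?thesis by (simp only: extremal_ode_def)
qed

text \<open>For a form of order \<open>w / 4\<close> the second Serre derivative multiplies the
  leading coefficient by \<open>(w/4 - (w-2)/12) * (w/4 - w/12) = (w + 1) w / 36\<close>. The
  difference therefore loses its leading term.\<close>

definition extremal_step :: "int \<Rightarrow> complex fps \<Rightarrow> complex fps" where
  "extremal_step w F = fps_const ((of_int w + 1) * of_int w / 36) * (E4_fps * F) -
     serre_fps w (serre_fps (w - 2) F)"

lemma serre_E4_twelfth: "serre_fps 4 E4_fps = - (4 * twelfth * E6_fps)"
  and serre_E6_twelfth: "serre_fps 6 E6_fps = - (6 * twelfth * E4_fps ^ 2)"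
  unfolding serre_E4 serre_E6 by (simp_all add: numeral_fps_const flip: fps_const_neg)

text \<open>Over the polynomials in \<open>E4\<close> and \<open>E6\<close>, the span of
  \<open>F\<close> and its first two Serre derivatives is closed under differentiation: the equation
  removes the third derivative, and Ramanujan's identities remove those of \<open>E4\<close> and
  \<open>E6\<close>. The equation for the new form becomes a comparison of coefficients.\<close>

lemma extremal_ode_step:
  assumes "extremal_ode w F"
  shows "extremal_ode (w + 4) (extremal_step w F)"
proof -
  define W :: "complex fps" where "W = of_int w"
  define h where "h = twelfth"
  define G0 where "G0 = F"
  define G1 where "G1 = serre_fps (w - 2) G0"
  define G2 where "G2 = serre_fps w G1"
  \<comment> \<open>\<open>s\<close> and \<open>t\<close> are the coefficients of
    \<open>E4 G1\<close> and \<open>E6 G0\<close> in the derivative of \<open>H\<close>, after the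
    equation for \<open>F\<close> has eliminated the third derivative.\<close>
  define s where "s = h ^ 2 * (W + 2) ^ 2"
  define t where "t = - 2 * h ^ 3 * (W + 1) * (W + 2) ^ 2"
  define H where "H = 4 * h ^ 2 * (W + 1) * W * (E4_fps * G0) - G2"
  have scal: "s = fps_const ((of_int w + 2) ^ 2 / 144)"
    "t = fps_const (- ((of_int w + 1) * (of_int w + 2) ^ 2 / 864))"
    "4 * h ^ 2 * (W + 1) * W = fps_const ((of_int w + 1) * of_int w / 36)"
    by (simp_all add: s_def t_def h_def W_def numeral_fps_const field_simps power2_eq_square power3_eq_cube
        flip: fps_of_int)
  have H: "extremal_step w F = H"
    unfolding H_def scal(3) by (simp add: extremal_step_def G0_def G1_def G2_def)
  have G3: "serre_fps (w + 2) G2 = - (h ^ 2 * (4 - 3 * W ^ 2) * E4_fps * G1)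
       - h ^ 3 * (6 * W ^ 2 - 2 * W ^ 3 - 8) * E6_fps * G0"
    using assms unfolding extremal_ode_twelfth by (simp add: G0_def G1_def G2_def W_def h_def)
  have QG0: "serre_fps (w + 2) (E4_fps * G0) = - (4 * h * E6_fps) * G0 + E4_fps * G1"
    using serre_fps_mult[of 4 "w - 2" E4_fps G0] by (simp add: serre_E4_twelfth G1_def h_def add_ac)
  have QG1: "serre_fps (w + 4) (E4_fps * G1) = - (4 * h * E6_fps) * G1 + E4_fps * G2"
    using serre_fps_mult[of 4 w E4_fps G1] by (simp add: serre_E4_twelfth G2_def h_def add_ac)
  have RG0: "serre_fps (w + 4) (E6_fps * G0) = - (6 * h * E4_fps ^ 2) * G0 + E6_fps * G1"
    using serre_fps_mult[of 6 "w - 2" E6_fps G0] by (simp add: serre_E6_twelfth G1_def h_def add_ac)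
  have QG2: "serre_fps (w + 6) (E4_fps * G2) = - (4 * h * E6_fps) * G2 + E4_fps * serre_fps (w + 2) G2"
    using serre_fps_mult[of 4 "w + 2" E4_fps G2] by (simp add: serre_E4_twelfth h_def add_ac)
  have RG1: "serre_fps (w + 6) (E6_fps * G1) = - (6 * h * E4_fps ^ 2) * G1 + E6_fps * G2"
    using serre_fps_mult[of 6 w E6_fps G1] by (simp add: serre_E6_twelfth G2_def h_def add_ac)
  have QQG0: "serre_fps (w + 6) (E4_fps * (E4_fps * G0)) =
      - (4 * h * E6_fps) * (E4_fps * G0) + E4_fps * (- (4 * h * E6_fps) * G0 + E4_fps * G1)"
    using serre_fps_mult[of 4 "w + 2" E4_fps "E4_fps * G0"] by (simp add: serre_E4_twelfth QG0 h_def add_ac)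
  have H1: "serre_fps (w + 2) H = s * (E4_fps * G1) + t * (E6_fps * G0)"
  proof -
    have "serre_fps (w + 2) H = 4 * h ^ 2 * (W + 1) * W * (- (4 * h * E6_fps) * G0 + E4_fps * G1) - serre_fps (w + 2) G2"
      unfolding H_def serre_fps_diff QG0[symmetric] scal(3) serre_fps_cmult ..
    also have "\<dots> = s * (E4_fps * G1) + t * (E6_fps * G0)"
      unfolding G3 s_def t_def by (simp add: algebra_simps power2_eq_square power3_eq_cube)
    finally show ?thesis .
  qed
  have H2: "serre_fps (w + 4) (serre_fps (w + 2) H) =
      s * (- (4 * h) * (E6_fps * G1) + E4_fps * G2) + t * (- (6 * h) * (E4_fps * (E4_fps * G0)) + E6_fps * G1)"
    unfolding H1 scal(1,2) serre_fps_add serre_fps_cmult QG1 RG0 by (simp add: power2_eq_square mult_ac)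
  have h4: "- (4 * h) = fps_const (- 1/3)" and h6: "- (6 * h) = fps_const (- 1/2)"
    by (simp_all add: h_def numeral_fps_const)
  have "serre_fps (w + 6) (serre_fps (w + 4) (serre_fps (w + 2) H)) =
      s * (- (4 * h) * (- (6 * h * E4_fps ^ 2) * G1 + E6_fps * G2) +
           (- (4 * h * E6_fps) * G2 + E4_fps * serre_fps (w + 2) G2)) +
      t * (- (6 * h) * (- (4 * h * E6_fps) * (E4_fps * G0) + E4_fps * (- (4 * h * E6_fps) * G0 + E4_fps * G1)) +
           (- (6 * h * E4_fps ^ 2) * G1 + E6_fps * G2))"
    unfolding H2 scal(1,2) h4 h6 serre_fps_add serre_fps_cmult RG1 QG2 QQG0 ..
  also have "\<dots> = - (h ^ 2 * (4 - 3 * (W + 4) ^ 2) * E4_fps * (s * (E4_fps * G1) + t * (E6_fps * G0)))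
       - h ^ 3 * (6 * (W + 4) ^ 2 - 2 * (W + 4) ^ 3 - 8) * E6_fps * H"
    unfolding G3 s_def t_def H_def by algebra
  finally show ?thesis unfolding H extremal_ode_twelfth
    by (simp add: H1 W_def h_def add_ac)
qed

text \<open>In weight 0 the first Serre derivative has index -2, so the constant 1 is sent to
  \<open>E2 / 6\<close> and not to 0.\<close>

lemma extremal_ode_1: "extremal_ode 0 1"
proof -
  have 1: "serre_fps (-2) 1 = 2 * twelfth * E2_fps" by (simp add: serre_fps_twelfth)
  have 2: "serre_fps 0 (serre_fps (-2) 1) = 2 * twelfth ^ 2 * (E2_fps ^ 2 - E4_fps)"
  proof -
    have "serre_fps 0 (serre_fps (-2) 1) = 2 * twelfth * (fps_X * fps_deriv E2_fps)"
      unfolding 1 by (simp add: serre_fps_twelfth numeral_fps_const mult_ac)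
    then show ?thesis unfolding E2_fps_deriv by (simp only: power2_eq_square mult_ac)
  qed
  have dQ: "fps_X * fps_deriv E4_fps = 4 * twelfth * (E2_fps * E4_fps - E6_fps)"
    using serre_E4_twelfth unfolding serre_fps_twelfth by (simp add: algebra_simps)
  have "serre_fps 2 (serre_fps 0 (serre_fps (-2) 1)) =
     2 * twelfth ^ 2 * (2 * E2_fps * (fps_X * fps_deriv E2_fps) - fps_X * fps_deriv E4_fps
       - 2 * twelfth * E2_fps * (E2_fps ^ 2 - E4_fps))"
    unfolding 2 unfolding serre_fps_twelfth
    by (simp add: numeral_fps_const power2_eq_square algebra_simps)
  also have "\<dots> = - (twelfth ^ 2 * 4 * E4_fps * (2 * twelfth * E2_fps)) - twelfth ^ 3 * (- 8) * E6_fps"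
    unfolding E2_fps_deriv dQ by (simp add: algebra_simps power2_eq_square power3_eq_cube)
  finally show ?thesis unfolding extremal_ode_twelfth by (simp add: 1)
qed

section \<open>The first two coefficients and the normalisation of the recursion\<close>

lemma fps_mult_low_coeffs:
  fixes E F :: "complex fps"
  assumes "\<And>n. n < m \<Longrightarrow> fps_nth F n = 0"
  shows "n < m \<Longrightarrow> fps_nth (E * F) n = 0"
    and "fps_nth (E * F) m = fps_nth E 0 * fps_nth F m"
    and "fps_nth (E * F) (Suc m) = fps_nth E 0 * fps_nth F (Suc m) + fps_nth E (Suc 0) * fps_nth F m"
proof -
  define F' where "F' = fps_shift m F"
  have F: "F = fps_X ^ m * F'"
    by (rule fps_ext) (use assms in \<open>auto simp: F'_def fps_X_power_mult_nth\<close>)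
  have EF: "E * F = fps_X ^ m * (E * F')" by (simp add: F mult_ac)
  show "n < m \<Longrightarrow> fps_nth (E * F) n = 0"
    and "fps_nth (E * F) m = fps_nth E 0 * fps_nth F m"
    and "fps_nth (E * F) (Suc m) = fps_nth E 0 * fps_nth F (Suc m) + fps_nth E (Suc 0) * fps_nth F m"
    unfolding EF by (simp_all add: F fps_X_power_mult_nth fps_mult_nth_1' Suc_diff_le)
qed

lemma serre_fps_low_coeffs:
  assumes "\<And>n. n < m \<Longrightarrow> fps_nth F n = 0"
  shows "n < m \<Longrightarrow> fps_nth (serre_fps k F) n = 0"
    and "fps_nth (serre_fps k F) m = (of_nat m - of_int k / 12) * fps_nth F m"
    and "fps_nth (serre_fps k F) (Suc m) =
      (of_nat m + 1 - of_int k / 12) * fps_nth F (Suc m) + 2 * of_int k * fps_nth F m"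
proof -
  have D: "fps_nth (fps_X * fps_deriv F) n = of_nat n * fps_nth F n" for n
    by (cases n) simp_all
  note low = fps_mult_low_coeffs[where E = E2_fps, OF assms]
  show "n < m \<Longrightarrow> fps_nth (serre_fps k F) n = 0"
    using low(1) assms by (simp add: serre_fps_def D del: fps_X_mult_nth)
  show "fps_nth (serre_fps k F) m = (of_nat m - of_int k / 12) * fps_nth F m"
    by (simp add: serre_fps_def D low(2) E2_fps_nth del: fps_X_mult_nth) (simp add: algebra_simps)
  show "fps_nth (serre_fps k F) (Suc m) =
      (of_nat m + 1 - of_int k / 12) * fps_nth F (Suc m) + 2 * of_int k * fps_nth F m"
    by (simp add: serre_fps_def D low(3) E2_fps_nth del: fps_X_mult_nth) (simp add: field_simps)
qed

text \<open>In the equation at \<open>q^(m+1)\<close> the unknown coefficient \<open>x\<close>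
  carries the indicial polynomial at \<open>m + 1\<close>, which is
  \<open>(m + 1)^2 = (w + 4)^2 / 16\<close>. So \<open>x\<close> is determined, and this is the
  origin of \<open>(w + 4)^2\<close> in the recursion.\<close>

lemma extremal_step_coeffs:
  assumes ode: "extremal_ode (4 * int m) F"
    and low: "\<And>n. n < m \<Longrightarrow> fps_nth F n = 0" and lead: "fps_nth F m = 1"
  defines "w \<equiv> of_nat (4 * m) :: complex"
  shows "n \<le> m \<Longrightarrow> fps_nth (extremal_step (4 * int m) F) n = 0"
    and "fps_nth (extremal_step (4 * int m) F) (Suc m) =
      16 * (w + 1) * (w + 2) ^ 2 * (w + 3) / (3 * (w + 4) ^ 2)"
proof -
  define \<mu> :: complex where "\<mu> = of_nat m"
  define x where "x = fps_nth F (Suc m)"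
  define F1 where "F1 = serre_fps (4 * int m - 2) F"
  define F2 where "F2 = serre_fps (4 * int m) F1"
  define F3 where "F3 = serre_fps (4 * int m + 2) F2"
  have w: "w = 4 * \<mu>" by (simp add: w_def \<mu>_def)
  have low1: "fps_nth F1 n = 0" if "n < m" for n
    unfolding F1_def by (rule serre_fps_low_coeffs(1)[OF low that])
  have low2: "fps_nth F2 n = 0" if "n < m" for n
    unfolding F2_def by (rule serre_fps_low_coeffs(1)[OF low1 that])
  have c1: "fps_nth F1 m = (w + 1) / 6" "fps_nth F1 (Suc m) = (\<mu> + 1 - (w - 2) / 12) * x + 2 * (w - 2)"
    unfolding F1_def
    by (simp_all add: serre_fps_low_coeffs(2,3) low lead w_def x_def \<mu>_def field_simps)
  have c2: "fps_nth F2 m = w * (w + 1) / 36"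
    "fps_nth F2 (Suc m) = (\<mu> + 1 - w / 12) * fps_nth F1 (Suc m) + w * (w + 1) / 3"
    unfolding F2_def
    by (simp_all add: serre_fps_low_coeffs(2,3) low1 c1(1)) (simp_all add: w_def \<mu>_def field_simps)
  have c3: "fps_nth F3 (Suc m) = (\<mu> + 1 - (w + 2) / 12) * fps_nth F2 (Suc m) + 2 * (w + 2) * (w * (w + 1) / 36)"
    unfolding F3_def
    by (simp add: serre_fps_low_coeffs(3) low2 c2(1)) (simp add: w_def \<mu>_def)
  have "fps_nth F3 (Suc m) =
     - ((1/36 - w ^ 2 / 48) * (fps_nth F1 (Suc m) + 240 * ((w + 1) / 6)))
     - (w ^ 2 / 288 - w ^ 3 / 864 - 1/216) * (x - 504)"
  proof -
    have "F3 = - (fps_const (1/36 - w ^ 2 / 48) * (E4_fps * F1))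
       - fps_const (w ^ 2 / 288 - w ^ 3 / 864 - 1/216) * (E6_fps * F)"
      using ode unfolding extremal_ode_def F1_def F2_def F3_def by (simp add: w_def mult.assoc)
    then show ?thesis
      by (simp add: fps_mult_low_coeffs(3) low low1 E4_fps_nth E6_fps_nth c1(1) lead x_def)
  qed
  then have ode': "(\<mu> + 1 - (w + 2) / 12) * fps_nth F2 (Suc m) + 2 * (w + 2) * (w * (w + 1) / 36) =
     - ((1/36 - w ^ 2 / 48) * (fps_nth F1 (Suc m) + 240 * ((w + 1) / 6)))
     - (w ^ 2 / 288 - w ^ 3 / 864 - 1/216) * (x - 504)" unfolding c3 .
  have step: "extremal_step (4 * int m) F = fps_const ((w + 1) * w / 36) * (E4_fps * F) - F2"
    by (simp add: extremal_step_def F1_def F2_def w_def)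
  show "fps_nth (extremal_step (4 * int m) F) n = 0" if "n \<le> m"
  proof (cases "n = m")
    case True
    then show ?thesis
      unfolding step by (simp add: fps_mult_low_coeffs(2) low E4_fps_nth lead c2(1))
  next
    case False
    then show ?thesis
      unfolding step using that by (simp add: fps_mult_low_coeffs(1)[of m] low low2)
  qed
  have "fps_nth (extremal_step (4 * int m) F) (Suc m) = (w + 1) * w / 36 * (x + 240) - fps_nth F2 (Suc m)"
    unfolding step by (simp add: fps_mult_low_coeffs(3) low E4_fps_nth lead x_def)
  \<comment> \<open>Multiplication by \<open>(w + 4) ^ 2\<close> lets \<open>x\<close> be eliminated
    linearly by means of the equation \<open>ode'\<close>, without dividing.\<close>
  moreover have "3 * (w + 4) ^ 2 * ((w + 1) * w / 36 * (x + 240) - fps_nth F2 (Suc m)) =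
     16 * (w + 1) * (w + 2) ^ 2 * (w + 3)"
    using ode' unfolding c2(2) c1(2) w by algebra
  moreover have "w + 4 \<noteq> 0"
  proof -
    have "w + 4 = of_nat (4 * m + 4)" by (simp add: w_def)
    then show ?thesis by (simp only: of_nat_eq_0_iff)
  qed
  ultimately show "fps_nth (extremal_step (4 * int m) F) (Suc m) =
      16 * (w + 1) * (w + 2) ^ 2 * (w + 3) / (3 * (w + 4) ^ 2)"
    by (simp add: eq_divide_eq mult_ac)
qed

subsection \<open>Extremal forms\<close>

lemma extremal_ode_cmult:
  assumes "extremal_ode w F"
  shows "extremal_ode w (fps_const c * F)"
  unfolding extremal_ode_def serre_fps_cmult assms[unfolded extremal_ode_def]
  by (simp only: right_diff_distrib mult_minus_right mult_ac)

lemma quasi_fps_extremal_step: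
  assumes "even w" "quasi_fps w F"
  shows "quasi_fps (w + 4) (extremal_step w F)"
proof -
  have "quasi_fps (w + 4) (E4_fps * F)"
    using quasi_fps_mult_modular[OF assms(1) _ assms(2) modular_fps_E4] by (simp add: mult.commute)
  moreover have "quasi_fps (w + 4) (serre_fps w (serre_fps (w - 2) F))"
    using quasi_fps_serre[OF _ quasi_fps_serre[OF assms]] assms(1) by (simp add: add.assoc)
  ultimately show ?thesis unfolding extremal_step_def
    using assms(1) by (intro quasi_fps_diff quasi_fps_cmult) simp_all
qed

primrec extremal_fps :: "nat \<Rightarrow> complex fps" where
  "extremal_fps 0 = 1"
| "extremal_fps (Suc m) =
    fps_const (3 * (of_nat (4 * m) + 4) ^ 2 /
      (16 * (of_nat (4 * m) + 1) * (of_nat (4 * m) + 2) ^ 2 * (of_nat (4 * m) + 3))) *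
    extremal_step (4 * int m) (extremal_fps m)"

lemma extremal_fps_properties:
  "quasi_fps (4 * int m) (extremal_fps m) \<and> extremal_ode (4 * int m) (extremal_fps m) \<and>
   (\<forall>n<m. fps_nth (extremal_fps m) n = 0) \<and> fps_nth (extremal_fps m) m = 1"
proof (induction m)
  case 0
  have z: "modular_fps k 0" if "even k" for k
    using has_q_expansion_0 by (intro modular_fpsI[OF that]) auto
  have "quasi_fps 0 (1 + E2_fps * 0 + E2_fps ^ 2 * 0)"
    by (rule quasi_fpsI) (use modular_fps_const[of 1] z in simp_all)
  then show ?case using extremal_ode_1 by simp
next
  case (Suc m)
  define w :: complex where "w = of_nat (4 * m)"
  define c where "c = 3 * (w + 4) ^ 2 / (16 * (w + 1) * (w + 2) ^ 2 * (w + 3))"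
  have F: "extremal_fps (Suc m) = fps_const c * extremal_step (4 * int m) (extremal_fps m)"
    by (simp add: c_def w_def)
  have "fps_nth (extremal_step (4 * int m) (extremal_fps m)) n = 0" if "n \<le> m" for n
    using extremal_step_coeffs(1)[of m "extremal_fps m" n] Suc that by auto
  then have "\<forall>n<Suc m. fps_nth (extremal_fps (Suc m)) n = 0" unfolding F by simp
  moreover have "fps_nth (extremal_fps (Suc m)) (Suc m) = 1"
  proof -
    have "w + of_nat k \<noteq> 0" if "k > 0" for k
    proof -
      have "w + of_nat k = of_nat (4 * m + k)" by (simp add: w_def)
      then show ?thesis using that by (simp only: of_nat_eq_0_iff)
    qed
    from this[of 1] this[of 2] this[of 3] this[of 4]
    have "w + 1 \<noteq> 0" "w + 2 \<noteq> 0" "w + 3 \<noteq> 0" "w + 4 \<noteq> 0" by simp_all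
    moreover from this(1) have "16 * w + 16 \<noteq> 0"
      by (metis distrib_left mult_eq_0_iff mult.right_neutral zero_neq_numeral)
    moreover have "fps_nth (extremal_step (4 * int m) (extremal_fps m)) (Suc m) =
        16 * (w + 1) * (w + 2) ^ 2 * (w + 3) / (3 * (w + 4) ^ 2)"
      using extremal_step_coeffs(2)[of m "extremal_fps m"] Suc by (auto simp: w_def)
    ultimately show ?thesis unfolding F by (simp add: c_def)
  qed
  moreover have "extremal_ode (4 * int (Suc m)) (extremal_fps (Suc m))"
    unfolding F using extremal_ode_cmult[OF extremal_ode_step[of "4 * int m"]] Suc by (simp add: add.commute)
  moreover have "quasi_fps (4 * int (Suc m)) (extremal_fps (Suc m))"
    unfolding F using quasi_fps_cmult[OF _ quasi_fps_extremal_step[of "4 * int m"]] Suc by (simp add: add.commute)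
  ultimately show ?case by blast
qed

text \<open>The Serre derivative multiplies the leading coefficient by
  \<open>m - (4m - 2)/12 = (w + 1)/6\<close> with \<open>w = 4m\<close>. This is nonzero, so the
  order is kept, and its inverse is the normalising factor.\<close>

definition extremal_deriv_fps :: "nat \<Rightarrow> complex fps" where
  "extremal_deriv_fps m = fps_const (6 / (of_nat (4 * m) + 1)) * serre_fps (4 * int m - 2) (extremal_fps m)"

lemma extremal_deriv_fps_properties:
  "quasi_fps (4 * int m + 2) (extremal_deriv_fps m) \<and>
   (\<forall>n<m. fps_nth (extremal_deriv_fps m) n = 0) \<and> fps_nth (extremal_deriv_fps m) m = 1"
proof -
  note P = extremal_fps_properties[of m]
  have "(1::complex) + of_nat (4 * m) \<noteq> 0"
    by (metis of_nat_Suc of_nat_neq_0)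
  then have nz: "(1::complex) + of_nat m * 4 \<noteq> 0" by (simp add: mult.commute)
  have "fps_nth (serre_fps (4 * int m - 2) (extremal_fps m)) m = (of_nat (4 * m) + 1) / 6"
    using P by (simp add: serre_fps_low_coeffs(2) field_simps)
  then have "fps_nth (extremal_deriv_fps m) m = 1"
    using nz by (simp add: extremal_deriv_fps_def field_simps)
  moreover have "\<forall>n<m. fps_nth (extremal_deriv_fps m) n = 0"
    using P by (simp add: extremal_deriv_fps_def serre_fps_low_coeffs(1)[of m])
  moreover have "quasi_fps (4 * int m + 2) (extremal_deriv_fps m)"
    unfolding extremal_deriv_fps_def by (rule quasi_fps_cmult[OF _ quasi_fps_serre]) (use P in auto)
  ultimately show ?thesis by blast
qed

section \<open>Dimension and uniqueness\<close>

interpretation fv: vector_space fun_scale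
  by (rule vector_space_fun_scale)

lemma fun_add_apply: "f + g = (\<lambda>z. f z + g z)" for f g :: "complex \<Rightarrow> complex"
  by (simp add: plus_fun_def)

definition q_coeff :: "nat \<Rightarrow> (complex \<Rightarrow> complex) \<Rightarrow> complex" where
  "q_coeff n f = fps_nth (THE F. has_q_expansion f F) n"

lemma q_coeff_eq: "has_q_expansion f F \<Longrightarrow> q_coeff n f = fps_nth F n"
  unfolding q_coeff_def by (subst the_equality[of _ F]) (auto intro: has_q_expansion_unique)

lemma q_coeff_add:
  "has_q_expansion f F \<Longrightarrow> has_q_expansion g G \<Longrightarrow> q_coeff n (f + g) = q_coeff n f + q_coeff n g"
  by (simp add: fun_add_apply q_coeff_eq[OF has_q_expansion_add] q_coeff_eq)

lemma q_coeff_scale: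
  "has_q_expansion f F \<Longrightarrow> q_coeff n (fun_scale a f) = a * q_coeff n f"
  by (simp add: fun_scale_def q_coeff_eq[OF has_q_expansion_cmult] q_coeff_eq)

lemma subspace_modular_forms:
  assumes k: "even k"
  shows "fv.subspace (modular_forms k)"
proof (rule fv.subspaceI)
  show "0 \<in> modular_forms k"
    using has_q_expansion_0 by (intro modular_formsI[OF k, of _ 0]) (simp_all add: zero_fun_def)
next
  fix f g assume fg: "f \<in> modular_forms k" "g \<in> modular_forms k"
  then obtain F G where "has_q_expansion f F" "has_q_expansion g G"
    using modular_forms_q_expansion by meson
  note FG = this
  show "f + g \<in> modular_forms k" unfolding fun_add_apply
  proof (rule modular_formsI[OF k has_q_expansion_add[OF FG]])
    show "f (- 1 / z) + g (- 1 / z) = z powi k * (f z + g z)" if "z \<in> upper_half_plane" for z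
      unfolding modular_forms_S[OF fg(1) that] modular_forms_S[OF fg(2) that] by (rule distrib_left[symmetric])
  qed (simp add: modular_forms_outside[OF fg(1)] modular_forms_outside[OF fg(2)])
next
  fix c f assume f: "f \<in> modular_forms k"
  then obtain F where F: "has_q_expansion f F"
    using modular_forms_q_expansion by meson
  show "fun_scale c f \<in> modular_forms k" unfolding fun_scale_def
  proof (rule modular_formsI[OF k has_q_expansion_cmult[OF F]])
    show "c * f (- 1 / z) = z powi k * (c * f z)" if "z \<in> upper_half_plane" for z
      unfolding modular_forms_S[OF f that] by (rule mult.left_commute)
  qed (simp add: modular_forms_outside[OF f])
qed

lemma modular_forms_spanned_by_few:
  assumes k: "even k"
  shows "\<exists>B. finite B \<and> card B \<le> modular_dim k \<and> modular_forms (int k) \<subseteq> fv.span B"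
proof (rule fv.subspace_spanned_by_few[where c = q_coeff])
  show "fv.subspace (modular_forms (int k))" using k by (intro subspace_modular_forms) simp
  fix n a f g assume f: "f \<in> modular_forms (int k)"
  obtain F where F: "has_q_expansion f F" using modular_forms_q_expansion[OF f] by blast
  show "q_coeff n (fun_scale a f) = a * q_coeff n f" by (rule q_coeff_scale[OF F])
  show "q_coeff n (f + g) = q_coeff n f + q_coeff n g" if "g \<in> modular_forms (int k)"
    using modular_forms_q_expansion[OF that] q_coeff_add[OF F] by blast
  show "f = 0" if "\<And>n. n < modular_dim k \<Longrightarrow> q_coeff n f = 0"
  proof -
    have "F = 0"
    proof (rule modular_fps_eq_0_modular_dim[OF _ k])
      show "modular_fps (int k) F" using f F by (auto simp: modular_fps_def)
      show "fps_nth F n = 0" if "n < modular_dim k" for n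
        using \<open>\<And>n. n < modular_dim k \<Longrightarrow> q_coeff n f = 0\<close>[OF that] by (simp add: q_coeff_eq[OF F])
    qed
    then have "f z = 0" for z
      using F modular_forms_outside[OF f] by (cases "z \<in> upper_half_plane") (auto simp: has_q_expansion_iff)
    then show ?thesis by (simp add: fun_eq_iff)
  qed
qed

context
  fixes w :: nat
  assumes w: "even w" "w \<ge> 4"
begin

lemma quasimodular_forms_q_expansion:
  assumes "f \<in> quasimodular_forms (int w) 2"
  shows "\<exists>F. has_q_expansion f F"
proof -
  obtain g0 g1 g2 where g: "g0 \<in> modular_forms (int w)" "g1 \<in> modular_forms (int w - 2)"
    "g2 \<in> modular_forms (int w - 4)" and f: "f = (\<lambda>z. g0 z + E2 z * g1 z + E2 z ^ 2 * g2 z)"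
    using assms by (rule quasimodular_formsE)
  obtain G0 G1 G2 where q: "has_q_expansion g0 G0" "has_q_expansion g1 G1" "has_q_expansion g2 G2"
    using g modular_forms_q_expansion by meson
  show ?thesis unfolding f
    by (intro exI[of _ "G0 + E2_fps * G1 + E2_fps ^ 2 * G2"] has_q_expansion_add has_q_expansion_mult
        has_q_expansion_power has_q_expansion_E2 q)
qed

lemma subspace_quasimodular_forms: "fv.subspace (quasimodular_forms (int w) 2)"
proof (rule fv.subspaceI)
  have sub: "fv.subspace (modular_forms (int w - 2 * int l))" for l
    by (rule subspace_modular_forms) (use w in simp)
  show "0 \<in> quasimodular_forms (int w) 2"
    unfolding quasimodular_forms_def using fv.subspace_0[OF sub]
    by (auto intro!: exI[of _ "\<lambda>_. 0"] simp: zero_fun_def)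
  show "f + g \<in> quasimodular_forms (int w) 2"
    if fg: "f \<in> quasimodular_forms (int w) 2" "g \<in> quasimodular_forms (int w) 2" for f g
  proof -
    obtain a b where a: "\<And>l. l \<le> 2 \<Longrightarrow> a l \<in> modular_forms (int w - 2 * int l)"
      "f = (\<lambda>z. \<Sum>l\<le>2. E2 z ^ l * a l z)" and
      b: "\<And>l. l \<le> 2 \<Longrightarrow> b l \<in> modular_forms (int w - 2 * int l)"
      "g = (\<lambda>z. \<Sum>l\<le>2. E2 z ^ l * b l z)"
      using fg unfolding quasimodular_forms_def by blast
    have "f + g = (\<lambda>z. \<Sum>l\<le>2. E2 z ^ l * (a l + b l) z)"
      by (simp add: a(2) b(2) fun_add_apply distrib_left sum.distrib)
    then show ?thesis unfolding quasimodular_forms_def using a(1) b(1) fv.subspace_add[OF sub]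
      by (auto intro!: exI[of _ "\<lambda>l. a l + b l"])
  qed
  show "fun_scale c f \<in> quasimodular_forms (int w) 2" if f: "f \<in> quasimodular_forms (int w) 2" for c f
  proof -
    obtain a where a: "\<And>l. l \<le> 2 \<Longrightarrow> a l \<in> modular_forms (int w - 2 * int l)"
      "f = (\<lambda>z. \<Sum>l\<le>2. E2 z ^ l * a l z)" using f unfolding quasimodular_forms_def by blast
    have "fun_scale c f = (\<lambda>z. \<Sum>l\<le>2. E2 z ^ l * fun_scale c (a l) z)"
      by (simp add: a(2) fun_scale_def sum_distrib_left mult_ac)
    then show ?thesis unfolding quasimodular_forms_def using a(1) fv.subspace_scale[OF sub]
      by (auto intro!: exI[of _ "\<lambda>l. fun_scale c (a l)"])
  qed
qed

text \<open>Spanning sets of the three components, multiplied by 1, \<open>E2\<close> and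
  \<open>E2^2\<close>, are united. This is the upper half of the dimension count; forms of every
  order provide the lower half.\<close>

lemma quasimodular_forms_spanned_by_few:
  "\<exists>B. finite B \<and> card B \<le> w div 4 + 1 \<and> quasimodular_forms (int w) 2 \<subseteq> fv.span B"
proof -
  have "even (w - 2)" "even (w - 4)" using w by simp_all
  with w(1) obtain B0 B1 B2 where
    B: "finite B0" "card B0 \<le> modular_dim w" "modular_forms (int w) \<subseteq> fv.span B0"
    "finite B1" "card B1 \<le> modular_dim (w - 2)" "modular_forms (int (w - 2)) \<subseteq> fv.span B1"
    "finite B2" "card B2 \<le> modular_dim (w - 4)" "modular_forms (int (w - 4)) \<subseteq> fv.span B2"
    using modular_forms_spanned_by_few by meson
  define M where "M h = (\<lambda>g z. h z * g z)" for h :: "complex \<Rightarrow> complex" and g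
  have lin: "Vector_Spaces.linear fun_scale fun_scale (M h)" for h
    by unfold_locales (auto simp: M_def fun_scale_def algebra_simps fun_eq_iff)
  have im: "M h ` V \<subseteq> fv.span (M h ` B)" if "V \<subseteq> fv.span B" for h V B
  proof -
    interpret l: Vector_Spaces.linear fun_scale fun_scale "M h" by (rule lin)
    show ?thesis by (rule l.spans_image[OF that])
  qed
  define B where "B = B0 \<union> (M E2 ` B1 \<union> M (\<lambda>z. E2 z ^ 2) ` B2)"
  have "card B \<le> card B0 + (card (M E2 ` B1) + card (M (\<lambda>z. E2 z ^ 2) ` B2))"
    unfolding B_def by (intro order_trans[OF card_Un_le] add_left_mono card_Un_le)
  also have "\<dots> \<le> modular_dim w + (modular_dim (w - 2) + modular_dim (w - 4))"
    using B by (intro add_mono) (auto intro: order_trans[OF card_image_le])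
  also have "\<dots> \<le> w div 4 + 1" using modular_dim_sum_le[OF w] by simp
  finally have "card B \<le> w div 4 + 1" .
  moreover have "finite B" using B by (simp add: B_def)
  moreover have "quasimodular_forms (int w) 2 \<subseteq> fv.span B"
  proof
    fix f assume "f \<in> quasimodular_forms (int w) 2"
    then obtain g0 g1 g2 where g: "g0 \<in> modular_forms (int w)" "g1 \<in> modular_forms (int w - 2)"
      "g2 \<in> modular_forms (int w - 4)" and f: "f = (\<lambda>z. g0 z + E2 z * g1 z + E2 z ^ 2 * g2 z)"
      by (rule quasimodular_formsE)
    have w': "int w - 2 = int (w - 2)" "int w - 4 = int (w - 4)" using w by simp_all
    have "g0 \<in> fv.span B0" "M E2 g1 \<in> fv.span (M E2 ` B1)"
      "M (\<lambda>z. E2 z ^ 2) g2 \<in> fv.span (M (\<lambda>z. E2 z ^ 2) ` B2)"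
      using g B im unfolding w' by blast+
    then have "g0 \<in> fv.span B" "M E2 g1 \<in> fv.span B" "M (\<lambda>z. E2 z ^ 2) g2 \<in> fv.span B"
      using fv.span_mono[of _ B] unfolding B_def by blast+
    then have "g0 + (M E2 g1 + M (\<lambda>z. E2 z ^ 2) g2) \<in> fv.span B" by (intro fv.span_add)
    also have "g0 + (M E2 g1 + M (\<lambda>z. E2 z ^ 2) g2) = f" by (simp add: f M_def fun_add_apply add.assoc)
    finally show "f \<in> fv.span B" .
  qed
  ultimately show ?thesis by blast
qed

lemma ex_quasi_fps_of_order:
  assumes "j \<le> w div 4"
  shows "\<exists>F. quasi_fps (int w) F \<and> (\<forall>n<j. fps_nth F n = 0) \<and> fps_nth F j = 1"
proof -
  define m where "m = w div 4"
  \<comment> \<open>Choosing weight \<open>4 * j\<close> or \<open>4 * j + 2\<close> according to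
    \<open>w mod 4\<close> leaves a multiple of 4 as missing weight. A power of \<open>E4\<close>
    fills it without changing the order, having constant term 1.\<close>
  define K where "K = (if w mod 4 = 0 then extremal_fps j else extremal_deriv_fps j)"
  have K: "quasi_fps (4 * int j + int (w mod 4)) K" "\<And>n. n < j \<Longrightarrow> fps_nth K n = 0" "fps_nth K j = 1"
  proof -
    have "w mod 4 = 0 \<or> w mod 4 = 2" using w(1) by presburger
    then show "quasi_fps (4 * int j + int (w mod 4)) K" "\<And>n. n < j \<Longrightarrow> fps_nth K n = 0" "fps_nth K j = 1"
      using extremal_fps_properties[of j] extremal_deriv_fps_properties[of j] by (auto simp: K_def)
  qed
  have weight: "4 * int j + int (w mod 4) + int (m - j) * 4 = int w"
  proof -
    have "int w = 4 * int m + int (w mod 4)" unfolding m_def by presburger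
    moreover have "int (m - j) = int m - int j" using assms by (simp add: m_def of_nat_diff)
    ultimately show ?thesis by linarith
  qed
  have "even (w mod 4)" using w(1) by presburger
  then have "even (4 * int j + int (w mod 4))" by simp
  then have "quasi_fps (4 * int j + int (w mod 4) + int (m - j) * 4) (K * E4_fps ^ (m - j))"
    by (rule quasi_fps_mult_modular[OF _ _ K(1) modular_fps_power[OF _ modular_fps_E4]]) simp_all
  then have "quasi_fps (int w) (E4_fps ^ (m - j) * K)" unfolding weight by (simp add: mult.commute)
  moreover have "fps_nth (E4_fps ^ (m - j) * K) j = 1"
    by (subst fps_mult_low_coeffs(2)) (simp_all add: K fps_nth_power_0 E4_fps_nth)
  moreover have "fps_nth (E4_fps ^ (m - j) * K) n = 0" if "n < j" for n
    by (rule fps_mult_low_coeffs(1)[OF K(2) that])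
  ultimately show ?thesis by blast
qed

theorem dim_quasimodular_forms: "cdim (quasimodular_forms (int w) 2) = w div 4 + 1"
  and quasi_fps_eq_0: "\<And>F. quasi_fps (int w) F \<Longrightarrow> (\<And>n. n \<le> w div 4 \<Longrightarrow> fps_nth F n = 0) \<Longrightarrow> F = 0"
proof -
  let ?S = "quasimodular_forms (int w) 2"
  obtain B where B: "finite B" "card B \<le> w div 4 + 1" "?S \<subseteq> fv.span B"
    using quasimodular_forms_spanned_by_few by blast
  have "\<forall>j. \<exists>e. j < w div 4 + 1 \<longrightarrow> e \<in> ?S \<and> (\<forall>n<j. q_coeff n e = 0) \<and> q_coeff j e \<noteq> 0"
  proof
    fix j
    show "\<exists>e. j < w div 4 + 1 \<longrightarrow> e \<in> ?S \<and> (\<forall>n<j. q_coeff n e = 0) \<and> q_coeff j e \<noteq> 0"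
    proof (cases "j \<le> w div 4")
      case True
      then obtain F where F: "quasi_fps (int w) F" "\<forall>n<j. fps_nth F n = 0" "fps_nth F j = 1"
        using ex_quasi_fps_of_order by blast
      then obtain e where e: "e \<in> ?S" "has_q_expansion e F" by (auto simp: quasi_fps_def)
      then show ?thesis using F by (intro exI[of _ e]) (simp add: q_coeff_eq[OF e(2)])
    qed simp
  qed
  then obtain e where e: "\<And>j. j < w div 4 + 1 \<Longrightarrow> e j \<in> ?S"
    "\<And>j n. j < w div 4 + 1 \<Longrightarrow> n < j \<Longrightarrow> q_coeff n (e j) = 0"
    "\<And>j. j < w div 4 + 1 \<Longrightarrow> q_coeff j (e j) \<noteq> 0" by metis
  have add: "q_coeff n (f + g) = q_coeff n f + q_coeff n g" if "f \<in> ?S" "g \<in> ?S" for n f g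
    using quasimodular_forms_q_expansion[OF that(1)] quasimodular_forms_q_expansion[OF that(2)] q_coeff_add by blast
  have sc: "q_coeff n (fun_scale a f) = a * q_coeff n f" if "f \<in> ?S" for n a f
    using quasimodular_forms_q_expansion[OF that] q_coeff_scale by blast
  show "cdim ?S = w div 4 + 1" unfolding cdim_def
    by (rule fv.triangular_family_basis(1)[where c = q_coeff and e = e and B = B and N = "w div 4 + 1"])
       (fact subspace_quasimodular_forms add sc B e)+
  have zero: "f = 0" if "f \<in> ?S" "\<And>n. n < w div 4 + 1 \<Longrightarrow> q_coeff n f = 0" for f
    by (rule fv.triangular_family_basis(2)[where c = q_coeff and e = e and B = B and N = "w div 4 + 1" and S = ?S])
       (fact subspace_quasimodular_forms add sc B e that)+
  fix F assume F: "quasi_fps (int w) F" "\<And>n. n \<le> w div 4 \<Longrightarrow> fps_nth F n = 0"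
  then obtain f where f: "f \<in> ?S" "has_q_expansion f F" by (auto simp: quasi_fps_def)
  have "f = 0" by (rule zero[OF f(1)]) (use F(2) in \<open>simp add: q_coeff_eq[OF f(2)]\<close>)
  then show "F = 0"
    using has_q_expansion_unique[OF f(2) has_q_expansion_0] by simp
qed

text \<open>The order in the definition refers to \<open>cdim\<close>, so the dimension formula must
  first turn it into \<open>w div 4\<close>. The difference of two candidates then vanishes beyond
  the largest possible order.\<close>

lemma normalized_extremal_unique:
  assumes f: "normalized_extremal (int w) 2 f"
    and F: "quasi_fps (int w) F" "\<And>n. n < w div 4 \<Longrightarrow> fps_nth F n = 0" "fps_nth F (w div 4) = 1"
  shows "has_q_expansion f F"
proof -
  from f obtain F' where F': "has_q_expansion f F'" "subdegree F' = w div 4" "fps_nth F' (w div 4) = 1"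
    unfolding normalized_extremal_def dim_quasimodular_forms by auto
  with f have quasi: "quasi_fps (int w) F'" by (auto simp: quasi_fps_def normalized_extremal_def)
  have "F' - F = 0"
  proof (rule quasi_fps_eq_0)
    show "quasi_fps (int w) (F' - F)" by (rule quasi_fps_diff[OF _ quasi F(1)]) (use w in simp)
    show "fps_nth (F' - F) n = 0" if "n \<le> w div 4" for n
    proof (cases "n = w div 4")
      case True
      then show ?thesis by (simp add: F(3) F'(3))
    next
      case False
      then have n: "n < w div 4" using that by simp
      then have "n < subdegree F'" by (simp only: F'(2))
      then have "fps_nth F' n = 0" by (rule nth_less_subdegree_zero)
      then show ?thesis using F(2)[OF n] by simp
    qed
  qed
  then show ?thesis using F'(1) by simp
qed

end

lemma has_q_expansion_fun_eq:
  "has_q_expansion f F \<Longrightarrow> has_q_expansion g F \<Longrightarrow> z \<in> upper_half_plane \<Longrightarrow> f z = g z"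
  by (simp add: has_q_expansion_iff)

theorem proposition6p2:
  fixes f :: "nat \<Rightarrow> complex \<Rightarrow> complex"
  assumes "\<And>w. even w \<Longrightarrow> w \<ge> 4 \<Longrightarrow> normalized_extremal (int w) 2 (f w)"
  shows "(\<forall>z\<in>upper_half_plane. f 4 z = 1 / 288 * (E4 z - (E2 z)\<^sup>2)) \<and>
    (\<forall>w::nat. w \<ge> 4 \<and> w mod 4 = 0 \<longrightarrow>
      (\<forall>z\<in>upper_half_plane.
         f (w + 4) z =
           3 * (of_nat w + 4)\<^sup>2 /
             (16 * (of_nat w + 1) * (of_nat w + 2)\<^sup>2 * (of_nat w + 3)) *
           ((of_nat w + 1) * of_nat w / 36 * E4 z * f w z
              - serre_deriv_iter (int w - 2) 2 (f w) z) \<and>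
         f (w + 2) z =
           6 / (of_nat w + 1) * serre_deriv (int w - 2) (f w) z))"
proof (intro conjI allI impI ballI)
  fix z assume z: "z \<in> upper_half_plane"
  \<comment> \<open>The factor is fixed by \<open>E4 - E2^2 = (240 + 48) q + ...\<close>.\<close>
  have "has_q_expansion (f 4) (fps_const (1/288) * (E4_fps - E2_fps ^ 2))"
  proof (rule normalized_extremal_unique[OF _ _ assms])
    have "modular_fps 4 (fps_const (1/288) * E4_fps)" "modular_fps 2 0" "modular_fps 0 (fps_const (- 1/288))"
      using modular_fps_cmult[OF _ modular_fps_E4] modular_fps_const
        modular_fpsI[OF _ has_q_expansion_0, of 2] by simp_all
    from quasi_fpsI[of 4, simplified, OF this]
    show "quasi_fps (int 4) (fps_const (1/288) * (E4_fps - E2_fps ^ 2))"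
      by (simp add: algebra_simps flip: fps_const_neg)
  qed (simp_all add: E4_fps_nth E2_fps_nth power2_eq_square fps_mult_nth_1')
  moreover have "has_q_expansion (\<lambda>z. 1 / 288 * (E4 z - (E2 z)\<^sup>2)) (fps_const (1/288) * (E4_fps - E2_fps ^ 2))"
    by (intro has_q_expansion_cmult has_q_expansion_diff has_q_expansion_power has_q_expansion_E2 has_q_expansion_E4)
  ultimately show "f 4 z = 1 / 288 * (E4 z - (E2 z)\<^sup>2)" using z by (rule has_q_expansion_fun_eq)
next
  fix w :: nat and z assume w: "w \<ge> 4 \<and> w mod 4 = 0" and z: "z \<in> upper_half_plane"
  define m where "m = w div 4"
  have wm: "w = 4 * m" using w by (auto simp: m_def)
  have m: "m \<ge> 1" using w by (simp add: wm)
  \<comment> \<open>Uniqueness identifies the given extremal forms with the members of the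
    constructed sequence; the recursions then hold by the construction of
    \<open>extremal_fps\<close> and \<open>extremal_deriv_fps\<close>.\<close>
  have F: "has_q_expansion (f w) (extremal_fps m)"
    unfolding wm by (rule normalized_extremal_unique[OF _ _ assms]) (use m extremal_fps_properties[of m] in simp_all)
  have F4: "has_q_expansion (f (w + 4)) (extremal_fps (Suc m))"
    using extremal_fps_properties[of "Suc m"] m
    by (intro normalized_extremal_unique[OF _ _ assms]) (simp_all add: wm add.commute del: extremal_fps.simps)
  have F2: "has_q_expansion (f (w + 2)) (extremal_deriv_fps m)"
  proof (rule normalized_extremal_unique[OF _ _ assms])
    \<comment> \<open>The order required in weight \<open>w + 2\<close> is the same as in weight
      \<open>w\<close>, which is why a single derivative suffices.\<close>
    have "(w + 2) div 4 = m" "int (w + 2) = 4 * int m + 2" unfolding wm by presburger+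
    then show "quasi_fps (int (w + 2)) (extremal_deriv_fps m)" "fps_nth (extremal_deriv_fps m) ((w + 2) div 4) = 1"
      "\<And>n. n < (w + 2) div 4 \<Longrightarrow> fps_nth (extremal_deriv_fps m) n = 0"
      using extremal_deriv_fps_properties[of m] by (simp_all only:)
  qed (use m wm in simp_all)
  have S1: "has_q_expansion (serre_deriv (int w - 2) (f w)) (serre_fps (4 * int m - 2) (extremal_fps m))"
    using has_q_expansion_serre_deriv[OF F] by (simp add: wm)
  have S2: "has_q_expansion (serre_deriv_iter (int w - 2) 2 (f w))
      (serre_fps (4 * int m) (serre_fps (4 * int m - 2) (extremal_fps m)))"
    using has_q_expansion_serre_deriv[OF S1] by (simp add: wm numeral_2_eq_2)
  have "has_q_expansion (\<lambda>z. 3 * (of_nat w + 4)\<^sup>2 /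
             (16 * (of_nat w + 1) * (of_nat w + 2)\<^sup>2 * (of_nat w + 3)) *
           ((of_nat w + 1) * of_nat w / 36 * (E4 z * f w z) - serre_deriv_iter (int w - 2) 2 (f w) z))
     (extremal_fps (Suc m))"
  proof -
    have "extremal_fps (Suc m) = fps_const (3 * (of_nat w + 4)\<^sup>2 /
             (16 * (of_nat w + 1) * (of_nat w + 2)\<^sup>2 * (of_nat w + 3))) *
       (fps_const ((of_nat w + 1) * of_nat w / 36) * (E4_fps * extremal_fps m) -
        serre_fps (4 * int m) (serre_fps (4 * int m - 2) (extremal_fps m)))"
      by (simp add: extremal_step_def wm)
    then show ?thesis
      by (simp only:) (intro has_q_expansion_cmult has_q_expansion_diff has_q_expansion_mult has_q_expansion_E4 F S2)
  qed
  from has_q_expansion_fun_eq[OF F4 this z]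
  show "f (w + 4) z = 3 * (of_nat w + 4)\<^sup>2 /
             (16 * (of_nat w + 1) * (of_nat w + 2)\<^sup>2 * (of_nat w + 3)) *
           ((of_nat w + 1) * of_nat w / 36 * E4 z * f w z
              - serre_deriv_iter (int w - 2) 2 (f w) z)"
    by (simp only: mult.assoc)
  have "has_q_expansion (\<lambda>z. 6 / (of_nat w + 1) * serre_deriv (int w - 2) (f w) z) (extremal_deriv_fps m)"
    using has_q_expansion_cmult[OF S1, of "6 / (of_nat w + 1)"] by (simp add: extremal_deriv_fps_def wm)
  from has_q_expansion_fun_eq[OF F2 this z]
  show "f (w + 2) z = 6 / (of_nat w + 1) * serre_deriv (int w - 2) (f w) z" .
qed

end
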